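(* If $\mathcal F$ is a countably based pro-saturated fusion system on a pro-$p$ group $S$, then $\mathcal F$ is saturated.
   Context: Fix a prime $p$. All subgroups of profinite groups are closed and all homomorphisms are continuous. Fusion systems. A fusion system on a finite $p$-group $S$ is a category $\mathcal F$ whose objects are all subgroups of $S$ and whose morphisms are injective group homomorphisms, such that (a) $\mathcal F$ contains every homomorphism between subgroups induced by conjugation by an element of $S$; (b) every morphism of $\mathcal F$ factors as an isomorphism in $\mathcal F$ followed by an inclusion. A morphism from a fusion system $\mathcal F$ on $S$ to a fusion system $\mathcal G$ on $T$ is a group homomorphism $\alpha:S\to T$ for which there is a (necessarily unique) functor $A:\mathcal F\to\mathcal G$ with $A(P)=\alpha(P)$ for all $P\le S$ and $\alpha\varphi=A(\varphi)\alpha$ (on $P$) for all $\varphi\in\mathrm{Hom}_{\mathcal F}(P,Q)$. Pro-fusion systems. Given an inverse system of fusion systems $\mathcal F_i$ on finite $p$-groups $S_i$, indexed by a directed set $I$, with morphisms of fusion systems $(f_{i,j},F_{i,j}):\mathcal F_j\to\mathcal F_i$ for $j\ge i$ satisfying $f_{i,j}f_{j,k}=f_{i,k}$, put $S=\varprojlim_i S_i$ with projections $f_i:S\to S_i$. The pro-fusion system $\mathcal F=\varprojlim_i\mathcal F_i$ on the pro-$p$ group $S$ is the category whose objects are the closed subgroups of $S$ and with $\mathrm{Hom}_{\mathcal F}(P,Q)=\varprojlim_i\mathrm{Hom}_{\mathcal F_i}(f_i(P),f_i(Q))$, whose elements are regarded as homomorphisms $P\to Q$; thus $\mathrm{Aut}_{\mathcal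 F}(P)$ is a profinite group. Morphisms and isomorphisms of pro-fusion systems are defined by the same conditions as for fusion systems. Saturation of a pro-fusion system $\mathcal F$ on $S$ (a fusion system on a finite $p$-group being a special case). Let $\mathrm{Aut}_S(Q)$ be the image of $N_S(Q)$ in $\mathrm{Aut}_{\mathcal F}(Q)$. For an isomorphism $\varphi:R\to Q$ in $\mathcal F$ let $N_\varphi=\{x\in N_S(R)\mid \exists y\in N_S(Q):\ \varphi(xux^{-1})=y\varphi(u)y^{-1}\ \forall u\in R\}$. $Q$ is receptive in $\mathcal F$ if for all $R\le S$ and all isomorphisms $\varphi:R\to Q$ in $\mathcal F$ there is a morphism $\tilde\varphi:N_\varphi\to N_S(Q)$ in $\mathcal F$ with $\tilde\varphi|_R=\varphi$. $Q$ is fully normalized in $\mathcal F$ if it is receptive and $\mathrm{Aut}_S(Q)$ is a Sylow pro-$p$ subgroup of $\mathrm{Aut}_{\mathcal F}(Q)$. $\mathcal F$ is saturated if every $\mathcal F$-isomorphism class of subgroups of $S$ contains a subgroup that is fully normalized in $\mathcal F$. A pro-fusion system is pro-saturated if it is isomorphic to an inverse limit of saturated fusion systems on finite $p$-groups. It is countably based if it is isomorphic to an inverse limit of fusion systems on finite $p$-groups indexed by the natural numbers with the usual ordering. *)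

theory Defs
  imports
    "HOL-Algebra.Product_Groups"
    "HOL-Algebra.Group_Action"
    "HOL-Analysis.Analysis"
begin

section \<open>Profinite groups\<close>

definition profinite_group :: "'a monoid \<Rightarrow> 'a topology \<Rightarrow> bool" where
  "profinite_group G T \<longleftrightarrow>
     group G \<and> topspace T = carrier G \<and>
     continuous_map (prod_topology T T) T (\<lambda>(x, y). x \<otimes>\<^bsub>G\<^esub> y) \<and>
     continuous_map T T (\<lambda>x. inv\<^bsub>G\<^esub> x) \<and>
     compact_space T \<and> Hausdorff_space T \<and>
     (\<forall>C. connectedin T C \<longrightarrow> (\<exists>x. C \<subseteq> {x}))"

definition pro_p_group :: "nat \<Rightarrow> 'a monoid \<Rightarrow> 'a topology \<Rightarrow> bool" where
  "pro_p_group p G T \<longleftrightarrow>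
     profinite_group G T \<and>
     (\<forall>N. N \<lhd> G \<and> openin T N \<longrightarrow> (\<exists>k. card (rcosets\<^bsub>G\<^esub> N) = p ^ k))"

text \<open>
  A Sylow pro-\<open>p\<close> subgroup is a closed pro-\<open>p\<close> subgroup whose index, as a supernatural
  number, is prime to \<open>p\<close>. The supernatural index of \<open>H\<close> in \<open>G\<close> is the least common multiple
  of the indices of \<open>HN\<close> in \<open>G\<close>, for \<open>N\<close> an open normal subgroup of \<open>G\<close>.
\<close>

definition sylow_pro_p :: "nat \<Rightarrow> 'a monoid \<Rightarrow> 'a topology \<Rightarrow> 'a set \<Rightarrow> bool" where
  "sylow_pro_p p G T H \<longleftrightarrow>
     subgroup H G \<and> closedin T H \<and>
     pro_p_group p (G\<lparr>carrier := H\<rparr>) (subtopology T H) \<and>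
     (\<forall>N. N \<lhd> G \<and> openin T N \<longrightarrow> \<not> p dvd card (rcosets\<^bsub>G\<^esub> (H <#>\<^bsub>G\<^esub> N)))"


section \<open>Fusion systems and their morphisms\<close>

text \<open>
  Fusion systems on finite \<open>p\<close>-groups and pro-fusion systems share one representation: a
  topological group, its \<open>Hom\<close> sets, and a topology on each \<open>Hom\<close> set. All topologies are
  discrete in the finite case, so that ``closed subgroup'' then just means ``subgroup''.
  A morphism from \<open>P\<close> to \<open>Q\<close> is a function that is \<open>undefined\<close> outside \<open>P\<close>.
\<close>

record 'a fusion =
  Grp :: "'a monoid"
  Top :: "'a topology"
  Hom :: "'a set \<Rightarrow> 'a set \<Rightarrow> ('a \<Rightarrow> 'a) set"
  HomTop :: "'a set \<Rightarrow> 'a set \<Rightarrow> ('a \<Rightarrow> 'a) topology"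

definition Obj :: "'a fusion \<Rightarrow> 'a set set" where
  "Obj \<F> = {P. subgroup P (Grp \<F>) \<and> closedin (Top \<F>) P}"

definition conj_by :: "'a fusion \<Rightarrow> 'a \<Rightarrow> 'a \<Rightarrow> 'a" where
  "conj_by \<F> x u = x \<otimes>\<^bsub>Grp \<F>\<^esub> u \<otimes>\<^bsub>Grp \<F>\<^esub> inv\<^bsub>Grp \<F>\<^esub> x"

definition Iso :: "'a fusion \<Rightarrow> 'a set \<Rightarrow> 'a set \<Rightarrow> ('a \<Rightarrow> 'a) set" where
  "Iso \<F> P Q = {\<phi> \<in> Hom \<F> P Q.
     \<exists>\<psi> \<in> Hom \<F> Q P. compose P \<psi> \<phi> = (\<lambda>u\<in>P. u) \<and> compose Q \<phi> \<psi> = (\<lambda>u\<in>Q. u)}"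

definition finite_fusion_system :: "nat \<Rightarrow> 'a fusion \<Rightarrow> bool" where
  "finite_fusion_system p \<F> \<longleftrightarrow>
     group (Grp \<F>) \<and> finite (carrier (Grp \<F>)) \<and> (\<exists>n. Coset.order (Grp \<F>) = p ^ n) \<and>
     Top \<F> = discrete_topology (carrier (Grp \<F>)) \<and>
     (\<forall>P Q. HomTop \<F> P Q = discrete_topology (Hom \<F> P Q)) \<and>
     (\<forall>P Q. \<forall>\<phi> \<in> Hom \<F> P Q.
        P \<in> Obj \<F> \<and> Q \<in> Obj \<F> \<and> \<phi> \<in> extensional P \<and> inj_on \<phi> P \<and>
        \<phi> \<in> hom ((Grp \<F>)\<lparr>carrier := P\<rparr>) ((Grp \<F>)\<lparr>carrier := Q\<rparr>)) \<and>
     (\<forall>P \<in> Obj \<F>. (\<lambda>u\<in>P. u) \<in> Hom \<F> P P) \<and>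
     (\<forall>P Q R. \<forall>\<phi> \<in> Hom \<F> P Q. \<forall>\<psi> \<in> Hom \<F> Q R. compose P \<psi> \<phi> \<in> Hom \<F> P R) \<and>
     (\<forall>P \<in> Obj \<F>. \<forall>Q \<in> Obj \<F>. \<forall>x \<in> carrier (Grp \<F>).
        conj_by \<F> x ` P \<subseteq> Q \<longrightarrow> (\<lambda>u\<in>P. conj_by \<F> x u) \<in> Hom \<F> P Q) \<and>
     (\<forall>P Q. \<forall>\<phi> \<in> Hom \<F> P Q.
        \<exists>R \<in> Obj \<F>. R \<subseteq> Q \<and> (\<exists>\<psi> \<in> Iso \<F> P R. \<phi> = compose P (\<lambda>u\<in>R. u) \<psi>))"

text \<open>
  \<open>A P Q\<close> is the action on \<open>Hom \<F> P Q\<close> of the functor that accompanies \<open>\<alpha>\<close>.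
\<close>

definition fusion_functor ::
  "'a fusion \<Rightarrow> 'b fusion \<Rightarrow> ('a \<Rightarrow> 'b) \<Rightarrow> ('a set \<Rightarrow> 'a set \<Rightarrow> ('a \<Rightarrow> 'a) \<Rightarrow> ('b \<Rightarrow> 'b)) \<Rightarrow> bool"
where
  "fusion_functor \<F> \<G> \<alpha> A \<longleftrightarrow>
     (\<forall>P \<in> Obj \<F>. \<alpha> ` P \<in> Obj \<G>) \<and>
     (\<forall>P \<in> Obj \<F>. \<forall>Q \<in> Obj \<F>. \<forall>\<phi> \<in> Hom \<F> P Q. A P Q \<phi> \<in> Hom \<G> (\<alpha> ` P) (\<alpha> ` Q)) \<and>
     (\<forall>P \<in> Obj \<F>. A P P (\<lambda>u\<in>P. u) = (\<lambda>v\<in>\<alpha> ` P. v)) \<and>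
     (\<forall>P \<in> Obj \<F>. \<forall>Q \<in> Obj \<F>. \<forall>R \<in> Obj \<F>. \<forall>\<phi> \<in> Hom \<F> P Q. \<forall>\<psi> \<in> Hom \<F> Q R.
        A P R (compose P \<psi> \<phi>) = compose (\<alpha> ` P) (A Q R \<psi>) (A P Q \<phi>)) \<and>
     (\<forall>P \<in> Obj \<F>. \<forall>Q \<in> Obj \<F>. \<forall>\<phi> \<in> Hom \<F> P Q. \<forall>u \<in> P. \<alpha> (\<phi> u) = A P Q \<phi> (\<alpha> u))"

definition fusion_morphism_with ::
  "'a fusion \<Rightarrow> 'b fusion \<Rightarrow> ('a \<Rightarrow> 'b) \<Rightarrow> ('a set \<Rightarrow> 'a set \<Rightarrow> ('a \<Rightarrow> 'a) \<Rightarrow> ('b \<Rightarrow> 'b)) \<Rightarrow> bool"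
where
  "fusion_morphism_with \<F> \<G> \<alpha> A \<longleftrightarrow>
     \<alpha> \<in> hom (Grp \<F>) (Grp \<G>) \<and> continuous_map (Top \<F>) (Top \<G>) \<alpha> \<and> fusion_functor \<F> \<G> \<alpha> A"

definition fusion_morphism :: "'a fusion \<Rightarrow> 'b fusion \<Rightarrow> ('a \<Rightarrow> 'b) \<Rightarrow> bool" where
  "fusion_morphism \<F> \<G> \<alpha> \<longleftrightarrow> (\<exists>A. fusion_morphism_with \<F> \<G> \<alpha> A)"

definition fusion_isomorphic :: "'a fusion \<Rightarrow> 'b fusion \<Rightarrow> bool" where
  "fusion_isomorphic \<F> \<G> \<longleftrightarrow>
     (\<exists>\<alpha> \<beta>. fusion_morphism \<F> \<G> \<alpha> \<and> fusion_morphism \<G> \<F> \<beta> \<and>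
        (\<forall>x \<in> carrier (Grp \<F>). \<beta> (\<alpha> x) = x) \<and> (\<forall>y \<in> carrier (Grp \<G>). \<alpha> (\<beta> y) = y))"


section \<open>Inverse systems and pro-fusion systems\<close>

definition directed_set :: "'i set \<Rightarrow> ('i \<Rightarrow> 'i \<Rightarrow> bool) \<Rightarrow> bool" where
  "directed_set I r \<longleftrightarrow>
     I \<noteq> {} \<and> (\<forall>i\<in>I. r i i) \<and>
     (\<forall>i\<in>I. \<forall>j\<in>I. \<forall>k\<in>I. r i j \<longrightarrow> r j k \<longrightarrow> r i k) \<and>
     (\<forall>i\<in>I. \<forall>j\<in>I. \<exists>k\<in>I. r i k \<and> r j k)"

text \<open>
  Here \<open>r i j\<close> stands for \<open>i \<le> j\<close>, and then \<open>(f i j, A i j)\<close> is a morphism from \<open>\<F> j\<close>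
  to \<open>\<F> i\<close>.
\<close>

definition inverse_system ::
  "nat \<Rightarrow> 'i set \<Rightarrow> ('i \<Rightarrow> 'i \<Rightarrow> bool) \<Rightarrow> ('i \<Rightarrow> 'a fusion) \<Rightarrow> ('i \<Rightarrow> 'i \<Rightarrow> 'a \<Rightarrow> 'a) \<Rightarrow>
   ('i \<Rightarrow> 'i \<Rightarrow> 'a set \<Rightarrow> 'a set \<Rightarrow> ('a \<Rightarrow> 'a) \<Rightarrow> ('a \<Rightarrow> 'a)) \<Rightarrow> bool"
where
  "inverse_system p I r \<F> f A \<longleftrightarrow>
     directed_set I r \<and>
     (\<forall>i\<in>I. finite_fusion_system p (\<F> i)) \<and>
     (\<forall>i\<in>I. \<forall>j\<in>I. r i j \<longrightarrow> fusion_morphism_with (\<F> j) (\<F> i) (f i j) (A i j)) \<and>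
     (\<forall>i\<in>I. \<forall>x\<in>carrier (Grp (\<F> i)). f i i x = x) \<and>
     (\<forall>i\<in>I. \<forall>j\<in>I. \<forall>k\<in>I. r i j \<longrightarrow> r j k \<longrightarrow>
        (\<forall>x\<in>carrier (Grp (\<F> k)). f i j (f j k x) = f i k x))"

definition lim_carrier ::
  "'i set \<Rightarrow> ('i \<Rightarrow> 'i \<Rightarrow> bool) \<Rightarrow> ('i \<Rightarrow> 'a fusion) \<Rightarrow> ('i \<Rightarrow> 'i \<Rightarrow> 'a \<Rightarrow> 'a) \<Rightarrow> ('i \<Rightarrow> 'a) set"
where
  "lim_carrier I r \<F> f =
     {x \<in> (\<Pi>\<^sub>E i\<in>I. carrier (Grp (\<F> i))). \<forall>i\<in>I. \<forall>j\<in>I. r i j \<longrightarrow> f i j (x j) = x i}"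

definition lim_group ::
  "'i set \<Rightarrow> ('i \<Rightarrow> 'i \<Rightarrow> bool) \<Rightarrow> ('i \<Rightarrow> 'a fusion) \<Rightarrow> ('i \<Rightarrow> 'i \<Rightarrow> 'a \<Rightarrow> 'a) \<Rightarrow> ('i \<Rightarrow> 'a) monoid"
where
  "lim_group I r \<F> f =
     (product_group I (\<lambda>i. Grp (\<F> i)))\<lparr>carrier := lim_carrier I r \<F> f\<rparr>"

definition lim_topology ::
  "'i set \<Rightarrow> ('i \<Rightarrow> 'i \<Rightarrow> bool) \<Rightarrow> ('i \<Rightarrow> 'a fusion) \<Rightarrow> ('i \<Rightarrow> 'i \<Rightarrow> 'a \<Rightarrow> 'a) \<Rightarrow> ('i \<Rightarrow> 'a) topology"
where
  "lim_topology I r \<F> f =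
     subtopology (product_topology (\<lambda>i. Top (\<F> i)) I) (lim_carrier I r \<F> f)"

abbreviation proj_image :: "'i \<Rightarrow> ('i \<Rightarrow> 'a) set \<Rightarrow> 'a set" where
  "proj_image i P \<equiv> (\<lambda>x. x i) ` P"

text \<open>
  The elements of the inverse limit of the sets \<open>Hom (\<F> i) (f\<^sub>i P) (f\<^sub>i Q)\<close> are compatible
  families; \<open>realize\<close> turns such a family into the function from \<open>P\<close> to \<open>Q\<close> that it stands
  for. On the compatible families, \<open>realize\<close> is injective, because a member of a family is
  determined by its values on \<open>f\<^sub>i P\<close>.
\<close>

definition lim_families ::
  "'i set \<Rightarrow> ('i \<Rightarrow> 'i \<Rightarrow> bool) \<Rightarrow> ('i \<Rightarrow> 'a fusion) \<Rightarrow>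
   ('i \<Rightarrow> 'i \<Rightarrow> 'a set \<Rightarrow> 'a set \<Rightarrow> ('a \<Rightarrow> 'a) \<Rightarrow> ('a \<Rightarrow> 'a)) \<Rightarrow>
   ('i \<Rightarrow> 'a) set \<Rightarrow> ('i \<Rightarrow> 'a) set \<Rightarrow> ('i \<Rightarrow> 'a \<Rightarrow> 'a) set"
where
  "lim_families I r \<F> A P Q =
     {\<Phi> \<in> (\<Pi>\<^sub>E i\<in>I. Hom (\<F> i) (proj_image i P) (proj_image i Q)).
        \<forall>i\<in>I. \<forall>j\<in>I. r i j \<longrightarrow> A i j (proj_image j P) (proj_image j Q) (\<Phi> j) = \<Phi> i}"

definition realize ::
  "'i set \<Rightarrow> ('i \<Rightarrow> 'a) set \<Rightarrow> ('i \<Rightarrow> 'a \<Rightarrow> 'a) \<Rightarrow> (('i \<Rightarrow> 'a) \<Rightarrow> ('i \<Rightarrow> 'a))"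
where
  "realize I P \<Phi> = (\<lambda>x\<in>P. \<lambda>i\<in>I. \<Phi> i (x i))"

definition lim_hom ::
  "'i set \<Rightarrow> ('i \<Rightarrow> 'i \<Rightarrow> bool) \<Rightarrow> ('i \<Rightarrow> 'a fusion) \<Rightarrow> ('i \<Rightarrow> 'i \<Rightarrow> 'a \<Rightarrow> 'a) \<Rightarrow>
   ('i \<Rightarrow> 'i \<Rightarrow> 'a set \<Rightarrow> 'a set \<Rightarrow> ('a \<Rightarrow> 'a) \<Rightarrow> ('a \<Rightarrow> 'a)) \<Rightarrow>
   ('i \<Rightarrow> 'a) set \<Rightarrow> ('i \<Rightarrow> 'a) set \<Rightarrow> (('i \<Rightarrow> 'a) \<Rightarrow> ('i \<Rightarrow> 'a)) set"
where
  "lim_hom I r \<F> f A P Q =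
     {realize I P \<Phi> | \<Phi>. \<Phi> \<in> lim_families I r \<F> A P Q \<and>
        subgroup P (lim_group I r \<F> f) \<and> closedin (lim_topology I r \<F> f) P \<and>
        subgroup Q (lim_group I r \<F> f) \<and> closedin (lim_topology I r \<F> f) Q}"

text \<open>The inverse limit topology, transported along the bijection \<open>realize\<close>.\<close>

definition lim_hom_topology ::
  "'i set \<Rightarrow> ('i \<Rightarrow> 'i \<Rightarrow> bool) \<Rightarrow> ('i \<Rightarrow> 'a fusion) \<Rightarrow> ('i \<Rightarrow> 'i \<Rightarrow> 'a \<Rightarrow> 'a) \<Rightarrow>
   ('i \<Rightarrow> 'i \<Rightarrow> 'a set \<Rightarrow> 'a set \<Rightarrow> ('a \<Rightarrow> 'a) \<Rightarrow> ('a \<Rightarrow> 'a)) \<Rightarrow>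
   ('i \<Rightarrow> 'a) set \<Rightarrow> ('i \<Rightarrow> 'a) set \<Rightarrow> (('i \<Rightarrow> 'a) \<Rightarrow> ('i \<Rightarrow> 'a)) topology"
where
  "lim_hom_topology I r \<F> f A P Q =
     pullback_topology (lim_hom I r \<F> f A P Q)
       (the_inv_into (lim_families I r \<F> A P Q) (realize I P))
       (subtopology
          (product_topology (\<lambda>i. HomTop (\<F> i) (proj_image i P) (proj_image i Q)) I)
          (lim_families I r \<F> A P Q))"

definition inverse_limit ::
  "'i set \<Rightarrow> ('i \<Rightarrow> 'i \<Rightarrow> bool) \<Rightarrow> ('i \<Rightarrow> 'a fusion) \<Rightarrow> ('i \<Rightarrow> 'i \<Rightarrow> 'a \<Rightarrow> 'a) \<Rightarrow>
   ('i \<Rightarrow> 'i \<Rightarrow> 'a set \<Rightarrow> 'a set \<Rightarrow> ('a \<Rightarrow> 'a) \<Rightarrow> ('a \<Rightarrow> 'a)) \<Rightarrow> ('i \<Rightarrow> 'a) fusion"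
where
  "inverse_limit I r \<F> f A =
     \<lparr>Grp = lim_group I r \<F> f,
      Top = lim_topology I r \<F> f,
      Hom = lim_hom I r \<F> f A,
      HomTop = lim_hom_topology I r \<F> f A\<rparr>"

definition pro_fusion_system :: "nat \<Rightarrow> ('i \<Rightarrow> 'a) fusion \<Rightarrow> bool" where
  "pro_fusion_system p \<F> \<longleftrightarrow>
     (\<exists>I r \<G> f A. inverse_system p I r \<G> f A \<and> \<F> = inverse_limit I r \<G> f A)"


section \<open>Saturation\<close>

definition Aut_group :: "'a fusion \<Rightarrow> 'a set \<Rightarrow> ('a \<Rightarrow> 'a) monoid" where
  "Aut_group \<F> P = \<lparr>carrier = Iso \<F> P P, monoid.mult = compose P, one = (\<lambda>u\<in>P. u)\<rparr>"

definition Aut_topology :: "'a fusion \<Rightarrow> 'a set \<Rightarrow> ('a \<Rightarrow> 'a) topology" where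
  "Aut_topology \<F> P = subtopology (HomTop \<F> P P) (Iso \<F> P P)"

definition Aut_S :: "'a fusion \<Rightarrow> 'a set \<Rightarrow> ('a \<Rightarrow> 'a) set" where
  "Aut_S \<F> Q = (\<lambda>x. \<lambda>u\<in>Q. conj_by \<F> x u) ` normalizer (Grp \<F>) Q"

definition N_phi :: "'a fusion \<Rightarrow> 'a set \<Rightarrow> 'a set \<Rightarrow> ('a \<Rightarrow> 'a) \<Rightarrow> 'a set" where
  "N_phi \<F> R Q \<phi> =
     {x \<in> normalizer (Grp \<F>) R. \<exists>y \<in> normalizer (Grp \<F>) Q.
        \<forall>u\<in>R. \<phi> (conj_by \<F> x u) = conj_by \<F> y (\<phi> u)}"

definition receptive :: "'a fusion \<Rightarrow> 'a set \<Rightarrow> bool" where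
  "receptive \<F> Q \<longleftrightarrow>
     (\<forall>R \<in> Obj \<F>. \<forall>\<phi> \<in> Iso \<F> R Q.
        \<exists>\<psi> \<in> Hom \<F> (N_phi \<F> R Q \<phi>) (normalizer (Grp \<F>) Q). \<forall>u\<in>R. \<psi> u = \<phi> u)"

definition fully_normalized :: "nat \<Rightarrow> 'a fusion \<Rightarrow> 'a set \<Rightarrow> bool" where
  "fully_normalized p \<F> Q \<longleftrightarrow>
     receptive \<F> Q \<and> sylow_pro_p p (Aut_group \<F> Q) (Aut_topology \<F> Q) (Aut_S \<F> Q)"

definition saturated :: "nat \<Rightarrow> 'a fusion \<Rightarrow> bool" where
  "saturated p \<F> \<longleftrightarrow>
     (\<forall>P \<in> Obj \<F>. \<exists>Q \<in> Obj \<F>. Iso \<F> P Q \<noteq> {} \<and> fully_normalized p \<F> Q)"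

text \<open>
  The type arguments name the type \<open>'j\<close> of indices and the type \<open>'b\<close> in which the underlying
  sets of the finite \<open>p\<close>-groups live, as these types cannot be quantified existentially.
\<close>

definition pro_saturated :: "'j itself \<Rightarrow> 'b itself \<Rightarrow> nat \<Rightarrow> 'a fusion \<Rightarrow> bool" where
  "pro_saturated _ _ p \<F> \<longleftrightarrow>
     (\<exists>(I :: 'j set) r (\<G> :: 'j \<Rightarrow> 'b fusion) f A.
        inverse_system p I r \<G> f A \<and> (\<forall>i\<in>I. saturated p (\<G> i)) \<and>
        fusion_isomorphic \<F> (inverse_limit I r \<G> f A))"

definition countably_based :: "'c itself \<Rightarrow> nat \<Rightarrow> 'a fusion \<Rightarrow> bool" where
  "countably_based _ p \<F> \<longleftrightarrow>
     (\<exists>(\<G> :: nat \<Rightarrow> 'c fusion) f A.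
        inverse_system p UNIV (\<le>) \<G> f A \<and>
        fusion_isomorphic \<F> (inverse_limit UNIV (\<le>) \<G> f A))"

end

theory Submission
  imports Defs "HOL-Algebra.Zassenhaus"
begin

text \<open>
  Write \<open>S\<close> as the inverse limit of finite \<open>p\<close>-groups \<open>S\<^sub>j\<close> carrying saturated fusion systems
  \<open>\<F>\<^sub>j\<close>, with maps \<open>a j\<close> from \<open>S\<close> to \<open>S\<^sub>j\<close> that need not be surjective. Given a closed
  subgroup \<open>P\<close>, choose for each \<open>m\<close> an isomorphism \<open>\<theta>\<^sub>m\<close> in \<open>\<F>\<^sub>m\<close> from the image of \<open>P\<close> to
  a fully normalized subgroup \<open>X\<^sub>m\<close>. These choices are not compatible, but at each level \<open>j\<close>
  the images of \<open>\<theta>\<^sub>m\<close> and of the normalizer of \<open>X\<^sub>m\<close> range over a finite set, so by compactness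
  there is a compatible family of values each of which is attained for cofinally many \<open>m\<close>. The
  family of isomorphisms has a limit \<open>P \<rightarrow> Q\<close> in \<open>\<F>\<close>, and \<open>Q\<close> is fully normalized. Indeed,
  \<open>X\<^sub>m\<close> and the image of \<open>Q\<close> in \<open>S\<^sub>m\<close> are isomorphic by a map that is trivial at level \<open>j\<close>, for
  cofinally many \<open>m\<close>. Hence the Sylow property of \<open>Aut\<^sub>S(Q)\<close> can be read off from \<open>X\<^sub>m\<close>, because
  images of Sylow subgroups are Sylow subgroups. An extension of a given isomorphism onto \<open>Q\<close>
  exists at each level because \<open>X\<^sub>m\<close> is receptive, after a correction by an automorphism that
  is trivial at level \<open>j\<close>; the level-wise extensions form an inverse system of finite nonempty
  sets.
\<close>

section \<open>Directed inverse limits of finite sets\<close>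

text \<open>The obstacle is that full normalization is not compatible with the maps between levels:
  the image of a fully normalized subgroup need not be fully normalized, and the image of its
  normalizer may be smaller than the normalizer of its image. This is why the image of the
  normalizer is stabilized together with the isomorphism: a compatible family in the stable sets
  lifts to an element that normalizes \<open>Q\<close>, which makes \<open>Aut_S F Q\<close> large
  enough at every level. That it is not too large is a matter of orders, as its image is a
  \<open>p\<close>-group that already contains a Sylow subgroup. The indices \<open>m\<close> for
  which the comparison with \<open>X m\<close> is trivial at level \<open>j\<close> depend on
  \<open>j\<close>. So every property of \<open>Q\<close> is shown for its image at one fixed level
  and passes to \<open>Q\<close> by closedness or by a further inverse limit of finite sets.
  Cofinality is essential, because the automorphism group of the image of \<open>Q\<close> at level
  \<open>m\<close> is known to induce on level \<open>j\<close> the same maps as that of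
  \<open>Q\<close> only when \<open>m\<close> is large.\<close>

lemma directed_set_ub2:
  assumes "directed_set J r" "i \<in> J" "j \<in> J"
  obtains k where "k \<in> J" "r i k" "r j k"
proof -
  have "\<forall>i\<in>J. \<forall>j\<in>J. \<exists>k\<in>J. r i k \<and> r j k" using assms(1) unfolding directed_set_def by (elim conjE) assumption
  then show thesis using that assms(2,3) by fast
qed

lemma directed_set_refl: "directed_set J r \<Longrightarrow> i \<in> J \<Longrightarrow> r i i"
  unfolding directed_set_def by (elim conjE) fast

lemma directed_set_trans:
  assumes "directed_set J r" "i \<in> J" "j \<in> J" "k \<in> J" "r i j" "r j k"
  shows "r i k"
proof -
  have "\<forall>i\<in>J. \<forall>j\<in>J. \<forall>k\<in>J. r i j \<longrightarrow> r j k \<longrightarrow> r i k"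
    using assms(1) unfolding directed_set_def by (elim conjE) assumption
  then show ?thesis using assms(2-6) by fast
qed

lemma directed_set_nonempty: "directed_set J r \<Longrightarrow> J \<noteq> {}"
  unfolding directed_set_def by (elim conjE)

lemma directed_set_finite_ub:
  assumes "directed_set J r" "finite K" "K \<subseteq> J"
  shows "\<exists>k\<in>J. \<forall>i\<in>K. r i k"
  using assms(2,3)
proof (induction K)
  case empty
  then show ?case using directed_set_nonempty[OF assms(1)] by auto
next
  case (insert x K)
  then obtain k where k: "k \<in> J" "\<forall>i\<in>K. r i k" by auto
  have x: "x \<in> J" using insert.prems by simp
  obtain l where l: "l \<in> J" "r x l" "r k l" using directed_set_ub2[OF assms(1) x k(1)] .
  have "r i l" if "i \<in> K" for i
    using directed_set_trans[OF assms(1) _ k(1) l(1) _ l(3)] that k(2) insert.prems by auto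
  then show ?case using l by auto
qed

text \<open>In the product of the finite discrete sets \<open>X j\<close>, which is compact, each
  single condition \<open>g i j (x j) = x i\<close> is closed. Finitely many conditions involve
  finitely many indices and are met by pushing down one element of \<open>X k\<close> for an upper
  bound \<open>k\<close> of them; the finite intersection property does the rest.\<close>

lemma finite_inverse_limit_nonempty:
  fixes X :: "'i \<Rightarrow> 'x set"
  assumes dir: "directed_set J r"
    and fin: "\<And>j. j \<in> J \<Longrightarrow> finite (X j)"
    and ne: "\<And>j. j \<in> J \<Longrightarrow> X j \<noteq> {}"
    and map: "\<And>i j x. \<lbrakk>i \<in> J; j \<in> J; r i j; x \<in> X j\<rbrakk> \<Longrightarrow> g i j x \<in> X i"
    and comp: "\<And>i j k x. \<lbrakk>i \<in> J; j \<in> J; k \<in> J; r i j; r j k; x \<in> X k\<rbrakk>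
      \<Longrightarrow> g i j (g j k x) = g i k x"
  shows "\<exists>x. (\<forall>j\<in>J. x j \<in> X j) \<and> (\<forall>i\<in>J. \<forall>j\<in>J. r i j \<longrightarrow> g i j (x j) = x i)"
proof -
  define T where "T = product_topology (\<lambda>j. discrete_topology (X j)) J"
  have topT: "topspace T = (\<Pi>\<^sub>E j\<in>J. X j)" by (simp add: T_def)
  have "compact_space T"
    unfolding T_def by (simp add: compact_space_product_topology compact_space_discrete_topology fin)
  define C where "C = (\<lambda>(i, j). {x \<in> topspace T. g i j (x j) = x i})"
  define E where "E = {(i, j). i \<in> J \<and> j \<in> J \<and> r i j}"
  have clC: "closedin T (C e)" if eE: "e \<in> E" for e
  proof -
    obtain i j where e: "e = (i, j)" "i \<in> J" "j \<in> J" "r i j" using eE unfolding E_def by blast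
    have 1: "continuous_map T (discrete_topology (X i)) (\<lambda>x. x i)"
      unfolding T_def by (rule continuous_map_product_projection) (rule e)
    have "continuous_map T (discrete_topology (X j)) (\<lambda>x. x j)"
      unfolding T_def by (rule continuous_map_product_projection) (rule e)
    moreover have "continuous_map (discrete_topology (X j)) (discrete_topology (X i)) (g i j)"
      using map e by auto
    ultimately have 2: "continuous_map T (discrete_topology (X i)) (\<lambda>x. g i j (x j))"
      using continuous_map_compose[of T _ "\<lambda>x. x j" _ "g i j"] by (simp add: o_def)
    show ?thesis unfolding C_def e(1) prod.case
      by (rule closedin_continuous_maps_eq[OF _ 2 1]) auto
  qed
  have fip: "\<Inter>\<F> \<noteq> {}" if F: "finite \<F>" "\<F> \<subseteq> insert (topspace T) (C ` E)" for \<F>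
  proof -
    obtain D where D: "D \<subseteq> E" "finite D" "\<F> \<subseteq> insert (topspace T) (C ` D)"
    proof -
      have "finite (\<F> \<inter> C ` E)" "\<F> \<inter> C ` E \<subseteq> C ` E" using F by auto
      from finite_subset_image[OF this] obtain D
        where D: "D \<subseteq> E" "finite D" "\<F> \<inter> C ` E = C ` D" by metis
      have "c \<in> insert (topspace T) (C ` D)" if "c \<in> \<F>" for c
        using F(2) D(3) that by auto
      then show thesis using that D(1,2) by (meson subsetI)
    qed
    define K where "K = fst ` D \<union> snd ` D"
    have "finite K" "K \<subseteq> J" using D by (auto simp: K_def E_def)
    from directed_set_finite_ub[OF dir this]
    obtain k where k: "k \<in> J" "\<forall>i\<in>K. r i k" by blast
    obtain z where z: "z \<in> X k" using ne k by blast
    \<comment> \<open>Coordinates that are not below \<open>k\<close> occur in none of the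
      conditions in \<open>D\<close> and get an arbitrary value.\<close>
    define x where "x = (\<lambda>i\<in>J. if r i k then g i k z else (SOME y. y \<in> X i))"
    have xT: "x \<in> topspace T"
      unfolding topT x_def using map k z ne by (auto simp: some_in_eq)
    have "x \<in> C e" if eD: "e \<in> D" for e
    proof -
      obtain i j where e: "e = (i, j)" "i \<in> J" "j \<in> J" "r i j" using eD D(1) unfolding E_def by blast
      have "i \<in> K" "j \<in> K" using eD e by (force simp: K_def)+
      then have "r i k" "r j k" using k by auto
      then show ?thesis using xT e k z comp by (simp add: C_def x_def)
    qed
    then have "x \<in> \<Inter>\<F>" using D(3) xT by blast
    then show ?thesis by blast
  qed
  have "\<forall>c\<in>insert (topspace T) (C ` E). closedin T c" using clC by auto
  with \<open>compact_space T\<close> fip have "\<Inter>(insert (topspace T) (C ` E)) \<noteq> {}"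
    unfolding compact_space_fip by blast
  then obtain x where x: "x \<in> topspace T" "\<And>e. e \<in> E \<Longrightarrow> x \<in> C e" by blast
  have "x j \<in> X j" if "j \<in> J" for j using x(1) that topT by auto
  moreover have "g i j (x j) = x i" if "i \<in> J" "j \<in> J" "r i j" for i j
    using x(2)[of "(i, j)"] that by (simp add: C_def E_def)
  ultimately show ?thesis by blast
qed

text \<open>The preimages of \<open>y\<close> in the sets \<open>X k\<close> with \<open>k\<close>
  above \<open>n\<close> again form an inverse system of finite nonempty sets; at the other indices
  the full sets are kept.\<close>

lemma finite_inverse_limit_lift:
  fixes X :: "'i \<Rightarrow> 'x set"
  assumes dir: "directed_set J r"
    and fin: "\<And>j. j \<in> J \<Longrightarrow> finite (X j)"
    and map: "\<And>i j x. \<lbrakk>i \<in> J; j \<in> J; r i j; x \<in> X j\<rbrakk> \<Longrightarrow> g i j x \<in> X i"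
    and comp: "\<And>i j k x. \<lbrakk>i \<in> J; j \<in> J; k \<in> J; r i j; r j k; x \<in> X k\<rbrakk>
      \<Longrightarrow> g i j (g j k x) = g i k x"
    and n: "n \<in> J" and lift: "\<And>k. \<lbrakk>k \<in> J; r n k\<rbrakk> \<Longrightarrow> y \<in> g n k ` X k"
  shows "\<exists>x. (\<forall>j\<in>J. x j \<in> X j) \<and> (\<forall>i\<in>J. \<forall>j\<in>J. r i j \<longrightarrow> g i j (x j) = x i) \<and> x n = y"
proof -
  define Y where "Y = (\<lambda>k. {z \<in> X k. r n k \<longrightarrow> g n k z = y})"
  have "\<exists>x. (\<forall>j\<in>J. x j \<in> Y j) \<and> (\<forall>i\<in>J. \<forall>j\<in>J. r i j \<longrightarrow> g i j (x j) = x i)"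
  proof (rule finite_inverse_limit_nonempty[OF dir, of Y g])
    show "finite (Y j)" if "j \<in> J" for j using fin[OF that] by (simp add: Y_def)
    show "Y j \<noteq> {}" if j: "j \<in> J" for j
    proof -
      obtain k where k: "k \<in> J" "r j k" "r n k" using directed_set_ub2[OF dir j n] .
      obtain z where z: "z \<in> X k" "y = g n k z" using lift[OF k(1,3)] by blast
      have "g j k z \<in> Y j" using map j k z comp n by (auto simp: Y_def)
      then show ?thesis by blast
    qed
    show "g i j x \<in> Y i" if "i \<in> J" "j \<in> J" "r i j" "x \<in> Y j" for i j x
    proof -
      have x: "x \<in> X j" "r n j \<Longrightarrow> g n j x = y" using that(4) by (auto simp: Y_def)
      have "g n i (g i j x) = y" if "r n i"
        using comp[OF n \<open>i \<in> J\<close> \<open>j \<in> J\<close> that \<open>r i j\<close> x(1)]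
          x(2) directed_set_trans[OF dir n \<open>i \<in> J\<close> \<open>j \<in> J\<close> that \<open>r i j\<close>] by simp
      then show ?thesis using map[OF that(1-3) x(1)] by (simp add: Y_def)
    qed
    show "g i j (g j k x) = g i k x"
      if "i \<in> J" "j \<in> J" "k \<in> J" "r i j" "r j k" "x \<in> Y k" for i j k x
      using that comp by (auto simp: Y_def)
  qed
  then obtain x where x: "\<forall>j\<in>J. x j \<in> Y j" "\<forall>i\<in>J. \<forall>j\<in>J. r i j \<longrightarrow> g i j (x j) = x i"
    by blast
  \<comment> \<open>Membership of \<open>x n\<close> in \<open>Y n\<close> says
    \<open>g n n (x n) = y\<close>, and compatibility of \<open>x\<close> removes
    \<open>g n n\<close>, which is not assumed to be the identity.\<close>
  have "x n = y" using x directed_set_refl[OF dir n] n by (auto simp: Y_def)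
  moreover have "x j \<in> X j" if "j \<in> J" for j using x(1) that by (auto simp: Y_def)
  ultimately show ?thesis using x(2) by blast
qed

text \<open>Compatibility and directedness reduce basic open sets to conditions on one coordinate.\<close>

lemma openin_directed_limit:
  assumes dir: "directed_set I r" and C: "C \<subseteq> (\<Pi>\<^sub>E i\<in>I. D i)"
    and T: "\<And>i. i \<in> I \<Longrightarrow> T i = discrete_topology (D i)"
    and compat: "\<And>i j x y. \<lbrakk>i \<in> I; j \<in> I; r i j; x \<in> C; y \<in> C; x j = y j\<rbrakk> \<Longrightarrow> x i = y i"
  shows "openin (subtopology (product_topology T I) C) U \<longleftrightarrow>
    U \<subseteq> C \<and> (\<forall>x\<in>U. \<exists>i\<in>I. \<forall>y\<in>C. y i = x i \<longrightarrow> y \<in> U)" (is "openin ?S U \<longleftrightarrow> ?R")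
proof
  assume "openin ?S U"
  then obtain V where V: "openin (product_topology T I) V" "U = V \<inter> C"
    by (auto simp: openin_subtopology)
  have "\<exists>i\<in>I. \<forall>y\<in>C. y i = x i \<longrightarrow> y \<in> U" if "x \<in> U" for x
  proof -
    have x: "x \<in> V" "x \<in> C" using that V by auto
    obtain W where W: "finite {i \<in> I. W i \<noteq> D i}" "x \<in> Pi\<^sub>E I W" "Pi\<^sub>E I W \<subseteq> V"
      using V(1) x(1) unfolding openin_product_topology_alt using T by (auto cong: conj_cong)
    have "{i \<in> I. W i \<noteq> D i} \<subseteq> I" by auto
    from directed_set_finite_ub[OF dir W(1) this]
    obtain k where k: "k \<in> I" "\<forall>i\<in>{i \<in> I. W i \<noteq> D i}. r i k" by blast
    have "y \<in> U" if y: "y \<in> C" "y k = x k" for y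
    proof -
      have "y i \<in> W i" if i: "i \<in> I" for i
      proof (cases "W i = D i")
        case True then show ?thesis using y C i by auto
      next
        case False
        then have "y i = x i" using compat[of i k y x] k i x y by auto
        then show ?thesis using W(2) i by auto
      qed
      then have "y \<in> Pi\<^sub>E I W" using y C by auto
      then show ?thesis using W(3) V(2) y by blast
    qed
    then show ?thesis using k by blast
  qed
  then show ?R using V by blast
next
  assume R: ?R
  show "openin ?S U"
  proof (subst openin_subopen, intro ballI)
    fix x assume x: "x \<in> U"
    then obtain i where i: "i \<in> I" "\<forall>y\<in>C. y i = x i \<longrightarrow> y \<in> U" using R by blast
    have xC: "x \<in> C" using x R by auto
    have "openin ?S {y \<in> topspace ?S. y i \<in> {x i}}"
    proof (rule openin_continuous_map_preimage)
      have "continuous_map (product_topology T I) (T i) (\<lambda>y. y i)"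
        by (rule continuous_map_product_projection) (rule i(1))
      then show "continuous_map ?S (discrete_topology (D i)) (\<lambda>y. y i)"
        using T[OF i(1)] by (simp add: continuous_map_from_subtopology)
      show "openin (discrete_topology (D i)) {x i}" using xC C i by auto
    qed
    moreover have "(\<Pi>\<^sub>E i\<in>I. topspace (T i)) = (\<Pi>\<^sub>E i\<in>I. D i)" by (rule PiE_cong) (simp add: T)
    then have "topspace ?S = C" using C by auto
    then have "{y \<in> topspace ?S. y i \<in> {x i}} = {y \<in> C. y i = x i}" by simp
    ultimately have "openin ?S {y \<in> C. y i = x i}" by simp
    moreover have "x \<in> {y \<in> C. y i = x i}" "{y \<in> C. y i = x i} \<subseteq> U" using i(2) xC by auto
    ultimately show "\<exists>V. openin ?S V \<and> x \<in> V \<and> V \<subseteq> U" by blast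
  qed
qed

section \<open>Sylow subgroups of finite groups\<close>

text \<open>For a subgroup of order \<open>a\<close> in a group of order \<open>b\<close>, this says that it is Sylow.\<close>

definition sylow_card :: "nat \<Rightarrow> nat \<Rightarrow> nat \<Rightarrow> bool" where
  "sylow_card p a b \<longleftrightarrow> (\<exists>k m. a = p ^ k \<and> b = p ^ k * m \<and> \<not> p dvd m)"

lemma (in group) card_subgroup_dvd:
  assumes "subgroup A G" "subgroup B G" "A \<subseteq> B"
  shows "card A dvd card B"
proof -
  have "group (G\<lparr>carrier := B\<rparr>)" using assms(2) by (rule subgroup_imp_group)
  moreover have "subgroup A (G\<lparr>carrier := B\<rparr>)" using assms by (metis subgroup_incl)
  ultimately have "card (rcosets\<^bsub>G\<lparr>carrier := B\<rparr>\<^esub> A) * card A = Coset.order (G\<lparr>carrier := B\<rparr>)"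
    by (rule group.lagrange)
  then have "card B = card (rcosets\<^bsub>G\<lparr>carrier := B\<rparr>\<^esub> A) * card A"
    by (simp add: Coset.order_def)
  then show ?thesis by simp
qed

text \<open>All fibres of \<open>h\<close> on \<open>K\<close> are translates of the kernel of the
  restriction to \<open>K\<close>.\<close>

lemma (in group_hom) card_hom_image:
  assumes K: "subgroup K G" and fin: "finite K"
  shows "card (h ` K) * card {x \<in> K. h x = \<one>\<^bsub>H\<^esub>} = card K"
proof -
  have KG: "K \<subseteq> carrier G" using K by (rule subgroup.subset)
  have fib: "card {x \<in> K. h x = y} = card {x \<in> K. h x = \<one>\<^bsub>H\<^esub>}" if y: "y \<in> h ` K" for y
  proof -
    obtain x0 where x0: "x0 \<in> K" "y = h x0" using y by blast
    have x0G: "x0 \<in> carrier G" using x0 KG by blast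
    have "bij_betw (\<lambda>k. x0 \<otimes> k) {x \<in> K. h x = \<one>\<^bsub>H\<^esub>} {x \<in> K. h x = y}"
    proof (rule bij_betwI[where g = "\<lambda>x. inv x0 \<otimes> x"])
      show "(\<lambda>k. x0 \<otimes> k) \<in> {x \<in> K. h x = \<one>\<^bsub>H\<^esub>} \<rightarrow> {x \<in> K. h x = y}"
      proof
        fix k assume k: "k \<in> {x \<in> K. h x = \<one>\<^bsub>H\<^esub>}"
        then have "k \<in> carrier G" using KG by blast
        then have "h (x0 \<otimes> k) = y" using k x0 x0G by simp
        then show "x0 \<otimes> k \<in> {x \<in> K. h x = y}" using k x0 subgroup.m_closed[OF K] by simp
      qed
      show "(\<lambda>x. inv x0 \<otimes> x) \<in> {x \<in> K. h x = y} \<rightarrow> {x \<in> K. h x = \<one>\<^bsub>H\<^esub>}"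
      proof
        fix x assume x: "x \<in> {x \<in> K. h x = y}"
        then have "x \<in> carrier G" using KG by blast
        then have "h (inv x0 \<otimes> x) = \<one>\<^bsub>H\<^esub>" using x x0 x0G by simp
        then show "inv x0 \<otimes> x \<in> {x \<in> K. h x = \<one>\<^bsub>H\<^esub>}"
          using x x0(1) subgroup.m_closed[OF K] subgroup.m_inv_closed[OF K] by simp
      qed
      show "inv x0 \<otimes> (x0 \<otimes> x) = x" if "x \<in> {x \<in> K. h x = \<one>\<^bsub>H\<^esub>}" for x
      proof -
        have "x \<in> carrier G" using that KG by blast
        then show ?thesis using x0G by (simp add: G.m_assoc[symmetric])
      qed
      show "x0 \<otimes> (inv x0 \<otimes> x) = x" if "x \<in> {x \<in> K. h x = y}" for x
      proof -
        have "x \<in> carrier G" using that KG by blast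
        then show ?thesis using x0G by (simp add: G.m_assoc[symmetric])
      qed
    qed
    from bij_betw_same_card[OF this] show ?thesis by (rule sym)
  qed
  have "card K = (\<Sum>x\<in>K. 1)" by simp
  also have "\<dots> = (\<Sum>y\<in>h ` K. \<Sum>x\<in>{x \<in> K. h x = y}. 1)"
    using fin by (rule sum.image_gen)
  also have "\<dots> = (\<Sum>y\<in>h ` K. card {x \<in> K. h x = \<one>\<^bsub>H\<^esub>})"
    by (intro sum.cong) (auto simp: fib)
  also have "\<dots> = card (h ` K) * card {x \<in> K. h x = \<one>\<^bsub>H\<^esub>}" by simp
  finally show ?thesis by simp
qed

text \<open>By multiplicativity of orders, the index \<open>m\<close> of \<open>A\<close> is the
  product of the index \<open>q\<close> of its image and the index \<open>s\<close> of the kernel on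
  \<open>A\<close> in the kernel on the whole group. Hence \<open>q\<close> divides a number prime
  to \<open>p\<close>.\<close>

lemma (in group_hom) sylow_card_image:
  assumes p: "prime p" and fin: "finite (carrier G)" and A: "subgroup A G"
    and syl: "sylow_card p (card A) (card (carrier G))"
  shows "sylow_card p (card (h ` A)) (card (h ` carrier G))"
proof -
  obtain k m where km: "card A = p ^ k" "card (carrier G) = p ^ k * m" "\<not> p dvd m"
    using syl by (auto simp: sylow_card_def)
  define KA where "KA = {x \<in> A. h x = \<one>\<^bsub>H\<^esub>}"
  define KG where "KG = {x \<in> carrier G. h x = \<one>\<^bsub>H\<^esub>}"
  have finA: "finite A" using fin A by (meson finite_subset subgroup.subset)
  have 1: "card (h ` A) * card KA = p ^ k" using card_hom_image[OF A finA] km by (simp add: KA_def)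
  have 2: "card (h ` carrier G) * card KG = p ^ k * m"
    using card_hom_image[OF G.subgroup_self fin] km by (simp add: KG_def)
  have KGs: "subgroup KG G" using subgroup_kernel by (simp add: KG_def kernel_def)
  have KAs: "subgroup KA G"
  proof -
    have "KA = A \<inter> KG" using subgroup.subset[OF A] by (auto simp: KA_def KG_def)
    then show ?thesis using G.subgroups_Inter_pair[OF A KGs] by simp
  qed
  have "card KA dvd card KG"
    by (rule G.card_subgroup_dvd[OF KAs KGs]) (use subgroup.subset[OF A] in \<open>auto simp: KA_def KG_def\<close>)
  then obtain s where s: "card KG = card KA * s" by (auto simp: dvd_def)
  have "card (h ` A) dvd card (h ` carrier G)"
    by (rule H.card_subgroup_dvd[OF subgroup_img_is_subgroup[OF A]
          subgroup_img_is_subgroup[OF G.subgroup_self]]) (use subgroup.subset[OF A] in auto)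
  then obtain q where q: "card (h ` carrier G) = card (h ` A) * q" by (auto simp: dvd_def)
  have pk: "p ^ k > 0" using p by (simp add: prime_gt_0_nat)
  have "p ^ k * m = card (h ` A) * q * (card KA * s)" using 2 s q by simp
  also have "\<dots> = (card (h ` A) * card KA) * (q * s)" by (simp add: mult_ac)
  also have "\<dots> = p ^ k * (q * s)" using 1 by simp
  finally have "m = q * s" using pk by (metis mult_left_cancel not_gr_zero)
  then have "\<not> p dvd q" using km(3) by auto
  moreover have "card (h ` A) dvd p ^ k" using 1 by (metis dvd_triv_left)
  then obtain l where "card (h ` A) = p ^ l" using divides_primepow_nat[OF p] by blast
  ultimately show ?thesis using q by (auto simp: sylow_card_def)
qed

text \<open>Orbits have \<open>p\<close>-power size. Without a fixed point none of these sizes is 1,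
  so \<open>p\<close> would divide their sum \<open>card E\<close>.\<close>

lemma (in group_action) p_group_fixed_point:
  assumes p: "prime p" and G: "Coset.order G = p ^ l" and E: "finite E" "\<not> p dvd card E"
  shows "\<exists>x\<in>E. \<forall>g\<in>carrier G. \<phi> g x = x"
proof (rule ccontr)
  assume no: "\<not> ?thesis"
  interpret gr: group G using group_hom group_hom.axioms(1) by auto
  have finG: "finite (carrier G)"
    using G p gr.order_gt_0_iff_finite by (simp add: prime_gt_0_nat)
  have "p dvd card orb" if orb: "orb \<in> orbits G E \<phi>" for orb
  proof -
    obtain x where x: "x \<in> E" "orb = orbit G \<phi> x" using orb by (auto simp: orbits_def)
    have eq: "card (orbit G \<phi> x) * card (stabilizer G \<phi> x) = p ^ l"
      using orbit_stabilizer_theorem[OF x(1)] G by simp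
    then have "card (orbit G \<phi> x) dvd p ^ l" by (metis dvd_triv_left)
    then obtain s where s: "card (orbit G \<phi> x) = p ^ s" using divides_primepow_nat[OF p] by blast
    have "s \<noteq> 0"
    proof
      assume "s = 0"
      then have "card (stabilizer G \<phi> x) = card (carrier G)" using eq s G by (simp add: Coset.order_def)
      then have "stabilizer G \<phi> x = carrier G"
        using stabilizer_subset finG by (intro card_subset_eq) auto
      then have "\<forall>g\<in>carrier G. \<phi> g x = x" by (auto simp: stabilizer_def)
      then show False using no x by blast
    qed
    then show ?thesis using s x by simp
  qed
  then have "p dvd (\<Sum>orb\<in>orbits G E \<phi>. card orb)" by (intro dvd_sum) auto
  also have "(\<Sum>orb\<in>orbits G E \<phi>. card orb) = (\<Sum>orb\<in>orbits G E \<phi>. \<Sum>x\<in>orb. 1)" by simp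
  also have "\<dots> = (\<Sum>x\<in>E. 1)" by (rule disjoint_sum[OF E(1)])
  finally show False using E(2) by simp
qed

lemma (in group) l_coset_eq_iff:
  assumes A: "subgroup A G" and x: "x \<in> carrier G" and y: "y \<in> carrier G"
  shows "x <# A = y <# A \<longleftrightarrow> inv y \<otimes> x \<in> A"
proof
  assume "x <# A = y <# A"
  moreover have "x \<in> x <# A"
    using subgroup.one_closed[OF A] x by (force simp: l_coset_def)
  ultimately obtain a where "a \<in> A" "x = y \<otimes> a" by (auto simp: l_coset_def)
  then show "inv y \<otimes> x \<in> A" using subgroup.subset[OF A] y by (auto simp: m_assoc[symmetric])
next
  assume *: "inv y \<otimes> x \<in> A"
  have "x = y \<otimes> (inv y \<otimes> x)" using x y by (simp add: m_assoc[symmetric])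
  then have "x \<in> y <# A" using * unfolding l_coset_def by blast
  then show "x <# A = y <# A" using l_repr_independence[OF _ y A] by simp
qed

text \<open>The set \<open>W\<close> may consist of some left cosets only. Stability under
  \<open>K\<close> suffices, since the inverse of an element of \<open>K\<close> provides the
  inverse permutation.\<close>

lemma (in group) l_coset_action:
  assumes K: "subgroup K G" and A: "A \<subseteq> carrier G" and W: "W \<subseteq> (\<lambda>u. u <# A) ` carrier G"
    and st: "\<And>k w. k \<in> K \<Longrightarrow> w \<in> W \<Longrightarrow> k <# w \<in> W"
  shows "group_action (G\<lparr>carrier := K\<rparr>) W (\<lambda>k. \<lambda>w\<in>W. k <# w)"
proof -
  have KG: "K \<subseteq> carrier G" using K by (rule subgroup.subset)
  have Wc: "w \<subseteq> carrier G" if w: "w \<in> W" for w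
  proof -
    obtain u where "u \<in> carrier G" "w = u <# A" using w W by blast
    then show ?thesis using l_coset_subset_G[OF A] by simp
  qed
  have asc: "k <# (k' <# w) = (k \<otimes> k') <# w" if "k \<in> K" "k' \<in> K" "w \<in> W" for k k' w
    using that KG Wc by (intro lcos_m_assoc) auto
  have one: "\<one> <# w = w" if "w \<in> W" for w using Wc[OF that] lcos_mult_one by simp
  have bij: "(\<lambda>w\<in>W. k <# w) \<in> Bij W" if k: "k \<in> K" for k
  proof -
    have ik: "inv k \<in> K" using K k by (rule subgroup.m_inv_closed)
    have kG: "k \<in> carrier G" using k KG by blast
    have "bij_betw (\<lambda>w. k <# w) W W"
    proof (rule bij_betwI[where g = "\<lambda>w. inv k <# w"])
      show "(\<lambda>w. k <# w) \<in> W \<rightarrow> W" "(\<lambda>w. inv k <# w) \<in> W \<rightarrow> W" using st k ik by auto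
      show "inv k <# (k <# w) = w" if "w \<in> W" for w
        using asc[OF ik k that] one[OF that] kG by simp
      show "k <# (inv k <# w) = w" if "w \<in> W" for w
        using asc[OF k ik that] one[OF that] kG by simp
    qed
    then show ?thesis by (simp add: Bij_def)
  qed
  have "(\<lambda>k. \<lambda>w\<in>W. k <# w) \<in> hom (G\<lparr>carrier := K\<rparr>) (BijGroup W)"
  proof (rule homI)
    show "(\<lambda>w\<in>W. k <# w) \<in> carrier (BijGroup W)" if "k \<in> carrier (G\<lparr>carrier := K\<rparr>)" for k
      using bij that by (simp add: BijGroup_def)
    show "(\<lambda>w\<in>W. (k \<otimes>\<^bsub>G\<lparr>carrier := K\<rparr>\<^esub> k') <# w) =
      (\<lambda>w\<in>W. k <# w) \<otimes>\<^bsub>BijGroup W\<^esub> (\<lambda>w\<in>W. k' <# w)"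
      if k: "k \<in> carrier (G\<lparr>carrier := K\<rparr>)" "k' \<in> carrier (G\<lparr>carrier := K\<rparr>)" for k k'
    proof -
      have k': "k \<in> K" "k' \<in> K" using k by auto
      then have "(\<lambda>w\<in>W. k <# w) \<otimes>\<^bsub>BijGroup W\<^esub> (\<lambda>w\<in>W. k' <# w) =
        compose W (\<lambda>w\<in>W. k <# w) (\<lambda>w\<in>W. k' <# w)"
        using bij by (simp add: BijGroup_def)
      also have "\<dots> = (\<lambda>w\<in>W. (k \<otimes> k') <# w)"
        using k' st asc by (auto simp: compose_def fun_eq_iff)
      finally show ?thesis by simp
    qed
  qed
  then show ?thesis
    unfolding group_action_def group_hom_def group_hom_axioms_def
    using subgroup_imp_group[OF K] group_BijGroup by blast
qed

text \<open>
  The cosets \<open>u A\<close> with \<open>u \<in> U\<close> are permuted by \<open>K\<close>, and their number divides the index of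
  \<open>A\<close>; a coset fixed by \<open>K\<close> provides the conjugating element.
\<close>

lemma (in group) sylow_conjugate_in_normal:
  assumes p: "prime p" and fin: "finite (carrier G)"
    and A: "subgroup A G" and syl: "sylow_card p (card A) (card (carrier G))"
    and K: "subgroup K G" "card K = p ^ l" and U: "U \<lhd> G"
    and KAU: "\<And>k. k \<in> K \<Longrightarrow> \<exists>a\<in>A. k \<otimes> inv a \<in> U"
  shows "\<exists>u\<in>U. \<forall>k\<in>K. inv u \<otimes> k \<otimes> u \<in> A"
proof -
  have Us: "subgroup U G" using U by (rule normal_imp_subgroup)
  have sub: "A \<subseteq> carrier G" "K \<subseteq> carrier G" "U \<subseteq> carrier G"
    using A K Us by (auto dest: subgroup.subset)
  define W where "W = (\<lambda>u. u <# A) ` U"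
  have finW: "finite W" unfolding W_def using fin sub by (meson finite_imageI finite_subset)
  have st: "k <# w \<in> W" if k: "k \<in> K" and w: "w \<in> W" for k w
  proof -
    obtain u where u: "u \<in> U" "w = u <# A" using w by (auto simp: W_def)
    obtain a where a: "a \<in> A" "k \<otimes> inv a \<in> U" using KAU[OF k] by blast
    have c: "k \<in> carrier G" "u \<in> carrier G" "a \<in> carrier G" using k u a sub by auto
    \<comment> \<open>The coset of \<open>k \<otimes> u\<close> needs a representative in
      \<open>U\<close>. Multiplying on the right by the inverse of \<open>a\<close> does not change
      the coset, and the result is the product of an element of \<open>U\<close> with a conjugate of
      \<open>u\<close>.\<close>
    define v where "v = (k \<otimes> inv a) \<otimes> (a \<otimes> u \<otimes> inv a)"
    have v: "v \<in> U" unfolding v_def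
    proof (rule subgroup.m_closed[OF Us a(2)])
      show "a \<otimes> u \<otimes> inv a \<in> U" using U u(1) c(3) unfolding normal_inv_iff by blast
    qed
    have vc: "v \<in> carrier G" using v sub by auto
    have v': "v = k \<otimes> u \<otimes> inv a" 
    proof -
      have "k \<otimes> inv a \<otimes> a = k" using c by (simp add: m_assoc)
      then show ?thesis unfolding v_def using c by (simp add: m_assoc[symmetric])
    qed
    have "inv (w \<otimes> inv a) \<otimes> w = a" if "w \<in> carrier G" for w
      using that c by (simp add: inv_mult_group m_assoc)
    from this[of "k \<otimes> u"] have "inv v \<otimes> (k \<otimes> u) = a" using c v' by simp
    then have "(k \<otimes> u) <# A = v <# A" using l_coset_eq_iff[OF A _ vc] c a by simp
    moreover have "k <# (u <# A) = (k \<otimes> u) <# A" using c sub by (intro lcos_m_assoc) auto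
    ultimately show ?thesis using u v by (auto simp: W_def)
  qed
  have act: "group_action (G\<lparr>carrier := K\<rparr>) W (\<lambda>k. \<lambda>w\<in>W. k <# w)"
    by (rule l_coset_action[OF K(1) sub(1) _ st]) (use sub in \<open>auto simp: W_def\<close>)
  \<comment> \<open>The cosets in \<open>W\<close> partition \<open>U <#> A\<close>, which is a
    subgroup because \<open>U\<close> is normal; so \<open>card W\<close> is the index of
    \<open>A\<close> in it.\<close>
  have cardW: "card A * card W = card (U <#> A)"
  proof -
    have "\<Union>W = U <#> A" by (auto simp: W_def set_mult_def l_coset_def)
    moreover have "card A * card W = card (\<Union>W)"
    proof (rule card_partition)
      show "finite W" by fact
      have "\<Union>W \<subseteq> carrier G" using sub by (auto simp: W_def l_coset_def)
      then show "finite (\<Union>W)" using fin by (meson finite_subset)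
      show "card c = card A" if cW: "c \<in> W" for c
      proof -
        obtain u where u: "u \<in> U" "c = u <# A" using cW by (auto simp: W_def)
        have "c = (\<lambda>a. u \<otimes> a) ` A" using u by (auto simp: l_coset_def)
        moreover have "inj_on (\<lambda>a. u \<otimes> a) A" using u sub by (auto simp: inj_on_def subset_iff)
        ultimately show ?thesis by (simp add: card_image)
      qed
      show "c1 \<inter> c2 = {}" if c: "c1 \<in> W" "c2 \<in> W" "c1 \<noteq> c2" for c1 c2
      proof -
        obtain u1 u2 where u: "u1 \<in> U" "c1 = u1 <# A" "u2 \<in> U" "c2 = u2 <# A"
          using c by (auto simp: W_def)
        have "c1 = x <# A" "c2 = x <# A" if "x \<in> c1" "x \<in> c2" for x
          using l_repr_independence[OF _ _ A] that u sub by auto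
        then show ?thesis using c(3) by blast
      qed
    qed
    ultimately show ?thesis by simp
  qed
  have "subgroup (U <#> A) G" using mult_norm_subgroup[OF U A] .
  then have "card (U <#> A) dvd card (carrier G)"
    using card_subgroup_dvd[OF _ subgroup_self] subgroup.subset by blast
  then obtain c where c: "card (carrier G) = card A * card W * c" using cardW by (auto simp: dvd_def)
  obtain k m where km: "card A = p ^ k" "card (carrier G) = p ^ k * m" "\<not> p dvd m"
    using syl by (auto simp: sylow_card_def)
  have "p ^ k > 0" using p by (simp add: prime_gt_0_nat)
  then have "m = card W * c" using c km by (metis mult.assoc mult_left_cancel not_gr_zero)
  then have nd: "\<not> p dvd card W" using km(3) by auto
  have "Coset.order (G\<lparr>carrier := K\<rparr>) = p ^ l" using K by (simp add: Coset.order_def)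
  from group_action.p_group_fixed_point[OF act p this finW nd]
  obtain w where w: "w \<in> W" "\<And>k. k \<in> K \<Longrightarrow> k <# w = w" by auto
  obtain u where u: "u \<in> U" "w = u <# A" using w by (auto simp: W_def)
  have "inv u \<otimes> k \<otimes> u \<in> A" if k: "k \<in> K" for k
  proof -
    have c: "k \<in> carrier G" "u \<in> carrier G" using k u sub by auto
    have "(k \<otimes> u) <# A = u <# A" using w(2)[OF k] u lcos_m_assoc[OF sub(1) c] by simp
    then have "inv u \<otimes> (k \<otimes> u) \<in> A" using l_coset_eq_iff[OF A _ c(2)] c by simp
    then show ?thesis using c by (simp add: m_assoc)
  qed
  then show ?thesis using u by blast
qed

section \<open>Groups presented by finite levels\<close>

text \<open>
  A profinite group \<open>G\<close> given through a separating directed family of homomorphisms \<open>\<rho> j\<close>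
  with finite images; \<open>complete\<close> says that \<open>G\<close> is the inverse limit of these images.
\<close>

locale profinite_levels = group G for G :: "'a monoid" (structure) +
  fixes T :: "'a topology" and J :: "'j set" and r :: "'j \<Rightarrow> 'j \<Rightarrow> bool"
    and K :: "'j \<Rightarrow> 'k monoid" and \<rho> :: "'j \<Rightarrow> 'a \<Rightarrow> 'k"
  assumes dir: "directed_set J r"
    and grpK: "\<And>j. j \<in> J \<Longrightarrow> group (K j)"
    and hom\<rho>: "\<And>j. j \<in> J \<Longrightarrow> \<rho> j \<in> hom G (K j)"
    and fin\<rho>: "\<And>j. j \<in> J \<Longrightarrow> finite (\<rho> j ` carrier G)"
    and sep: "\<And>g h. \<lbrakk>g \<in> carrier G; h \<in> carrier G; \<And>j. j \<in> J \<Longrightarrow> \<rho> j g = \<rho> j h\<rbrakk> \<Longrightarrow> g = h"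
    and compat: "\<And>i j g h. \<lbrakk>i \<in> J; j \<in> J; r i j; g \<in> carrier G; h \<in> carrier G; \<rho> j g = \<rho> j h\<rbrakk>
      \<Longrightarrow> \<rho> i g = \<rho> i h"
    and complete: "\<And>c. \<lbrakk>\<And>j. j \<in> J \<Longrightarrow> c j \<in> carrier G;
        \<And>i j. \<lbrakk>i \<in> J; j \<in> J; r i j\<rbrakk> \<Longrightarrow> \<rho> i (c j) = \<rho> i (c i)\<rbrakk>
      \<Longrightarrow> \<exists>g\<in>carrier G. \<forall>j\<in>J. \<rho> j g = \<rho> j (c j)"
    and opn: "\<And>U. openin T U \<longleftrightarrow> U \<subseteq> carrier G \<and>
      (\<forall>g\<in>U. \<exists>j\<in>J. \<forall>h\<in>carrier G. \<rho> j h = \<rho> j g \<longrightarrow> h \<in> U)"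
begin

lemma group_hom_level: "j \<in> J \<Longrightarrow> group_hom G (K j) (\<rho> j)"
  unfolding group_hom_def group_hom_axioms_def using is_group grpK hom\<rho> by blast

lemma topspace: "topspace T = carrier G"
proof
  show "topspace T \<subseteq> carrier G" using openin_topspace opn by metis
  have "openin T (carrier G)" using opn directed_set_nonempty[OF dir] by blast
  then show "carrier G \<subseteq> topspace T" by (rule openin_subset)
qed

lemma openin_level:
  assumes "j \<in> J"
  shows "openin T {h \<in> carrier G. \<rho> j h \<in> S}"
  unfolding opn
proof (intro conjI ballI)
  fix g assume "g \<in> {h \<in> carrier G. \<rho> j h \<in> S}"
  then show "\<exists>i\<in>J. \<forall>h\<in>carrier G. \<rho> i h = \<rho> i g \<longrightarrow> h \<in> {h \<in> carrier G. \<rho> j h \<in> S}"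
    using assms by (intro bexI[of _ j]) auto
qed auto

lemma closedin_level:
  assumes "j \<in> J"
  shows "closedin T {h \<in> carrier G. \<rho> j h \<in> S}"
proof -
  have "carrier G - {h \<in> carrier G. \<rho> j h \<in> S} = {h \<in> carrier G. \<rho> j h \<in> - S}" by auto
  then show ?thesis using openin_level[OF assms, of "- S"] by (auto simp: closedin_def topspace)
qed

text \<open>Suppose that a cover has no finite subcover. At each level there are finitely many
  fibres, so some fibre is not finitely covered, and the values with this property form an inverse
  system. A compatible choice comes from a point \<open>g\<close> by \<open>complete\<close>, but an
  open set of the cover around \<open>g\<close> contains a whole fibre through
  \<open>g\<close>.\<close>

lemma compact: "compact_space T"
  unfolding compact_space_def compactin_def
proof (intro conjI allI impI)
  show "topspace T \<subseteq> topspace T" by simp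
  fix \<U> assume U: "Ball \<U> (openin T) \<and> topspace T \<subseteq> \<Union>\<U>"
  define fincov where "fincov = (\<lambda>S. \<exists>\<F>. finite \<F> \<and> \<F> \<subseteq> \<U> \<and> S \<subseteq> \<Union>\<F>)"
  show "\<exists>\<F>. finite \<F> \<and> \<F> \<subseteq> \<U> \<and> topspace T \<subseteq> \<Union>\<F>"
  proof (rule ccontr)
    assume "\<not> ?thesis"
    then have nf: "\<not> fincov (carrier G)" by (simp add: fincov_def topspace)
    define cls where "cls = (\<lambda>j y. {g \<in> carrier G. \<rho> j g = y})"
    define X where "X = (\<lambda>j. {y \<in> \<rho> j ` carrier G. \<not> fincov (cls j y)})"
    \<comment> \<open>No transition maps between the images are given. They are obtained by choosing
      preimages in \<open>G\<close>; by \<open>compat\<close> the choice does not matter.\<close>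
    define rep where "rep = (\<lambda>j y. SOME g. g \<in> carrier G \<and> \<rho> j g = y)"
    have rep: "rep j y \<in> carrier G \<and> \<rho> j (rep j y) = y" if "y \<in> \<rho> j ` carrier G" for j y
    proof -
      have "\<exists>g. g \<in> carrier G \<and> \<rho> j g = y" using that by auto
      then show ?thesis unfolding rep_def by (rule someI_ex)
    qed
    have red: "\<rho> i (rep j (\<rho> j g)) = \<rho> i g" if "i \<in> J" "j \<in> J" "r i j" "g \<in> carrier G" for i j g
    proof -
      have "rep j (\<rho> j g) \<in> carrier G \<and> \<rho> j (rep j (\<rho> j g)) = \<rho> j g" using that(4) by (intro rep) simp
      then show ?thesis using compat[OF that(1-3) _ that(4)] by blast
    qed
    have "\<exists>x. (\<forall>j\<in>J. x j \<in> X j) \<and> (\<forall>i\<in>J. \<forall>j\<in>J. r i j \<longrightarrow> \<rho> i (rep j (x j)) = x i)"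
    proof (rule finite_inverse_limit_nonempty[OF dir, of X "\<lambda>i j y. \<rho> i (rep j y)"])
      show "finite (X j)" if "j \<in> J" for j using fin\<rho>[OF that] by (simp add: X_def)
      show "X j \<noteq> {}" if j: "j \<in> J" for j
      proof
        assume "X j = {}"
        then have "\<forall>y\<in>\<rho> j ` carrier G. \<exists>\<F>. finite \<F> \<and> \<F> \<subseteq> \<U> \<and> cls j y \<subseteq> \<Union>\<F>"
          by (auto simp: X_def fincov_def)
        then obtain \<F> where F: "\<And>y. y \<in> \<rho> j ` carrier G \<Longrightarrow> finite (\<F> y) \<and> \<F> y \<subseteq> \<U> \<and> cls j y \<subseteq> \<Union>(\<F> y)"
          by metis
        have "fincov (carrier G)" unfolding fincov_def
        proof (intro exI[of _ "\<Union>(\<F> ` (\<rho> j ` carrier G))"] conjI)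
          show "finite (\<Union>(\<F> ` (\<rho> j ` carrier G)))" using fin\<rho>[OF j] F by (intro finite_UN_I) auto
          show "\<Union>(\<F> ` (\<rho> j ` carrier G)) \<subseteq> \<U>" using F by blast
          show "carrier G \<subseteq> \<Union>(\<Union>(\<F> ` (\<rho> j ` carrier G)))"
          proof
            fix g assume g: "g \<in> carrier G"
            then have "\<rho> j g \<in> \<rho> j ` carrier G" "g \<in> cls j (\<rho> j g)" by (auto simp: cls_def)
            then have "g \<in> \<Union>(\<F> (\<rho> j g))" using F by (meson subsetD)
            then show "g \<in> \<Union>(\<Union>(\<F> ` (\<rho> j ` carrier G)))" using g by auto
          qed
        qed
        then show False using nf by simp
      qed
      show "\<rho> i (rep j y) \<in> X i" if "i \<in> J" "j \<in> J" "r i j" "y \<in> X j" for i j y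
      proof -
        have y: "y \<in> \<rho> j ` carrier G" "\<not> fincov (cls j y)" using that(4) by (auto simp: X_def)
        have "cls j y \<subseteq> cls i (\<rho> i (rep j y))"
        proof
          fix g assume "g \<in> cls j y"
          then have g: "g \<in> carrier G" "\<rho> j g = y" by (auto simp: cls_def)
          have "\<rho> i g = \<rho> i (rep j y)"
            by (rule compat[OF that(1-3) g(1)]) (simp_all add: g(2) rep[OF y(1)])
          then show "g \<in> cls i (\<rho> i (rep j y))" using g by (simp add: cls_def)
        qed
        then have "\<not> fincov (cls i (\<rho> i (rep j y)))" using y(2) unfolding fincov_def by (meson subset_trans)
        then show ?thesis using rep[OF y(1)] by (simp add: X_def)
      qed
      show "\<rho> i (rep j (\<rho> j (rep k y))) = \<rho> i (rep k y)"
        if "i \<in> J" "j \<in> J" "k \<in> J" "r i j" "r j k" "y \<in> X k" for i j k y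
      proof -
        have "y \<in> \<rho> k ` carrier G" using that(6) by (simp add: X_def)
        from rep[OF this] show ?thesis using red[OF that(1,2,4)] by blast
      qed
    qed
    then obtain x where x: "\<And>j. j \<in> J \<Longrightarrow> x j \<in> X j"
      "\<And>i j. \<lbrakk>i \<in> J; j \<in> J; r i j\<rbrakk> \<Longrightarrow> \<rho> i (rep j (x j)) = x i" by blast
    have xi: "x j \<in> \<rho> j ` carrier G" if "j \<in> J" for j using x(1)[OF that] by (simp add: X_def)
    have "\<exists>g\<in>carrier G. \<forall>j\<in>J. \<rho> j g = \<rho> j (rep j (x j))"
    proof (rule complete)
      show "rep j (x j) \<in> carrier G" if "j \<in> J" for j using rep[OF xi[OF that]] by simp
      show "\<rho> i (rep j (x j)) = \<rho> i (rep i (x i))" if "i \<in> J" "j \<in> J" "r i j" for i j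
        using x(2)[OF that] rep[OF xi[OF that(1)]] by simp
    qed
    then obtain g where g: "g \<in> carrier G" "\<forall>j\<in>J. \<rho> j g = x j" using rep xi by auto
    then obtain V where V: "V \<in> \<U>" "g \<in> V" using U topspace by blast
    then have "openin T V" using U by blast
    then obtain j where j: "j \<in> J" "\<forall>h\<in>carrier G. \<rho> j h = \<rho> j g \<longrightarrow> h \<in> V" using V(2) opn by blast
    then have "cls j (x j) \<subseteq> \<Union>{V}" using g by (auto simp: cls_def)
    then have "fincov (cls j (x j))" unfolding fincov_def using V(1) by (intro exI[of _ "{V}"]) auto
    then show False using x(1)[OF j(1)] by (simp add: X_def)
  qed
qed

text \<open>The fibres of the maps \<open>\<rho> j\<close> are open and closed. Products and
  inverses are determined at level \<open>j\<close> by the factors at level \<open>j\<close>, which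
  gives continuity; since the levels separate points, the space is Hausdorff and totally
  disconnected.\<close>

lemma profinite: "profinite_group G T"
  unfolding profinite_group_def
proof (intro conjI allI impI)
  show "group G" by (rule is_group)
  show "topspace T = carrier G" by (rule topspace)
  show "compact_space T" by (rule compact)
  have level_mult: "\<rho> j (x \<otimes> y) = \<rho> j x \<otimes>\<^bsub>K j\<^esub> \<rho> j y"
    if "j \<in> J" "x \<in> carrier G" "y \<in> carrier G" for j x y
    using hom_mult[OF hom\<rho>] that by blast
  have level_inv: "\<rho> j (inv x) = inv\<^bsub>K j\<^esub> \<rho> j x" if "j \<in> J" "x \<in> carrier G" for j x
    using group_hom.hom_inv[OF group_hom_level] that by blast
  show "continuous_map (prod_topology T T) T (\<lambda>(x, y). x \<otimes> y)"
    unfolding continuous_map_def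
  proof (intro conjI allI impI)
    show "(\<lambda>(x, y). x \<otimes> y) \<in> topspace (prod_topology T T) \<rightarrow> topspace T" by (auto simp: topspace)
    fix U assume U: "openin T U"
    show "openin (prod_topology T T) {z \<in> topspace (prod_topology T T). (case z of (x, y) \<Rightarrow> x \<otimes> y) \<in> U}"
      (is "openin _ ?V")
    proof (subst openin_subopen, intro ballI)
      fix z assume z: "z \<in> ?V"
      then obtain x y where xy: "z = (x, y)" "x \<in> carrier G" "y \<in> carrier G" "x \<otimes> y \<in> U"
        by (auto simp: topspace)
      obtain j where j: "j \<in> J" "\<forall>h\<in>carrier G. \<rho> j h = \<rho> j (x \<otimes> y) \<longrightarrow> h \<in> U"
        using U xy(4) opn by blast
      define W where "W = {h \<in> carrier G. \<rho> j h \<in> {\<rho> j x}} \<times> {h \<in> carrier G. \<rho> j h \<in> {\<rho> j y}}"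
      have "openin (prod_topology T T) W"
        unfolding W_def openin_prod_Times_iff using openin_level[OF j(1)] by blast
      moreover have "z \<in> W" using xy by (simp add: W_def)
      moreover have "W \<subseteq> ?V" using j xy by (auto simp: W_def topspace level_mult)
      ultimately show "\<exists>W. openin (prod_topology T T) W \<and> z \<in> W \<and> W \<subseteq> ?V" by blast
    qed
  qed
  show "continuous_map T T (\<lambda>x. inv x)"
    unfolding continuous_map_def
  proof (intro conjI allI impI)
    show "(\<lambda>x. inv x) \<in> topspace T \<rightarrow> topspace T" by (auto simp: topspace)
    fix U assume U: "openin T U"
    show "openin T {x \<in> topspace T. inv x \<in> U}"
      unfolding opn
    proof (intro conjI ballI)
      fix g assume g: "g \<in> {x \<in> topspace T. inv x \<in> U}"
      then obtain j where j: "j \<in> J" "\<forall>h\<in>carrier G. \<rho> j h = \<rho> j (inv g) \<longrightarrow> h \<in> U"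
        using U opn by blast
      then show "\<exists>j\<in>J. \<forall>h\<in>carrier G. \<rho> j h = \<rho> j g \<longrightarrow> h \<in> {x \<in> topspace T. inv x \<in> U}"
        using g by (intro bexI[of _ j]) (auto simp: topspace level_inv)
    qed (auto simp: topspace)
  qed
  have split: "\<exists>j\<in>J. \<rho> j x \<noteq> \<rho> j y" if "x \<in> carrier G" "y \<in> carrier G" "x \<noteq> y" for x y
    using sep that by blast
  show "Hausdorff_space T"
    unfolding Hausdorff_space_def
  proof (intro allI impI)
    fix x y assume "x \<in> topspace T \<and> y \<in> topspace T \<and> x \<noteq> y"
    then have xy: "x \<in> carrier G" "y \<in> carrier G" "x \<noteq> y" by (auto simp: topspace)
    obtain j where j: "j \<in> J" "\<rho> j x \<noteq> \<rho> j y" using split[OF xy] by blast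
    show "\<exists>U V. openin T U \<and> openin T V \<and> x \<in> U \<and> y \<in> V \<and> disjnt U V"
      using openin_level[OF j(1), of "{\<rho> j x}"] openin_level[OF j(1), of "{\<rho> j y}"] xy j
      by (intro exI[of _ "{h \<in> carrier G. \<rho> j h \<in> {\<rho> j x}}"] exI[of _ "{h \<in> carrier G. \<rho> j h \<in> {\<rho> j y}}"])
        (auto simp: disjnt_def)
  qed
  show "\<exists>x. C \<subseteq> {x}" if C: "connectedin T C" for C
  proof (rule ccontr)
    assume n: "\<not> ?thesis"
    then obtain x y where xy: "x \<in> C" "y \<in> C" "x \<noteq> y" by blast
    have Cc: "C \<subseteq> carrier G" using C topspace connectedin_subset_topspace by blast
    obtain j where j: "j \<in> J" "\<rho> j x \<noteq> \<rho> j y" using split xy Cc by blast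
    have "C \<subseteq> {h \<in> carrier G. \<rho> j h \<in> {\<rho> j x}} \<or> disjnt C {h \<in> carrier G. \<rho> j h \<in> {\<rho> j x}}"
      using connectedin_clopen_cases[OF C closedin_level[OF j(1)] openin_level[OF j(1)]] .
    then show False using xy j Cc by (auto simp: disjnt_def)
  qed
qed

text \<open>The levelwise closedness \<open>cl\<close> is what keeps the limit of a compatible
  family of elements of \<open>H\<close> inside \<open>H\<close>; the algebraic conditions are
  inherited from \<open>G\<close>.\<close>

lemma level_restrict:
  assumes H: "subgroup H G"
    and cl: "\<And>g. \<lbrakk>g \<in> carrier G; \<And>j. j \<in> J \<Longrightarrow> \<rho> j g \<in> \<rho> j ` H\<rbrakk> \<Longrightarrow> g \<in> H"
  shows "profinite_levels (G\<lparr>carrier := H\<rparr>) (subtopology T H) J r K \<rho>"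
proof -
  have HG: "H \<subseteq> carrier G" using H by (rule subgroup.subset)
  interpret HH: group "G\<lparr>carrier := H\<rparr>" using H by (rule subgroup_imp_group)
  show ?thesis
  proof (intro profinite_levels.intro profinite_levels_axioms.intro)
    show "Group.group (G\<lparr>carrier := H\<rparr>)" by (rule HH.is_group)
    show "directed_set J r" by (rule dir)
    fix j assume j: "j \<in> J"
    show "group (K j)" using j by (rule grpK)
    show "\<rho> j \<in> hom (G\<lparr>carrier := H\<rparr>) (K j)" using hom\<rho>[OF j] HG by (auto simp: hom_def)
    show "finite (\<rho> j ` carrier (G\<lparr>carrier := H\<rparr>))"
      using fin\<rho>[OF j] HG by (auto intro: finite_subset[OF image_mono])
  next
    fix g h assume "g \<in> carrier (G\<lparr>carrier := H\<rparr>)" "h \<in> carrier (G\<lparr>carrier := H\<rparr>)"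
      "\<And>j. j \<in> J \<Longrightarrow> \<rho> j g = \<rho> j h"
    then show "g = h" using sep[of g h] HG by auto
  next
    fix i j g h assume "i \<in> J" "j \<in> J" "r i j" "g \<in> carrier (G\<lparr>carrier := H\<rparr>)"
      "h \<in> carrier (G\<lparr>carrier := H\<rparr>)" "\<rho> j g = \<rho> j h"
    then show "\<rho> i g = \<rho> i h" using compat[of i j g h] HG by auto
  next
    fix c assume c: "\<And>j. j \<in> J \<Longrightarrow> c j \<in> carrier (G\<lparr>carrier := H\<rparr>)"
      "\<And>i j. i \<in> J \<Longrightarrow> j \<in> J \<Longrightarrow> r i j \<Longrightarrow> \<rho> i (c j) = \<rho> i (c i)"
    obtain g where g: "g \<in> carrier G" "\<forall>j\<in>J. \<rho> j g = \<rho> j (c j)"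
      using complete[of c] c HG by (auto simp: subset_iff)
    then have "g \<in> H" using c(1) by (intro cl) auto
    then show "\<exists>g\<in>carrier (G\<lparr>carrier := H\<rparr>). \<forall>j\<in>J. \<rho> j g = \<rho> j (c j)" using g by auto
  next
    fix U
    show "openin (subtopology T H) U \<longleftrightarrow> U \<subseteq> carrier (G\<lparr>carrier := H\<rparr>) \<and>
      (\<forall>g\<in>U. \<exists>j\<in>J. \<forall>h\<in>carrier (G\<lparr>carrier := H\<rparr>). \<rho> j h = \<rho> j g \<longrightarrow> h \<in> U)" (is "_ \<longleftrightarrow> ?R")
    proof
      assume "openin (subtopology T H) U"
      then obtain V where V: "openin T V" "U = V \<inter> H" by (auto simp: openin_subtopology)
      have "\<exists>j\<in>J. \<forall>h\<in>H. \<rho> j h = \<rho> j g \<longrightarrow> h \<in> U" if "g \<in> U" for g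
      proof -
        obtain j where "j \<in> J" "\<forall>h\<in>carrier G. \<rho> j h = \<rho> j g \<longrightarrow> h \<in> V"
          using V \<open>g \<in> U\<close> opn by blast
        then show ?thesis using V(2) HG by blast
      qed
      then show ?R using V(2) by simp
    next
      assume R: ?R
      \<comment> \<open>An open subset of \<open>G\<close> with trace \<open>U\<close> on
        \<open>H\<close> is built from fibres in \<open>G\<close> whose trace on \<open>H\<close> is
        contained in \<open>U\<close>.\<close>
      define V where "V = \<Union>{{h \<in> carrier G. \<rho> j h \<in> {\<rho> j g}} | g j.
        g \<in> U \<and> j \<in> J \<and> (\<forall>h\<in>H. \<rho> j h = \<rho> j g \<longrightarrow> h \<in> U)}"
      have "openin T V" unfolding V_def using openin_level by (intro openin_Union) blast
      moreover have "U = V \<inter> H"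
      proof
        show "V \<inter> H \<subseteq> U" by (auto simp: V_def)
        show "U \<subseteq> V \<inter> H"
        proof
          fix g assume g: "g \<in> U"
          then have gH: "g \<in> H" using R by auto
          obtain j where "j \<in> J" "\<forall>h\<in>H. \<rho> j h = \<rho> j g \<longrightarrow> h \<in> U" using R g by auto
          then have "g \<in> V" unfolding V_def using g gH HG by blast
          then show "g \<in> V \<inter> H" using gH by blast
        qed
      qed
      ultimately show "openin (subtopology T H) U" by (auto simp: openin_subtopology)
    qed
  qed
qed

lemma open_contains_kernel:
  assumes "openin T N" "\<one> \<in> N"
  shows "\<exists>j\<in>J. \<forall>g\<in>carrier G. \<rho> j g = \<rho> j \<one> \<longrightarrow> g \<in> N"
  using assms opn by blast

text \<open>\<open>G\<close> may be infinite, so the index is counted in a finite image. As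
  \<open>N\<close> contains the kernel of \<open>\<rho> j\<close>, distinct cosets of
  \<open>N\<close> have disjoint images, each a translate of the image of \<open>N\<close>.\<close>

lemma card_rcosets_level:
  assumes N: "subgroup N G" and j: "j \<in> J" and ker: "\<forall>g\<in>carrier G. \<rho> j g = \<rho> j \<one> \<longrightarrow> g \<in> N"
  shows "card (rcosets N) * card (\<rho> j ` N) = card (\<rho> j ` carrier G)"
proof -
  interpret h: group_hom G "K j" "\<rho> j" using j by (rule group_hom_level)
  have NG: "N \<subseteq> carrier G" using N by (rule subgroup.subset)
  have same: "c = c'" if c: "c \<in> rcosets N" "c' \<in> rcosets N" "g \<in> c" "g' \<in> c'" "\<rho> j g = \<rho> j g'" for c c' g g'
  proof -
    obtain a a' where a: "a \<in> carrier G" "c = N #> a" "a' \<in> carrier G" "c' = N #> a'"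
      using c(1,2) by (auto simp: RCOSETS_def)
    have gc: "g \<in> carrier G" "g' \<in> carrier G" using c(3,4) a r_coset_subset_G[OF NG] by auto
    have cg: "c = N #> g" "c' = N #> g'" using repr_independence[OF _ _ N] a c(3,4) by auto
    have "\<rho> j (g \<otimes> inv g') = \<rho> j \<one>" using c(5) gc by simp
    then have "g \<otimes> inv g' \<in> N" using ker gc by blast
    then have "g \<in> N #> g'" using subgroup.rcos_module_rev[OF N is_group gc(2,1)] by simp
    then show ?thesis using repr_independence[OF _ gc(2) N] cg by simp
  qed
  have ne: "c \<noteq> {}" if "c \<in> rcosets N" for c
    using subgroup.rcosets_non_empty[OF N that] .
  define C where "C = (\<lambda>c. \<rho> j ` c) ` (rcosets N)"
  have inj: "inj_on (\<lambda>c. \<rho> j ` c) (rcosets N)"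
  proof (rule inj_onI)
    fix c c' assume c: "c \<in> rcosets N" "c' \<in> rcosets N" "\<rho> j ` c = \<rho> j ` c'"
    obtain g where g: "g \<in> c" using ne c(1) by blast
    then obtain g' where "g' \<in> c'" "\<rho> j g = \<rho> j g'" using c(3) by blast
    then show "c = c'" using same c g by blast
  qed
  have UC: "\<Union>C = \<rho> j ` carrier G"
  proof -
    have "\<Union>C = \<rho> j ` \<Union>(rcosets N)" by (auto simp: C_def)
    then show ?thesis using rcosets_part_G[OF N] by simp
  qed
  have "card (\<rho> j ` N) * card C = card (\<Union>C)"
  proof (rule card_partition)
    show "finite (\<Union>C)" using UC fin\<rho>[OF j] by simp
    then show "finite C" by (rule finite_UnionD)
    show "card c = card (\<rho> j ` N)" if "c \<in> C" for c
    proof -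
      obtain g where g: "g \<in> carrier G" "c = \<rho> j ` (N #> g)" using \<open>c \<in> C\<close> by (auto simp: C_def RCOSETS_def)
      have "c = (\<lambda>y. y \<otimes>\<^bsub>K j\<^esub> \<rho> j g) ` \<rho> j ` N"
      proof -
        have "N #> g = (\<lambda>n. n \<otimes> g) ` N" by (auto simp: r_coset_def)
        moreover have "\<rho> j (n \<otimes> g) = \<rho> j n \<otimes>\<^bsub>K j\<^esub> \<rho> j g" if "n \<in> N" for n
          using that g NG by (intro h.hom_mult) auto
        ultimately show ?thesis using g(2) by (simp add: image_image)
      qed
      moreover have "inj_on (\<lambda>y. y \<otimes>\<^bsub>K j\<^esub> \<rho> j g) (\<rho> j ` N)"
        using g NG by (auto simp: inj_on_def subset_iff)
      ultimately show ?thesis by (simp add: card_image)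
    qed
    show "c1 \<inter> c2 = {}" if c: "c1 \<in> C" "c2 \<in> C" "c1 \<noteq> c2" for c1 c2
    proof (rule ccontr)
      obtain d1 d2 where d: "d1 \<in> rcosets N" "c1 = \<rho> j ` d1" "d2 \<in> rcosets N" "c2 = \<rho> j ` d2"
        using c by (auto simp: C_def)
      assume "c1 \<inter> c2 \<noteq> {}"
      then obtain g1 g2 where "g1 \<in> d1" "g2 \<in> d2" "\<rho> j g1 = \<rho> j g2" using d by auto
      then have "d1 = d2" by (rule same[OF d(1,3)])
      then show False using d c(3) by simp
    qed
  qed
  moreover have "card C = card (rcosets N)" unfolding C_def by (rule card_image[OF inj])
  ultimately show ?thesis using UC by (simp add: mult.commute)
qed

text \<open>Every open normal subgroup contains the kernel of some \<open>\<rho> j\<close>, so the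
  indices in the definition of a Sylow pro-\<open>p\<close> subgroup can be counted in the finite
  image at that level. There the index of \<open>H <#> N\<close> divides the index of the image of
  \<open>H\<close>.\<close>

theorem sylow_pro_p_levels:
  assumes p: "prime p" and H: "subgroup H G"
    and cl: "\<And>g. \<lbrakk>g \<in> carrier G; \<And>j. j \<in> J \<Longrightarrow> \<rho> j g \<in> \<rho> j ` H\<rbrakk> \<Longrightarrow> g \<in> H"
    and syl: "\<And>j. j \<in> J \<Longrightarrow> sylow_card p (card (\<rho> j ` H)) (card (\<rho> j ` carrier G))"
  shows "sylow_pro_p p G T H"
  unfolding sylow_pro_p_def
proof (intro conjI allI impI)
  have HG: "H \<subseteq> carrier G" using H by (rule subgroup.subset)
  show "subgroup H G" by (rule H)
  show "closedin T H"
    unfolding closedin_def topspace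
  proof
    show "H \<subseteq> carrier G" by (rule HG)
    have "\<exists>j\<in>J. \<rho> j g \<notin> \<rho> j ` H" if "g \<in> carrier G - H" for g using cl that by blast
    then show "openin T (carrier G - H)" unfolding opn by (metis Diff_iff Diff_subset imageI)
  qed
  interpret HL: profinite_levels "G\<lparr>carrier := H\<rparr>" "subtopology T H" J r K \<rho>
    by (rule level_restrict[OF H cl])
  show "pro_p_group p (G\<lparr>carrier := H\<rparr>) (subtopology T H)"
    unfolding pro_p_group_def
  proof (intro conjI allI impI)
    show "profinite_group (G\<lparr>carrier := H\<rparr>) (subtopology T H)" by (rule HL.profinite)
    fix N assume N: "N \<lhd> G\<lparr>carrier := H\<rparr> \<and> openin (subtopology T H) N"
    then have Ns: "subgroup N (G\<lparr>carrier := H\<rparr>)" by (simp add: normal_imp_subgroup)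
    obtain j where j: "j \<in> J"
      "\<forall>g\<in>carrier (G\<lparr>carrier := H\<rparr>). \<rho> j g = \<rho> j \<one>\<^bsub>G\<lparr>carrier := H\<rparr>\<^esub> \<longrightarrow> g \<in> N"
      using HL.open_contains_kernel N subgroup.one_closed[OF Ns] by blast
    have "card (rcosets\<^bsub>G\<lparr>carrier := H\<rparr>\<^esub> N) * card (\<rho> j ` N) = card (\<rho> j ` H)"
      using HL.card_rcosets_level[OF Ns j] by simp
    moreover obtain k where "card (\<rho> j ` H) = p ^ k" using syl[OF j(1)] by (auto simp: sylow_card_def)
    ultimately have "card (rcosets\<^bsub>G\<lparr>carrier := H\<rparr>\<^esub> N) dvd p ^ k" by (metis dvd_triv_left)
    then show "\<exists>k. card (rcosets\<^bsub>G\<lparr>carrier := H\<rparr>\<^esub> N) = p ^ k"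
      using divides_primepow_nat[OF p] by blast
  qed
  fix N assume N: "N \<lhd> G \<and> openin T N"
  then have Ns: "subgroup N G" by (simp add: normal_imp_subgroup)
  have NG: "N \<subseteq> carrier G" using Ns by (rule subgroup.subset)
  obtain j where j: "j \<in> J" "\<forall>g\<in>carrier G. \<rho> j g = \<rho> j \<one> \<longrightarrow> g \<in> N"
    using open_contains_kernel N subgroup.one_closed[OF Ns] by blast
  interpret h: group_hom G "K j" "\<rho> j" using j(1) by (rule group_hom_level)
  have HN: "subgroup (H <#> N) G"
    using mult_norm_subgroup[of N H] commut_normal[OF H, of N] N H by simp
  have Nsub: "N \<subseteq> H <#> N"
  proof
    fix n assume n: "n \<in> N"
    then have "n = \<one> \<otimes> n" using NG by auto
    then show "n \<in> H <#> N" using n subgroup.one_closed[OF H] unfolding set_mult_def by blast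
  qed
  have Hsub: "H \<subseteq> H <#> N"
  proof
    fix n assume n: "n \<in> H"
    then have "n = n \<otimes> \<one>" using HG by auto
    then show "n \<in> H <#> N" using n subgroup.one_closed[OF Ns] unfolding set_mult_def by blast
  qed
  have eq: "card (rcosets (H <#> N)) * card (\<rho> j ` (H <#> N)) = card (\<rho> j ` carrier G)"
    using card_rcosets_level[OF HN j(1)] j(2) Nsub by blast
  obtain k m where km: "card (\<rho> j ` H) = p ^ k" "card (\<rho> j ` carrier G) = p ^ k * m" "\<not> p dvd m"
    using syl[OF j(1)] by (auto simp: sylow_card_def)
  have "card (\<rho> j ` H) dvd card (\<rho> j ` (H <#> N))"
    using h.subgroup_img_is_subgroup[OF H] h.subgroup_img_is_subgroup[OF HN] Hsub
    by (intro h.H.card_subgroup_dvd) auto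
  then obtain q where q: "card (\<rho> j ` (H <#> N)) = p ^ k * q" using km by (auto simp: dvd_def)
  have "p ^ k > 0" using p by (simp add: prime_gt_0_nat)
  moreover have "p ^ k * m = p ^ k * (card (rcosets (H <#> N)) * q)" 
    using eq q km(2) by (simp only: mult_ac)
  ultimately have "m = card (rcosets (H <#> N)) * q" by (metis nat_mult_eq_cancel1)
  then show "\<not> p dvd card (rcosets (H <#> N))" using km(3) by auto
qed

end

section \<open>Categories of injective homomorphisms\<close>

text \<open>Collects what finite fusion systems and their limits have in common, so that
  automorphism groups, normalizers and \<open>N_phi\<close> are treated once for both. The
  factorization of a morphism into an isomorphism and an inclusion takes the form of
  \<open>Hom_onto_image\<close> and \<open>Hom_inverse\<close>.\<close>

locale fusion_category =
  fixes F :: "'a fusion"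
  assumes grp: "group (Grp F)"
    and Hom_obj: "\<And>\<phi> P Q. \<phi> \<in> Hom F P Q \<Longrightarrow> P \<in> Obj F \<and> Q \<in> Obj F"
    and Hom_ext: "\<And>\<phi> P Q. \<phi> \<in> Hom F P Q \<Longrightarrow> \<phi> \<in> extensional P"
    and Hom_inj: "\<And>\<phi> P Q. \<phi> \<in> Hom F P Q \<Longrightarrow> inj_on \<phi> P"
    and Hom_maps: "\<And>\<phi> P Q u. \<lbrakk>\<phi> \<in> Hom F P Q; u \<in> P\<rbrakk> \<Longrightarrow> \<phi> u \<in> Q"
    and Hom_mult: "\<And>\<phi> P Q u v. \<lbrakk>\<phi> \<in> Hom F P Q; u \<in> P; v \<in> P\<rbrakk>
      \<Longrightarrow> \<phi> (u \<otimes>\<^bsub>Grp F\<^esub> v) = \<phi> u \<otimes>\<^bsub>Grp F\<^esub> \<phi> v"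
    and Hom_comp: "\<And>\<phi> \<psi> P Q R. \<lbrakk>\<phi> \<in> Hom F P Q; \<psi> \<in> Hom F Q R\<rbrakk> \<Longrightarrow> compose P \<psi> \<phi> \<in> Hom F P R"
    and Hom_conj: "\<And>P Q x. \<lbrakk>P \<in> Obj F; Q \<in> Obj F; x \<in> carrier (Grp F); conj_by F x ` P \<subseteq> Q\<rbrakk>
      \<Longrightarrow> (\<lambda>u\<in>P. conj_by F x u) \<in> Hom F P Q"
    and Hom_onto_image: "\<And>\<phi> P Q. \<phi> \<in> Hom F P Q \<Longrightarrow> \<phi> \<in> Hom F P (\<phi> ` P)"
    and Hom_inverse: "\<And>\<phi> P Q. \<phi> \<in> Hom F P Q \<Longrightarrow> (\<lambda>v\<in>\<phi> ` P. inv_into P \<phi> v) \<in> Hom F (\<phi> ` P) P"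
begin

sublocale S: group "Grp F" by (rule grp)

lemma Obj_subgroup: "P \<in> Obj F \<Longrightarrow> subgroup P (Grp F)"
  by (simp add: Obj_def)

lemma Obj_subset: "P \<in> Obj F \<Longrightarrow> P \<subseteq> carrier (Grp F)"
  by (simp add: Obj_def subgroup.subset)

lemma conj_by_closed:
  "\<lbrakk>x \<in> carrier (Grp F); u \<in> carrier (Grp F)\<rbrakk> \<Longrightarrow> conj_by F x u \<in> carrier (Grp F)"
  by (simp add: conj_by_def)

lemma conj_by_mult:
  "\<lbrakk>x \<in> carrier (Grp F); y \<in> carrier (Grp F); u \<in> carrier (Grp F)\<rbrakk>
    \<Longrightarrow> conj_by F (x \<otimes>\<^bsub>Grp F\<^esub> y) u = conj_by F x (conj_by F y u)"
  by (simp add: conj_by_def S.inv_mult_group S.m_assoc)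

lemma conj_by_one: "u \<in> carrier (Grp F) \<Longrightarrow> conj_by F \<one>\<^bsub>Grp F\<^esub> u = u"
  by (simp add: conj_by_def)

lemma conj_by_inv_cancel:
  assumes "x \<in> carrier (Grp F)" "u \<in> carrier (Grp F)"
  shows "conj_by F (inv\<^bsub>Grp F\<^esub> x) (conj_by F x u) = u"
    and "conj_by F x (conj_by F (inv\<^bsub>Grp F\<^esub> x) u) = u"
  using assms conj_by_mult[of "inv\<^bsub>Grp F\<^esub> x" x u] conj_by_mult[of x "inv\<^bsub>Grp F\<^esub> x" u]
  by (simp_all add: conj_by_one)

lemma conj_by_mem:
  assumes P: "subgroup P (Grp F)" and "x \<in> P" "u \<in> P"
  shows "conj_by F x u \<in> P"
  unfolding conj_by_def using assms by (intro subgroup.m_closed[OF P] subgroup.m_inv_closed[OF P])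

lemma Hom_conj_by:
  assumes \<phi>: "\<phi> \<in> Hom F P Q" and x: "x \<in> P" and u: "u \<in> P"
  shows "\<phi> (conj_by F x u) = conj_by F (\<phi> x) (\<phi> u)"
proof -
  have P: "subgroup P (Grp F)" and Q: "subgroup Q (Grp F)"
    using Hom_obj[OF \<phi>] Obj_subgroup by auto
  have c: "x \<in> carrier (Grp F)" "u \<in> carrier (Grp F)" "\<phi> x \<in> carrier (Grp F)" "\<phi> u \<in> carrier (Grp F)"
    using x u Hom_maps[OF \<phi>] subgroup.subset[OF P] subgroup.subset[OF Q] by auto
  have m: "conj_by F x u \<in> P" using conj_by_mem[OF P x u] .
  \<comment> \<open>The conjugation relation is stated without inverses, as morphisms are only
    assumed to preserve products.\<close>
  have "conj_by F x u \<otimes>\<^bsub>Grp F\<^esub> x = x \<otimes>\<^bsub>Grp F\<^esub> u"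
    using c by (simp add: conj_by_def S.m_assoc)
  then have "\<phi> (conj_by F x u) \<otimes>\<^bsub>Grp F\<^esub> \<phi> x = \<phi> x \<otimes>\<^bsub>Grp F\<^esub> \<phi> u"
    using Hom_mult[OF \<phi> m x] Hom_mult[OF \<phi> x u] by simp
  moreover have "\<phi> (conj_by F x u) \<in> carrier (Grp F)"
    using Hom_maps[OF \<phi> m] subgroup.subset[OF Q] by auto
  ultimately show ?thesis unfolding conj_by_def using c by (metis S.inv_solve_right S.m_closed)
qed

lemma Hom_incl:
  assumes "P \<in> Obj F" "Q \<in> Obj F" "P \<subseteq> Q"
  shows "(\<lambda>u\<in>P. u) \<in> Hom F P Q"
proof -
  have P: "P \<subseteq> carrier (Grp F)" using assms Obj_subset by blast
  have "conj_by F \<one>\<^bsub>Grp F\<^esub> ` P \<subseteq> Q" using assms(3) P by (auto simp: conj_by_one subset_iff)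
  then have "(\<lambda>u\<in>P. conj_by F \<one>\<^bsub>Grp F\<^esub> u) \<in> Hom F P Q" using assms by (intro Hom_conj) auto
  moreover have "(\<lambda>u\<in>P. conj_by F \<one>\<^bsub>Grp F\<^esub> u) = (\<lambda>u\<in>P. u)"
    using P by (intro restrict_ext) (auto simp: conj_by_one)
  ultimately show ?thesis by simp
qed

lemma Hom_image_obj: "\<phi> \<in> Hom F P Q \<Longrightarrow> \<phi> ` P \<in> Obj F"
  using Hom_onto_image Hom_obj by blast

lemma Hom_change:
  assumes \<phi>: "\<phi> \<in> Hom F P Q" and Q': "Q' \<in> Obj F" "\<phi> ` P \<subseteq> Q'"
  shows "\<phi> \<in> Hom F P Q'"
proof -
  have "compose P (\<lambda>u\<in>\<phi> ` P. u) \<phi> \<in> Hom F P Q'"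
    using Hom_comp[OF Hom_onto_image[OF \<phi>] Hom_incl[OF Hom_image_obj[OF \<phi>] Q']] .
  moreover have "compose P (\<lambda>u\<in>\<phi> ` P. u) \<phi> = \<phi>"
    using Hom_ext[OF \<phi>] by (auto simp: compose_def extensional_def fun_eq_iff)
  ultimately show ?thesis by simp
qed

lemma Hom_restrict:
  assumes \<phi>: "\<phi> \<in> Hom F P Q" and P': "P' \<in> Obj F" "P' \<subseteq> P"
  shows "restrict \<phi> P' \<in> Hom F P' Q"
proof -
  have "compose P' \<phi> (\<lambda>u\<in>P'. u) \<in> Hom F P' Q"
    using Hom_comp[OF Hom_incl[OF P'(1) _ P'(2)] \<phi>] Hom_obj[OF \<phi>] by blast
  moreover have "compose P' \<phi> (\<lambda>u\<in>P'. u) = restrict \<phi> P'"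
    by (auto simp: compose_def fun_eq_iff)
  ultimately show ?thesis by simp
qed

text \<open>The inverse of a morphism on its image is a morphism by \<open>Hom_inverse\<close>, so
  surjectivity is all that an isomorphism needs in addition.\<close>

lemma Iso_iff: "\<phi> \<in> Iso F P Q \<longleftrightarrow> \<phi> \<in> Hom F P Q \<and> \<phi> ` P = Q"
proof
  assume "\<phi> \<in> Iso F P Q"
  then obtain \<psi> where \<psi>: "\<phi> \<in> Hom F P Q" "\<psi> \<in> Hom F Q P" "compose Q \<phi> \<psi> = (\<lambda>u\<in>Q. u)"
    by (auto simp: Iso_def)
  have "v \<in> \<phi> ` P" if v: "v \<in> Q" for v
  proof -
    have "\<phi> (\<psi> v) = v" using fun_cong[OF \<psi>(3), of v] v by (simp add: compose_def)
    then show ?thesis using Hom_maps[OF \<psi>(2) v] by (metis imageI)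
  qed
  then show "\<phi> \<in> Hom F P Q \<and> \<phi> ` P = Q" using \<psi>(1) Hom_maps[OF \<psi>(1)] by auto
next
  assume a: "\<phi> \<in> Hom F P Q \<and> \<phi> ` P = Q"
  then have inj: "inj_on \<phi> P" using Hom_inj by blast
  have 1: "(\<lambda>v\<in>Q. inv_into P \<phi> v) \<in> Hom F Q P" using Hom_inverse[of \<phi> P Q] a by simp
  have 2: "compose P (\<lambda>v\<in>Q. inv_into P \<phi> v) \<phi> = (\<lambda>u\<in>P. u)"
    using a inj by (auto simp: compose_def fun_eq_iff)
  have 3: "compose Q \<phi> (\<lambda>v\<in>Q. inv_into P \<phi> v) = (\<lambda>u\<in>Q. u)"
    using a by (auto simp: compose_def fun_eq_iff f_inv_into_f)
  show "\<phi> \<in> Iso F P Q" unfolding Iso_def using a 1 2 3 by blast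
qed

lemma Iso_Hom: "\<phi> \<in> Iso F P Q \<Longrightarrow> \<phi> \<in> Hom F P Q"
  by (simp add: Iso_iff)

lemma Iso_image: "\<phi> \<in> Iso F P Q \<Longrightarrow> \<phi> ` P = Q"
  by (simp add: Iso_iff)

lemma Iso_inv:
  assumes \<phi>: "\<phi> \<in> Iso F P Q"
  shows "(\<lambda>v\<in>Q. inv_into P \<phi> v) \<in> Iso F Q P"
proof -
  have "(\<lambda>v\<in>Q. inv_into P \<phi> v) \<in> Hom F Q P" using Hom_inverse[of \<phi> P Q] \<phi> by (auto simp: Iso_iff)
  moreover have "(\<lambda>v\<in>Q. inv_into P \<phi> v) ` Q = P"
    using \<phi> Hom_inj[of \<phi> P Q] by (auto simp: Iso_iff image_iff inv_into_into)
  ultimately show ?thesis by (simp add: Iso_iff)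
qed

lemma Iso_inv_apply:
  assumes \<phi>: "\<phi> \<in> Iso F P Q"
  shows "u \<in> P \<Longrightarrow> inv_into P \<phi> (\<phi> u) = u" "v \<in> Q \<Longrightarrow> \<phi> (inv_into P \<phi> v) = v"
    "v \<in> Q \<Longrightarrow> inv_into P \<phi> v \<in> P"
  using \<phi> Hom_inj[of \<phi> P Q] by (auto simp: Iso_iff f_inv_into_f inv_into_into)

lemma Iso_comp:
  assumes "\<phi> \<in> Iso F P Q" "\<psi> \<in> Iso F Q R"
  shows "compose P \<psi> \<phi> \<in> Iso F P R"
proof -
  have "compose P \<psi> \<phi> ` P = \<psi> ` \<phi> ` P" by (simp add: compose_def image_image)
  then show ?thesis using assms Hom_comp[of \<phi> P Q \<psi> R] by (simp add: Iso_iff)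
qed

lemma carrier_Aut: "carrier (Aut_group F Q) = Iso F Q Q"
  by (simp add: Aut_group_def)

lemma mult_Aut: "\<phi> \<otimes>\<^bsub>Aut_group F Q\<^esub> \<psi> = compose Q \<phi> \<psi>"
  by (simp add: Aut_group_def)

lemma one_Aut: "\<one>\<^bsub>Aut_group F Q\<^esub> = (\<lambda>u\<in>Q. u)"
  by (simp add: Aut_group_def)

lemma group_Aut:
  assumes Q: "Q \<in> Obj F"
  shows "group (Aut_group F Q)"
proof (rule groupI)
  show "\<one>\<^bsub>Aut_group F Q\<^esub> \<in> carrier (Aut_group F Q)"
    using Hom_incl[OF Q Q] by (auto simp: carrier_Aut one_Aut Iso_iff)
  show "x \<otimes>\<^bsub>Aut_group F Q\<^esub> y \<in> carrier (Aut_group F Q)"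
    if "x \<in> carrier (Aut_group F Q)" "y \<in> carrier (Aut_group F Q)" for x y
    using that Iso_comp by (simp add: carrier_Aut mult_Aut)
  show "x \<otimes>\<^bsub>Aut_group F Q\<^esub> y \<otimes>\<^bsub>Aut_group F Q\<^esub> z = x \<otimes>\<^bsub>Aut_group F Q\<^esub> (y \<otimes>\<^bsub>Aut_group F Q\<^esub> z)"
    if "x \<in> carrier (Aut_group F Q)" "y \<in> carrier (Aut_group F Q)" "z \<in> carrier (Aut_group F Q)" for x y z
  proof -
    have "z \<in> Q \<rightarrow> Q" using that by (auto simp: carrier_Aut Iso_iff)
    then show ?thesis by (auto simp: mult_Aut compose_def fun_eq_iff Pi_iff)
  qed
  show "\<one>\<^bsub>Aut_group F Q\<^esub> \<otimes>\<^bsub>Aut_group F Q\<^esub> x = x" if x: "x \<in> carrier (Aut_group F Q)" for x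
  proof -
    have "x \<in> Hom F Q Q" using x by (simp add: carrier_Aut Iso_iff)
    then have "x \<in> extensional Q" "x \<in> Q \<rightarrow> Q" using Hom_ext Hom_maps by auto
    then show ?thesis by (auto simp: mult_Aut one_Aut compose_def fun_eq_iff extensional_def Pi_iff)
  qed
  show "\<exists>y\<in>carrier (Aut_group F Q). y \<otimes>\<^bsub>Aut_group F Q\<^esub> x = \<one>\<^bsub>Aut_group F Q\<^esub>"
    if x: "x \<in> carrier (Aut_group F Q)" for x
  proof (rule bexI)
    have x': "x \<in> Iso F Q Q" using x by (simp add: carrier_Aut)
    show "(\<lambda>v\<in>Q. inv_into Q x v) \<in> carrier (Aut_group F Q)" using Iso_inv[OF x'] by (simp add: carrier_Aut)
    show "(\<lambda>v\<in>Q. inv_into Q x v) \<otimes>\<^bsub>Aut_group F Q\<^esub> x = \<one>\<^bsub>Aut_group F Q\<^esub>"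
      using Iso_inv_apply(1)[OF x'] Hom_maps[OF Iso_Hom[OF x']]
      by (auto simp: mult_Aut one_Aut compose_def fun_eq_iff)
  qed
qed

lemma inv_Aut_apply:
  assumes Q: "Q \<in> Obj F" and \<phi>: "\<phi> \<in> Iso F Q Q" and u: "u \<in> Q"
  shows "(inv\<^bsub>Aut_group F Q\<^esub> \<phi>) (\<phi> u) = u" "\<phi> ((inv\<^bsub>Aut_group F Q\<^esub> \<phi>) u) = u"
proof -
  interpret A: group "Aut_group F Q" by (rule group_Aut[OF Q])
  have c: "\<phi> \<in> carrier (Aut_group F Q)" using \<phi> by (simp add: carrier_Aut)
  show "(inv\<^bsub>Aut_group F Q\<^esub> \<phi>) (\<phi> u) = u" "\<phi> ((inv\<^bsub>Aut_group F Q\<^esub> \<phi>) u) = u"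
    using A.l_inv[OF c] A.r_inv[OF c] u
    by (auto simp: mult_Aut one_Aut compose_def fun_eq_iff split: if_splits)
qed

lemma normalizer_iff:
  assumes Q: "Q \<subseteq> carrier (Grp F)"
  shows "x \<in> normalizer (Grp F) Q \<longleftrightarrow> x \<in> carrier (Grp F) \<and> conj_by F x ` Q = Q"
proof -
  have "x <#\<^bsub>Grp F\<^esub> Q #>\<^bsub>Grp F\<^esub> inv\<^bsub>Grp F\<^esub> x = conj_by F x ` Q"
    by (auto simp: l_coset_def r_coset_def conj_by_def)
  then show ?thesis using Q by (auto simp: normalizer_def stabilizer_def)
qed

lemma normalizer_subgroup:
  "Q \<subseteq> carrier (Grp F) \<Longrightarrow> subgroup (normalizer (Grp F) Q) (Grp F)"
  by (rule S.normalizer_imp_subgroup)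

lemma subgroup_normalizes:
  assumes Q: "subgroup Q (Grp F)"
  shows "Q \<subseteq> normalizer (Grp F) Q"
proof
  fix x assume x: "x \<in> Q"
  have c: "Q \<subseteq> carrier (Grp F)" using Q by (rule subgroup.subset)
  have "u \<in> conj_by F x ` Q" if u: "u \<in> Q" for u
  proof
    show "u = conj_by F x (conj_by F (inv\<^bsub>Grp F\<^esub> x) u)" 
      using conj_by_inv_cancel(2)[OF subsetD[OF c x] subsetD[OF c u]] by (rule sym)
    show "conj_by F (inv\<^bsub>Grp F\<^esub> x) u \<in> Q"
      using conj_by_mem[OF Q subgroup.m_inv_closed[OF Q x] u] .
  qed
  then have "conj_by F x ` Q = Q" using conj_by_mem[OF Q x] by blast
  then show "x \<in> normalizer (Grp F) Q" using normalizer_iff[OF c] x c by blast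
qed

text \<open>In an infinite group, conjugation by \<open>x\<close> may map a subset \<open>Q\<close>
  properly into itself. The inclusion for the inverse of \<open>x\<close> excludes this.\<close>

lemma normalizer_iff_inclusions:
  assumes Q: "Q \<subseteq> carrier (Grp F)" and x: "x \<in> carrier (Grp F)"
    and "conj_by F x ` Q \<subseteq> Q" "conj_by F (inv\<^bsub>Grp F\<^esub> x) ` Q \<subseteq> Q"
  shows "x \<in> normalizer (Grp F) Q"
proof -
  have "u \<in> conj_by F x ` Q" if u: "u \<in> Q" for u
  proof
    show "u = conj_by F x (conj_by F (inv\<^bsub>Grp F\<^esub> x) u)" 
      using conj_by_inv_cancel(2)[OF x subsetD[OF Q u]] by (rule sym)
    show "conj_by F (inv\<^bsub>Grp F\<^esub> x) u \<in> Q" using assms(4) u by blast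
  qed
  then have "conj_by F x ` Q = Q" using assms(3) by blast
  then show ?thesis using normalizer_iff[OF Q] x by blast
qed

lemma conj_Iso:
  assumes Q: "Q \<in> Obj F" and x: "x \<in> normalizer (Grp F) Q"
  shows "(\<lambda>u\<in>Q. conj_by F x u) \<in> Iso F Q Q"
proof -
  have x': "x \<in> carrier (Grp F)" "conj_by F x ` Q = Q" using x normalizer_iff[OF Obj_subset[OF Q]] by auto
  then have "(\<lambda>u\<in>Q. conj_by F x u) \<in> Hom F Q Q" using Hom_conj[OF Q Q] by blast
  then show ?thesis using x'(2) by (simp add: Iso_iff)
qed

lemma conj_group_hom:
  assumes Q: "Q \<in> Obj F"
  shows "group_hom ((Grp F)\<lparr>carrier := normalizer (Grp F) Q\<rparr>) (Aut_group F Q)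
    (\<lambda>x. \<lambda>u\<in>Q. conj_by F x u)"
proof -
  have N: "subgroup (normalizer (Grp F) Q) (Grp F)" using normalizer_subgroup[OF Obj_subset[OF Q]] .
  have "(\<lambda>x. \<lambda>u\<in>Q. conj_by F x u) \<in> hom ((Grp F)\<lparr>carrier := normalizer (Grp F) Q\<rparr>) (Aut_group F Q)"
  proof (rule homI)
    show "(\<lambda>u\<in>Q. conj_by F x u) \<in> carrier (Aut_group F Q)"
      if "x \<in> carrier ((Grp F)\<lparr>carrier := normalizer (Grp F) Q\<rparr>)" for x
      using conj_Iso[OF Q] that by (simp add: carrier_Aut)
    show "(\<lambda>u\<in>Q. conj_by F (x \<otimes>\<^bsub>(Grp F)\<lparr>carrier := normalizer (Grp F) Q\<rparr>\<^esub> y) u) =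
      (\<lambda>u\<in>Q. conj_by F x u) \<otimes>\<^bsub>Aut_group F Q\<^esub> (\<lambda>u\<in>Q. conj_by F y u)"
      if xy: "x \<in> carrier ((Grp F)\<lparr>carrier := normalizer (Grp F) Q\<rparr>)"
        "y \<in> carrier ((Grp F)\<lparr>carrier := normalizer (Grp F) Q\<rparr>)" for x y
    proof -
      have c: "x \<in> carrier (Grp F)" "y \<in> carrier (Grp F)" "conj_by F y ` Q = Q" "Q \<subseteq> carrier (Grp F)"
        using xy normalizer_iff[OF Obj_subset[OF Q]] Obj_subset[OF Q] by auto
      have "conj_by F (x \<otimes>\<^bsub>Grp F\<^esub> y) u = conj_by F x (conj_by F y u)" "conj_by F y u \<in> Q" if "u \<in> Q" for u
        using c that conj_by_mult[of x y u] by auto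
      then show ?thesis by (auto simp: mult_Aut compose_def fun_eq_iff)
    qed
  qed
  then show ?thesis unfolding group_hom_def group_hom_axioms_def
    using S.subgroup_imp_group[OF N] group_Aut[OF Q] by blast
qed

lemma Aut_S_subgroup:
  assumes Q: "Q \<in> Obj F"
  shows "subgroup (Aut_S F Q) (Aut_group F Q)"
proof -
  interpret h: group_hom "(Grp F)\<lparr>carrier := normalizer (Grp F) Q\<rparr>" "Aut_group F Q"
    "\<lambda>x. \<lambda>u\<in>Q. conj_by F x u" by (rule conj_group_hom[OF Q])
  show ?thesis using h.img_is_subgroup by (simp add: Aut_S_def)
qed

end

lemma fusion_category_finite:
  assumes "finite_fusion_system p F"
  shows "fusion_category F"
proof -
  note d = assms[unfolded finite_fusion_system_def]
  note g = d[THEN conjunct1]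
  have f: "P \<in> Obj F \<and> Q \<in> Obj F \<and> \<phi> \<in> extensional P \<and> inj_on \<phi> P \<and>
      \<phi> \<in> hom ((Grp F)\<lparr>carrier := P\<rparr>) ((Grp F)\<lparr>carrier := Q\<rparr>)" if "\<phi> \<in> Hom F P Q" for P Q \<phi>
    using d[THEN conjunct2, THEN conjunct2, THEN conjunct2, THEN conjunct2, THEN conjunct2,
        THEN conjunct1] that by (elim allE ballE) auto
  have c: "compose P \<psi> \<phi> \<in> Hom F P R" if "\<phi> \<in> Hom F P Q" "\<psi> \<in> Hom F Q R" for P Q R \<phi> \<psi>
    using d[THEN conjunct2, THEN conjunct2, THEN conjunct2, THEN conjunct2, THEN conjunct2,
        THEN conjunct2, THEN conjunct2, THEN conjunct1] that by fast
  have k: "(\<lambda>u\<in>P. conj_by F x u) \<in> Hom F P Q"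
    if "P \<in> Obj F" "Q \<in> Obj F" "x \<in> carrier (Grp F)" "conj_by F x ` P \<subseteq> Q" for P Q x
    using d[THEN conjunct2, THEN conjunct2, THEN conjunct2, THEN conjunct2, THEN conjunct2,
        THEN conjunct2, THEN conjunct2, THEN conjunct2, THEN conjunct1] that by fast
  have fac: "\<exists>R \<in> Obj F. R \<subseteq> Q \<and> (\<exists>\<psi> \<in> Iso F P R. \<phi> = compose P (\<lambda>u\<in>R. u) \<psi>)"
    if "\<phi> \<in> Hom F P Q" for P Q \<phi>
    using d[THEN conjunct2, THEN conjunct2, THEN conjunct2, THEN conjunct2, THEN conjunct2,
        THEN conjunct2, THEN conjunct2, THEN conjunct2, THEN conjunct2] that by (elim allE ballE) auto
  \<comment> \<open>If \<phi> is the isomorphism \<psi> onto \<open>R\<close> followed by the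
    inclusion, then \<phi> and \<psi> agree as functions. Hence \<open>R\<close> is the image of
    \<phi>, and the inverse of \<psi> in the category is the inverse function.\<close>
  have im: "\<phi> \<in> Hom F P (\<phi> ` P) \<and> (\<lambda>v\<in>\<phi> ` P. inv_into P \<phi> v) \<in> Hom F (\<phi> ` P) P"
    if \<phi>: "\<phi> \<in> Hom F P Q" for \<phi> P Q
  proof -
    obtain R \<psi> \<psi>' where R: "\<psi> \<in> Hom F P R" "\<phi> = compose P (\<lambda>u\<in>R. u) \<psi>"
      "\<psi>' \<in> Hom F R P" "compose P \<psi>' \<psi> = (\<lambda>u\<in>P. u)" "compose R \<psi> \<psi>' = (\<lambda>u\<in>R. u)"
      using fac[OF \<phi>] by (auto simp: Iso_def)
    have mR: "\<psi> u \<in> R" if "u \<in> P" for u using f[OF R(1)] that by (auto simp: hom_def)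
    have mP: "\<psi>' v \<in> P" if "v \<in> R" for v using f[OF R(3)] that by (auto simp: hom_def)
    have eq: "\<phi> = \<psi>"
      using f[OF R(1)] mR unfolding R(2) by (auto simp: compose_def fun_eq_iff extensional_def)
    have i1: "\<psi>' (\<psi> u) = u" if "u \<in> P" for u using fun_cong[OF R(4), of u] that by (simp add: compose_def)
    have i2: "\<psi> (\<psi>' v) = v" if "v \<in> R" for v using fun_cong[OF R(5), of v] that by (simp add: compose_def)
    have img: "\<phi> ` P = R"
    proof
      show "\<phi> ` P \<subseteq> R" using eq mR by auto
      show "R \<subseteq> \<phi> ` P"
      proof
        fix v assume v: "v \<in> R"
        then have "v = \<phi> (\<psi>' v)" using i2 eq by simp
        then show "v \<in> \<phi> ` P" using mP[OF v] by blast
      qed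
    qed
    have "inv_into P \<phi> v = \<psi>' v" if v: "v \<in> R" for v
      by (rule inv_into_f_eq) (use f[OF \<phi>] mP v i2 eq in auto)
    then have "(\<lambda>v\<in>\<phi> ` P. inv_into P \<phi> v) = \<psi>'"
      using f[OF R(3)] img by (auto simp: fun_eq_iff extensional_def)
    then show ?thesis using img R eq by simp
  qed
  show ?thesis
  proof (rule fusion_category.intro)
    fix \<phi> P Q assume \<phi>: "\<phi> \<in> Hom F P Q"
    show "P \<in> Obj F \<and> Q \<in> Obj F" "\<phi> \<in> extensional P" "inj_on \<phi> P" using f[OF \<phi>] by auto
    show "\<phi> u \<in> Q" if "u \<in> P" for u using f[OF \<phi>] that by (auto simp: hom_def)
    show "\<phi> (u \<otimes>\<^bsub>Grp F\<^esub> v) = \<phi> u \<otimes>\<^bsub>Grp F\<^esub> \<phi> v" if "u \<in> P" "v \<in> P" for u v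
      using f[OF \<phi>] that by (auto simp: hom_def)
    show "\<phi> \<in> Hom F P (\<phi> ` P)" "(\<lambda>v\<in>\<phi> ` P. inv_into P \<phi> v) \<in> Hom F (\<phi> ` P) P" using im[OF \<phi>] by auto
  qed (rule g, erule (1) c, erule (3) k)
qed

lemma Obj_finite:
  assumes "finite_fusion_system p F"
  shows "P \<in> Obj F \<longleftrightarrow> subgroup P (Grp F)"
proof -
  have "Top F = discrete_topology (carrier (Grp F))"
    using assms unfolding finite_fusion_system_def by (elim conjE)
  then show ?thesis by (auto simp: Obj_def dest: subgroup.subset)
qed

lemma conj_by_hom:
  assumes "group (Grp F)" "group (Grp F')" "h \<in> hom (Grp F) (Grp F')"
    and "x \<in> carrier (Grp F)" "u \<in> carrier (Grp F)"
  shows "h (conj_by F x u) = conj_by F' (h x) (h u)"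
proof -
  interpret group_hom "Grp F" "Grp F'" h
    using assms(1-3) by (simp add: group_hom_def group_hom_axioms_def)
  show ?thesis using assms(4,5) by (simp add: conj_by_def)
qed

section \<open>Induced maps on images\<close>

text \<open>The map induced by \<phi> on the image of \<open>X\<close> under \<open>h\<close>,
  computed from a chosen preimage. It is meaningful if \<phi> respects the fibres of
  \<open>h\<close>; \<open>push_eqI\<close> identifies it with any extensional map that satisfies
  the commutation rule. In this way the action of a functor on morphisms is expressed by
  \<open>h\<close> alone.\<close>

definition push :: "('a \<Rightarrow> 'b) \<Rightarrow> 'a set \<Rightarrow> ('a \<Rightarrow> 'a) \<Rightarrow> 'b \<Rightarrow> 'b" where
  "push h X \<phi> = (\<lambda>v\<in>h ` X. h (\<phi> (inv_into X h v)))"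

lemma push_eqI:
  assumes "\<Phi> \<in> extensional (h ` X)" "\<And>u. u \<in> X \<Longrightarrow> \<Phi> (h u) = h (\<phi> u)"
  shows "push h X \<phi> = \<Phi>"
proof
  fix v
  show "push h X \<phi> v = \<Phi> v"
  proof (cases "v \<in> h ` X")
    case True
    then have "inv_into X h v \<in> X" "h (inv_into X h v) = v" by (auto intro: inv_into_into f_inv_into_f)
    then show ?thesis using assms(2)[of "inv_into X h v"] True by (simp add: push_def)
  next
    case False
    then show ?thesis using assms(1) by (simp add: push_def extensional_def)
  qed
qed

section \<open>Inverse limits of fusion systems\<close>

lemma fusion_morphism_withD:
  assumes "fusion_morphism_with F F' \<alpha> A"
  shows "\<alpha> \<in> hom (Grp F) (Grp F')" "continuous_map (Top F) (Top F') \<alpha>"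
    and "P \<in> Obj F \<Longrightarrow> \<alpha> ` P \<in> Obj F'"
    and "\<lbrakk>P \<in> Obj F; Q \<in> Obj F; \<phi> \<in> Hom F P Q\<rbrakk> \<Longrightarrow> A P Q \<phi> \<in> Hom F' (\<alpha> ` P) (\<alpha> ` Q)"
    and "\<lbrakk>P \<in> Obj F; Q \<in> Obj F; \<phi> \<in> Hom F P Q; u \<in> P\<rbrakk> \<Longrightarrow> \<alpha> (\<phi> u) = A P Q \<phi> (\<alpha> u)"
  using assms by (simp_all add: fusion_morphism_with_def fusion_functor_def)

text \<open>
  A fusion system \<open>F\<close> together with projections \<open>a j\<close> onto a directed system of finite fusion
  systems that exhibit it as the inverse limit. The functors of the system do not occur,
  because they are determined by the maps \<open>f i j\<close>.
\<close>

locale fusion_limit =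
  fixes p :: nat and F :: "'s fusion" and J :: "'j set" and r :: "'j \<Rightarrow> 'j \<Rightarrow> bool"
    and G :: "'j \<Rightarrow> 'b fusion" and f :: "'j \<Rightarrow> 'j \<Rightarrow> 'b \<Rightarrow> 'b" and a :: "'j \<Rightarrow> 's \<Rightarrow> 'b"
  assumes dir: "directed_set J r"
    and fin: "\<And>j. j \<in> J \<Longrightarrow> finite_fusion_system p (G j)"
    and fhom: "\<And>i j. \<lbrakk>i \<in> J; j \<in> J; r i j\<rbrakk> \<Longrightarrow> f i j \<in> hom (Grp (G j)) (Grp (G i))"
    and fcomp: "\<And>i j k x. \<lbrakk>i \<in> J; j \<in> J; k \<in> J; r i j; r j k; x \<in> carrier (Grp (G k))\<rbrakk>
      \<Longrightarrow> f i j (f j k x) = f i k x"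
    and fHom: "\<And>i j \<phi> X Y. \<lbrakk>i \<in> J; j \<in> J; r i j; \<phi> \<in> Hom (G j) X Y\<rbrakk>
      \<Longrightarrow> \<exists>\<Phi>\<in>Hom (G i) (f i j ` X) (f i j ` Y). \<forall>u\<in>X. f i j (\<phi> u) = \<Phi> (f i j u)"
    and grpF: "group (Grp F)"
    and ahom: "\<And>j. j \<in> J \<Longrightarrow> a j \<in> hom (Grp F) (Grp (G j))"
    and acomp: "\<And>i j x. \<lbrakk>i \<in> J; j \<in> J; r i j; x \<in> carrier (Grp F)\<rbrakk> \<Longrightarrow> f i j (a j x) = a i x"
    and asep: "\<And>x y. \<lbrakk>x \<in> carrier (Grp F); y \<in> carrier (Grp F); \<And>j. j \<in> J \<Longrightarrow> a j x = a j y\<rbrakk> \<Longrightarrow> x = y"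
    and acomplete: "\<And>c. \<lbrakk>\<And>j. j \<in> J \<Longrightarrow> c j \<in> carrier (Grp (G j));
        \<And>i j. \<lbrakk>i \<in> J; j \<in> J; r i j\<rbrakk> \<Longrightarrow> f i j (c j) = c i\<rbrakk>
      \<Longrightarrow> \<exists>x\<in>carrier (Grp F). \<forall>j\<in>J. a j x = c j"
    and Top_char: "\<And>U. openin (Top F) U \<longleftrightarrow> U \<subseteq> carrier (Grp F) \<and>
      (\<forall>x\<in>U. \<exists>j\<in>J. \<forall>y\<in>carrier (Grp F). a j y = a j x \<longrightarrow> y \<in> U)"
    and Hom_char: "\<And>\<phi> P Q. \<phi> \<in> Hom F P Q \<longleftrightarrow> P \<in> Obj F \<and> Q \<in> Obj F \<and> \<phi> \<in> extensional P \<and>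
      (\<forall>u\<in>P. \<phi> u \<in> Q) \<and>
      (\<forall>j\<in>J. \<exists>\<Phi>\<in>Hom (G j) (a j ` P) (a j ` Q). \<forall>u\<in>P. a j (\<phi> u) = \<Phi> (a j u))"
    and HomTop_char: "\<And>P Q U. \<lbrakk>P \<in> Obj F; Q \<in> Obj F\<rbrakk> \<Longrightarrow> openin (HomTop F P Q) U \<longleftrightarrow>
      U \<subseteq> Hom F P Q \<and>
      (\<forall>\<phi>\<in>U. \<exists>j\<in>J. \<forall>\<psi>\<in>Hom F P Q. (\<forall>u\<in>P. a j (\<psi> u) = a j (\<phi> u)) \<longrightarrow> \<psi> \<in> U)"
begin

lemma Gcat: "j \<in> J \<Longrightarrow> fusion_category (G j)"
  using fin fusion_category_finite by blast

lemma Ggrp: "j \<in> J \<Longrightarrow> group (Grp (G j))"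
  using Gcat fusion_category.grp by blast

lemma Gfinite: "j \<in> J \<Longrightarrow> finite (carrier (Grp (G j)))"
  using fin unfolding finite_fusion_system_def by blast

lemma GObj: "j \<in> J \<Longrightarrow> P \<in> Obj (G j) \<longleftrightarrow> subgroup P (Grp (G j))"
  using fin Obj_finite by blast

sublocale S: group "Grp F" by (rule grpF)

lemma agrp: "j \<in> J \<Longrightarrow> group_hom (Grp F) (Grp (G j)) (a j)"
  using grpF Ggrp ahom by (simp add: group_hom_def group_hom_axioms_def)

lemma fgrp: "\<lbrakk>i \<in> J; j \<in> J; r i j\<rbrakk> \<Longrightarrow> group_hom (Grp (G j)) (Grp (G i)) (f i j)"
  using Ggrp fhom by (simp add: group_hom_def group_hom_axioms_def)

lemma a_closed: "\<lbrakk>j \<in> J; x \<in> carrier (Grp F)\<rbrakk> \<Longrightarrow> a j x \<in> carrier (Grp (G j))"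
  using ahom by (auto simp: hom_def)

lemma f_closed: "\<lbrakk>i \<in> J; j \<in> J; r i j; x \<in> carrier (Grp (G j))\<rbrakk> \<Longrightarrow> f i j x \<in> carrier (Grp (G i))"
  using fhom by (auto simp: hom_def)

lemma topspace_Top: "topspace (Top F) = carrier (Grp F)"
proof
  show "topspace (Top F) \<subseteq> carrier (Grp F)" using openin_topspace Top_char by metis
  have "openin (Top F) (carrier (Grp F))" using Top_char directed_set_nonempty[OF dir] by blast
  then show "carrier (Grp F) \<subseteq> topspace (Top F)" by (rule openin_subset)
qed

text \<open>The fibres of the maps \<open>a j\<close> form a base of the topology. So a subgroup is
  closed if and only if each point outside it is separated from it at some level.\<close>

lemma Obj_char: "P \<in> Obj F \<longleftrightarrow> subgroup P (Grp F) \<and>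
  (\<forall>x\<in>carrier (Grp F). (\<forall>j\<in>J. a j x \<in> a j ` P) \<longrightarrow> x \<in> P)" (is "_ \<longleftrightarrow> _ \<and> ?C")
proof (cases "subgroup P (Grp F)")
  case True
  then have PS: "P \<subseteq> carrier (Grp F)" by (rule subgroup.subset)
  have "closedin (Top F) P \<longleftrightarrow> (\<forall>x\<in>carrier (Grp F) - P. \<exists>j\<in>J.
      \<forall>y\<in>carrier (Grp F). a j y = a j x \<longrightarrow> y \<in> carrier (Grp F) - P)"
    unfolding closedin_def topspace_Top Top_char using PS by blast
  also have "\<dots> \<longleftrightarrow> ?C"
  proof
    assume *: "\<forall>x\<in>carrier (Grp F) - P. \<exists>j\<in>J. \<forall>y\<in>carrier (Grp F). a j y = a j x \<longrightarrow> y \<in> carrier (Grp F) - P"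
    show ?C
    proof (intro ballI impI, rule ccontr)
      fix x assume x: "x \<in> carrier (Grp F)" "\<forall>j\<in>J. a j x \<in> a j ` P" "x \<notin> P"
      then obtain j where j: "j \<in> J" "\<forall>y\<in>carrier (Grp F). a j y = a j x \<longrightarrow> y \<in> carrier (Grp F) - P"
        using * by blast
      obtain y where "y \<in> P" "a j x = a j y" using x(2) j(1) by blast
      then show False using j(2) PS by auto
    qed
  next
    assume *: ?C
    show "\<forall>x\<in>carrier (Grp F) - P. \<exists>j\<in>J. \<forall>y\<in>carrier (Grp F). a j y = a j x \<longrightarrow> y \<in> carrier (Grp F) - P"
    proof
      fix x assume x: "x \<in> carrier (Grp F) - P"
      then obtain j where j: "j \<in> J" "a j x \<notin> a j ` P" using * by blast
      then have "\<forall>y\<in>carrier (Grp F). a j y = a j x \<longrightarrow> y \<in> carrier (Grp F) - P" by (metis DiffI imageI)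
      then show "\<exists>j\<in>J. \<forall>y\<in>carrier (Grp F). a j y = a j x \<longrightarrow> y \<in> carrier (Grp F) - P" using j(1) by blast
    qed
  qed
  finally show ?thesis using True by (simp add: Obj_def)
next
  case False
  then show ?thesis by (simp add: Obj_def)
qed

lemma Obj_subgrp: "P \<in> Obj F \<Longrightarrow> subgroup P (Grp F)"
  by (simp add: Obj_def)

lemma Obj_sub: "P \<in> Obj F \<Longrightarrow> P \<subseteq> carrier (Grp F)"
  by (simp add: Obj_def subgroup.subset)

lemma Obj_limit: "\<lbrakk>P \<in> Obj F; x \<in> carrier (Grp F); \<And>j. j \<in> J \<Longrightarrow> a j x \<in> a j ` P\<rbrakk> \<Longrightarrow> x \<in> P"
  using Obj_char by blast

lemma carrier_Obj: "carrier (Grp F) \<in> Obj F"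
  using Obj_char S.subgroup_self by blast

lemma image_Obj: "\<lbrakk>j \<in> J; P \<in> Obj F\<rbrakk> \<Longrightarrow> a j ` P \<in> Obj (G j)"
  using group_hom.subgroup_img_is_subgroup[OF agrp] Obj_subgrp GObj by blast

lemma f_image_Obj: "\<lbrakk>i \<in> J; j \<in> J; r i j; X \<in> Obj (G j)\<rbrakk> \<Longrightarrow> f i j ` X \<in> Obj (G i)"
  using group_hom.subgroup_img_is_subgroup[OF fgrp] GObj by blast

lemma f_image_a: "\<lbrakk>i \<in> J; j \<in> J; r i j; P \<subseteq> carrier (Grp F)\<rbrakk> \<Longrightarrow> f i j ` a j ` P = a i ` P"
  using acomp by (force simp: image_image subset_iff intro!: image_cong)

text \<open>Replaces the existence statement \<open>fHom\<close> by the explicit map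
  \<open>push\<close>, since an extensional map on the image of \<open>X\<close> is determined by
  the commutation rule.\<close>

lemma fpush:
  assumes "i \<in> J" "j \<in> J" "r i j" "\<phi> \<in> Hom (G j) X Y"
  shows "push (f i j) X \<phi> \<in> Hom (G i) (f i j ` X) (f i j ` Y)"
    and "u \<in> X \<Longrightarrow> push (f i j) X \<phi> (f i j u) = f i j (\<phi> u)"
proof -
  obtain \<Phi> where \<Phi>: "\<Phi> \<in> Hom (G i) (f i j ` X) (f i j ` Y)" "\<forall>u\<in>X. f i j (\<phi> u) = \<Phi> (f i j u)"
    using fHom[OF assms] by blast
  have "push (f i j) X \<phi> = \<Phi>"
    by (rule push_eqI[OF fusion_category.Hom_ext[OF Gcat[OF assms(1)] \<Phi>(1)]]) (simp add: \<Phi>(2))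
  then show "push (f i j) X \<phi> \<in> Hom (G i) (f i j ` X) (f i j ` Y)"
    and "u \<in> X \<Longrightarrow> push (f i j) X \<phi> (f i j u) = f i j (\<phi> u)" using \<Phi> by auto
qed

lemma apush:
  assumes "j \<in> J" "\<phi> \<in> Hom F P Q"
  shows "push (a j) P \<phi> \<in> Hom (G j) (a j ` P) (a j ` Q)"
    and "u \<in> P \<Longrightarrow> push (a j) P \<phi> (a j u) = a j (\<phi> u)"
proof -
  obtain \<Phi> where \<Phi>: "\<Phi> \<in> Hom (G j) (a j ` P) (a j ` Q)" "\<forall>u\<in>P. a j (\<phi> u) = \<Phi> (a j u)"
    using assms Hom_char by blast
  have "push (a j) P \<phi> = \<Phi>"
    by (rule push_eqI[OF fusion_category.Hom_ext[OF Gcat[OF assms(1)] \<Phi>(1)]]) (simp add: \<Phi>(2))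
  then show "push (a j) P \<phi> \<in> Hom (G j) (a j ` P) (a j ` Q)"
    and "u \<in> P \<Longrightarrow> push (a j) P \<phi> (a j u) = a j (\<phi> u)" using \<Phi> by auto
qed

lemma Hom_objs: "\<phi> \<in> Hom F P Q \<Longrightarrow> P \<in> Obj F \<and> Q \<in> Obj F"
  using Hom_char by blast

lemma Hom_in: "\<phi> \<in> Hom F P Q \<Longrightarrow> u \<in> P \<Longrightarrow> \<phi> u \<in> Q"
  using Hom_char by blast

lemma Hom_extn: "\<phi> \<in> Hom F P Q \<Longrightarrow> \<phi> \<in> extensional P"
  using Hom_char by blast

lemma Hom_injective:
  assumes \<phi>: "\<phi> \<in> Hom F P Q"
  shows "inj_on \<phi> P"
proof (rule inj_onI)
  fix u v assume uv: "u \<in> P" "v \<in> P" "\<phi> u = \<phi> v"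
  have P: "P \<subseteq> carrier (Grp F)" using Hom_objs[OF \<phi>] Obj_sub by blast
  have "a j u = a j v" if j: "j \<in> J" for j
    using fusion_category.Hom_inj[OF Gcat[OF j] apush(1)[OF j \<phi>]] apush(2)[OF j \<phi>] uv
    by (metis imageI inj_onD)
  then show "u = v" using asep uv P by blast
qed

lemma Hom_multiplicative:
  assumes \<phi>: "\<phi> \<in> Hom F P Q" and uv: "u \<in> P" "v \<in> P"
  shows "\<phi> (u \<otimes>\<^bsub>Grp F\<^esub> v) = \<phi> u \<otimes>\<^bsub>Grp F\<^esub> \<phi> v"
proof -
  have P: "P \<subseteq> carrier (Grp F)" "subgroup P (Grp F)"
    and Q: "Q \<subseteq> carrier (Grp F)" using Hom_objs[OF \<phi>] Obj_sub Obj_subgrp by auto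
  have c: "\<phi> u \<in> carrier (Grp F)" if "u \<in> P" for u using Hom_in[OF \<phi> that] Q by auto
  show ?thesis
  proof (rule asep)
    have m: "u \<otimes>\<^bsub>Grp F\<^esub> v \<in> P" using subgroup.m_closed[OF P(2) uv] .
    show "\<phi> (u \<otimes>\<^bsub>Grp F\<^esub> v) \<in> carrier (Grp F)" "\<phi> u \<otimes>\<^bsub>Grp F\<^esub> \<phi> v \<in> carrier (Grp F)"
      using c m uv by auto
    fix j assume j: "j \<in> J"
    interpret h: group_hom "Grp F" "Grp (G j)" "a j" by (rule agrp[OF j])
    have "a j (\<phi> (u \<otimes>\<^bsub>Grp F\<^esub> v)) = push (a j) P \<phi> (a j (u \<otimes>\<^bsub>Grp F\<^esub> v))" using apush(2)[OF j \<phi> m] by simp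
    also have "\<dots> = push (a j) P \<phi> (a j u \<otimes>\<^bsub>Grp (G j)\<^esub> a j v)" using uv P(1) by (simp add: subset_iff)
    also have "\<dots> = push (a j) P \<phi> (a j u) \<otimes>\<^bsub>Grp (G j)\<^esub> push (a j) P \<phi> (a j v)"
      using fusion_category.Hom_mult[OF Gcat[OF j] apush(1)[OF j \<phi>]] uv by blast
    also have "\<dots> = a j (\<phi> u \<otimes>\<^bsub>Grp F\<^esub> \<phi> v)" using apush(2)[OF j \<phi>] uv c by simp
    finally show "a j (\<phi> (u \<otimes>\<^bsub>Grp F\<^esub> v)) = a j (\<phi> u \<otimes>\<^bsub>Grp F\<^esub> \<phi> v)" .
  qed
qed

text \<open>Closedness of the image: if \<open>y\<close> lies in the image of \<phi> at each level,
  its preimages at the levels are unique because the level maps are injective. Hence they are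
  compatible and define a point of the closed subgroup \<open>P\<close> that \<phi> sends to
  \<open>y\<close>.\<close>

lemma Hom_mapsto_Obj:
  assumes \<phi>: "\<phi> \<in> Hom F P Q"
  shows "\<phi> ` P \<in> Obj F" "j \<in> J \<Longrightarrow> a j ` \<phi> ` P = push (a j) P \<phi> ` a j ` P"
proof -
  have P: "P \<in> Obj F" "P \<subseteq> carrier (Grp F)" "subgroup P (Grp F)"
    and Q: "Q \<subseteq> carrier (Grp F)" using Hom_objs[OF \<phi>] Obj_sub Obj_subgrp by auto
  have c: "\<phi> u \<in> carrier (Grp F)" if "u \<in> P" for u using Hom_in[OF \<phi> that] Q by auto
  have im: "a j ` \<phi> ` P = push (a j) P \<phi> ` a j ` P" if "j \<in> J" for j
    using apush(2)[OF that \<phi>] by (simp add: image_image)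
  then show "j \<in> J \<Longrightarrow> a j ` \<phi> ` P = push (a j) P \<phi> ` a j ` P" .
  have "group_hom ((Grp F)\<lparr>carrier := P\<rparr>) (Grp F) \<phi>"
    unfolding group_hom_def group_hom_axioms_def hom_def
    using S.subgroup_imp_group[OF P(3)] grpF Hom_multiplicative[OF \<phi>] c by auto
  from group_hom.img_is_subgroup[OF this] have sg: "subgroup (\<phi> ` P) (Grp F)" by simp
  have "y \<in> \<phi> ` P" if y: "y \<in> carrier (Grp F)" "\<forall>j\<in>J. a j y \<in> a j ` \<phi> ` P" for y
  proof -
    define c where "c = (\<lambda>j. inv_into (a j ` P) (push (a j) P \<phi>) (a j y))"
    have cj: "c j \<in> a j ` P" "push (a j) P \<phi> (c j) = a j y" if "j \<in> J" for j
    proof -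
      have "a j y \<in> push (a j) P \<phi> ` a j ` P" using y(2) im[OF that] that by blast
      then show "c j \<in> a j ` P" "push (a j) P \<phi> (c j) = a j y"
        unfolding c_def by (rule inv_into_into, rule f_inv_into_f)
    qed
    have cc: "f i j (c j) = c i" if ij: "i \<in> J" "j \<in> J" "r i j" for i j
    proof -
      obtain u where u: "u \<in> P" "c j = a j u" using cj(1)[OF ij(2)] by blast
      have "push (a i) P \<phi> (f i j (c j)) = push (a i) P \<phi> (a i u)" using u acomp[OF ij] P by auto
      also have "\<dots> = f i j (a j (\<phi> u))" using apush(2)[OF ij(1) \<phi> u(1)] acomp[OF ij] c u(1) by simp
      also have "\<dots> = f i j (a j y)" using cj(2)[OF ij(2)] apush(2)[OF ij(2) \<phi> u(1)] u(2) by simp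
      also have "\<dots> = push (a i) P \<phi> (c i)" using cj(2)[OF ij(1)] acomp[OF ij] y by simp
      finally have eq: "push (a i) P \<phi> (f i j (c j)) = push (a i) P \<phi> (c i)" .
      have "f i j (c j) \<in> a i ` P" using u acomp[OF ij] P by auto
      then show ?thesis
        using inj_onD[OF fusion_category.Hom_inj[OF Gcat[OF ij(1)] apush(1)[OF ij(1) \<phi>]] eq] cj(1)[OF ij(1)]
        by blast
    qed
    have "\<exists>x\<in>carrier (Grp F). \<forall>j\<in>J. a j x = c j"
    proof (rule acomplete)
      show "c j \<in> carrier (Grp (G j))" if "j \<in> J" for j using cj(1)[OF that] a_closed[OF that] P by auto
    qed (rule cc)
    then obtain x where x: "x \<in> carrier (Grp F)" "\<forall>j\<in>J. a j x = c j" by blast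
    have xP: "x \<in> P" by (rule Obj_limit[OF P(1) x(1)]) (use x(2) cj(1) in auto)
    have "\<phi> x = y"
    proof (rule asep[OF c[OF xP] y(1)])
      fix j assume j: "j \<in> J"
      show "a j (\<phi> x) = a j y" using apush(2)[OF j \<phi> xP] x(2) cj(2)[OF j] j by simp
    qed
    then show ?thesis using xP by blast
  qed
  then show "\<phi> ` P \<in> Obj F" using sg Obj_char by blast
qed

sublocale fusion_category F
proof (rule fusion_category.intro)
  show "group (Grp F)" by (rule grpF)
next
  fix \<phi> P Q assume \<phi>: "\<phi> \<in> Hom F P Q"
  have P: "P \<in> Obj F" "P \<subseteq> carrier (Grp F)" "subgroup P (Grp F)"
    and Q: "Q \<in> Obj F" "Q \<subseteq> carrier (Grp F)" using Hom_objs[OF \<phi>] Obj_sub Obj_subgrp by auto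
  show "P \<in> Obj F \<and> Q \<in> Obj F" "\<phi> \<in> extensional P" "inj_on \<phi> P"
    using Hom_objs[OF \<phi>] Hom_extn[OF \<phi>] Hom_injective[OF \<phi>] by auto
  show "\<phi> u \<in> Q" if "u \<in> P" for u using Hom_in[OF \<phi> that] .
  show "\<phi> (u \<otimes>\<^bsub>Grp F\<^esub> v) = \<phi> u \<otimes>\<^bsub>Grp F\<^esub> \<phi> v" if "u \<in> P" "v \<in> P" for u v
    using Hom_multiplicative[OF \<phi> that] .
  have im: "\<phi> ` P \<in> Obj F" and imj: "\<And>j. j \<in> J \<Longrightarrow> a j ` \<phi> ` P = push (a j) P \<phi> ` a j ` P"
    using Hom_mapsto_Obj[OF \<phi>] by auto
  show "\<phi> \<in> Hom F P (\<phi> ` P)"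
    unfolding Hom_char
  proof (intro conjI ballI P im Hom_extn[OF \<phi>])
    show "\<phi> u \<in> \<phi> ` P" if "u \<in> P" for u using that by blast
    fix j assume j: "j \<in> J"
    show "\<exists>\<Phi>\<in>Hom (G j) (a j ` P) (a j ` \<phi> ` P). \<forall>u\<in>P. a j (\<phi> u) = \<Phi> (a j u)"
      using fusion_category.Hom_onto_image[OF Gcat[OF j] apush(1)[OF j \<phi>]] apush(2)[OF j \<phi>] imj[OF j]
      by (intro bexI[of _ "push (a j) P \<phi>"]) auto
  qed
  show "(\<lambda>v\<in>\<phi> ` P. inv_into P \<phi> v) \<in> Hom F (\<phi> ` P) P"
    unfolding Hom_char
  proof (intro conjI ballI P im)
    show "(\<lambda>v\<in>\<phi> ` P. inv_into P \<phi> v) \<in> extensional (\<phi> ` P)" by simp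
    show "(\<lambda>v\<in>\<phi> ` P. inv_into P \<phi> v) u \<in> P" if "u \<in> \<phi> ` P" for u using that by (simp add: inv_into_into)
    fix j assume j: "j \<in> J"
    let ?\<Phi> = "push (a j) P \<phi>"
    have "(\<lambda>v\<in>?\<Phi> ` a j ` P. inv_into (a j ` P) ?\<Phi> v) \<in> Hom (G j) (a j ` \<phi> ` P) (a j ` P)"
      using fusion_category.Hom_inverse[OF Gcat[OF j] apush(1)[OF j \<phi>]] imj[OF j] by simp
    moreover have "a j ((\<lambda>v\<in>\<phi> ` P. inv_into P \<phi> v) w) = (\<lambda>v\<in>?\<Phi> ` a j ` P. inv_into (a j ` P) ?\<Phi> v) (a j w)"
      if w: "w \<in> \<phi> ` P" for w
    proof -
      obtain u where u: "u \<in> P" "w = \<phi> u" using w by blast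
      have "inv_into (a j ` P) ?\<Phi> (a j w) = a j u"
        using inv_into_f_f[OF fusion_category.Hom_inj[OF Gcat[OF j] apush(1)[OF j \<phi>]], of "a j u"]
          apush(2)[OF j \<phi> u(1)] u by simp
      moreover have "a j w \<in> ?\<Phi> ` a j ` P" using imj[OF j] w by blast
      ultimately show ?thesis using w u Hom_injective[OF \<phi>] by simp
    qed
    ultimately show "\<exists>\<Phi>\<in>Hom (G j) (a j ` \<phi> ` P) (a j ` P).
        \<forall>w\<in>\<phi> ` P. a j ((\<lambda>v\<in>\<phi> ` P. inv_into P \<phi> v) w) = \<Phi> (a j w)" by blast
  qed
next
  fix \<phi> \<psi> P Q R assume \<phi>: "\<phi> \<in> Hom F P Q" and \<psi>: "\<psi> \<in> Hom F Q R"
  show "compose P \<psi> \<phi> \<in> Hom F P R"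
    unfolding Hom_char
  proof (intro conjI ballI)
    show "P \<in> Obj F" "R \<in> Obj F" using Hom_objs \<phi> \<psi> by auto
    show "compose P \<psi> \<phi> \<in> extensional P" by simp
    show "compose P \<psi> \<phi> u \<in> R" if "u \<in> P" for u
      using that Hom_in[OF \<psi> Hom_in[OF \<phi> that]] by (simp add: compose_def)
    fix j assume j: "j \<in> J"
    have "compose (a j ` P) (push (a j) Q \<psi>) (push (a j) P \<phi>) \<in> Hom (G j) (a j ` P) (a j ` R)"
      using fusion_category.Hom_comp[OF Gcat[OF j] apush(1)[OF j \<phi>] apush(1)[OF j \<psi>]] .
    moreover have "a j (compose P \<psi> \<phi> u) = compose (a j ` P) (push (a j) Q \<psi>) (push (a j) P \<phi>) (a j u)"
      if "u \<in> P" for u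
      using that apush(2)[OF j \<phi> that] apush(2)[OF j \<psi> Hom_in[OF \<phi> that]] by (simp add: compose_def)
    ultimately show "\<exists>\<Phi>\<in>Hom (G j) (a j ` P) (a j ` R). \<forall>u\<in>P. a j (compose P \<psi> \<phi> u) = \<Phi> (a j u)"
      by blast
  qed
next
  fix P Q x assume P: "P \<in> Obj F" and Q: "Q \<in> Obj F" and x: "x \<in> carrier (Grp F)"
    and sub: "conj_by F x ` P \<subseteq> Q"
  show "(\<lambda>u\<in>P. conj_by F x u) \<in> Hom F P Q"
    unfolding Hom_char
  proof (intro conjI ballI P Q)
    show "(\<lambda>u\<in>P. conj_by F x u) \<in> extensional P" by simp
    show "(\<lambda>u\<in>P. conj_by F x u) u \<in> Q" if "u \<in> P" for u using sub that by auto
    fix j assume j: "j \<in> J"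
    have eq: "a j (conj_by F x u) = conj_by (G j) (a j x) (a j u)" if "u \<in> P" for u
      using conj_by_hom[OF grpF Ggrp[OF j] ahom[OF j] x] Obj_sub[OF P] that by blast
    have "conj_by (G j) (a j x) ` a j ` P \<subseteq> a j ` Q"
    proof (intro subsetI, elim imageE)
      fix v w u assume "v = conj_by (G j) (a j x) w" "w = a j u" "u \<in> P"
      then have "v = a j (conj_by F x u)" "conj_by F x u \<in> Q" using eq[of u] sub by auto
      then show "v \<in> a j ` Q" by blast
    qed
    then have "(\<lambda>v\<in>a j ` P. conj_by (G j) (a j x) v) \<in> Hom (G j) (a j ` P) (a j ` Q)"
      using fusion_category.Hom_conj[OF Gcat[OF j] image_Obj[OF j P] image_Obj[OF j Q] a_closed[OF j x]] by blast
    moreover have "\<forall>u\<in>P. a j ((\<lambda>u\<in>P. conj_by F x u) u) = (\<lambda>v\<in>a j ` P. conj_by (G j) (a j x) v) (a j u)"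
      using eq by simp
    ultimately show "\<exists>\<Phi>\<in>Hom (G j) (a j ` P) (a j ` Q). \<forall>u\<in>P. a j ((\<lambda>u\<in>P. conj_by F x u) u) = \<Phi> (a j u)"
      by blast
  qed
qed

text \<open>For each \<open>u\<close> the values \<open>\<Phi> j (a j u)\<close> are compatible and
  define a point, which lies in the closed subgroup \<open>Q\<close> because it does so at each
  level. This is how morphisms of the limit are constructed from morphisms of the levels.\<close>

lemma Hom_complete:
  assumes P: "P \<in> Obj F" and Q: "Q \<in> Obj F"
    and \<Phi>: "\<And>j. j \<in> J \<Longrightarrow> \<Phi> j \<in> Hom (G j) (a j ` P) (a j ` Q)"
    and compat: "\<And>i j u. \<lbrakk>i \<in> J; j \<in> J; r i j; u \<in> P\<rbrakk> \<Longrightarrow> f i j (\<Phi> j (a j u)) = \<Phi> i (a i u)"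
  shows "\<exists>\<phi>\<in>Hom F P Q. \<forall>j\<in>J. \<forall>u\<in>P. a j (\<phi> u) = \<Phi> j (a j u)"
proof -
  have \<Phi>Q: "\<Phi> j (a j u) \<in> a j ` Q" if "j \<in> J" "u \<in> P" for j u
    using fusion_category.Hom_maps[OF Gcat[OF that(1)] \<Phi>[OF that(1)]] that(2) by blast
  have "\<exists>x\<in>carrier (Grp F). \<forall>j\<in>J. a j x = \<Phi> j (a j u)" if u: "u \<in> P" for u
  proof (rule acomplete)
    show "\<Phi> j (a j u) \<in> carrier (Grp (G j))" if "j \<in> J" for j
      using \<Phi>Q[OF that u] a_closed[OF that] Obj_sub[OF Q] by auto
    show "f i j (\<Phi> j (a j u)) = \<Phi> i (a i u)" if "i \<in> J" "j \<in> J" "r i j" for i j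
      using compat[OF that u] .
  qed
  then obtain \<phi> where \<phi>: "\<And>u. u \<in> P \<Longrightarrow> \<phi> u \<in> carrier (Grp F) \<and> (\<forall>j\<in>J. a j (\<phi> u) = \<Phi> j (a j u))"
    by metis
  have "restrict \<phi> P \<in> Hom F P Q"
    unfolding Hom_char
  proof (intro conjI ballI P Q)
    show "restrict \<phi> P \<in> extensional P" by simp
    show "restrict \<phi> P u \<in> Q" if u: "u \<in> P" for u
      using Obj_limit[OF Q, of "\<phi> u"] \<phi>[OF u] \<Phi>Q u by auto
    fix j assume j: "j \<in> J"
    show "\<exists>\<Psi>\<in>Hom (G j) (a j ` P) (a j ` Q). \<forall>u\<in>P. a j (restrict \<phi> P u) = \<Psi> (a j u)"
      using \<phi> j by (intro bexI[OF _ \<Phi>[OF j]]) auto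
  qed
  then show ?thesis using \<phi> by (intro bexI[of _ "restrict \<phi> P"]) auto
qed

end

section \<open>The concrete inverse limit as an instance of \<open>fusion_limit\<close>\<close>

locale fusion_inverse_system =
  fixes p :: nat and I :: "'i set" and r :: "'i \<Rightarrow> 'i \<Rightarrow> bool" and G :: "'i \<Rightarrow> 'a fusion"
    and f :: "'i \<Rightarrow> 'i \<Rightarrow> 'a \<Rightarrow> 'a"
    and A :: "'i \<Rightarrow> 'i \<Rightarrow> 'a set \<Rightarrow> 'a set \<Rightarrow> ('a \<Rightarrow> 'a) \<Rightarrow> ('a \<Rightarrow> 'a)"
  assumes sys: "inverse_system p I r G f A"
begin

abbreviation L where "L \<equiv> inverse_limit I r G f A"

lemma idir: "directed_set I r"
  using sys by (simp add: inverse_system_def)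

lemma ifin: "i \<in> I \<Longrightarrow> finite_fusion_system p (G i)"
  using sys by (simp add: inverse_system_def)

lemma imor: "\<lbrakk>i \<in> I; j \<in> I; r i j\<rbrakk> \<Longrightarrow> fusion_morphism_with (G j) (G i) (f i j) (A i j)"
  using sys by (simp add: inverse_system_def)

lemma icomp: "\<lbrakk>i \<in> I; j \<in> I; k \<in> I; r i j; r j k; x \<in> carrier (Grp (G k))\<rbrakk> \<Longrightarrow> f i j (f j k x) = f i k x"
  using sys by (simp add: inverse_system_def)

lemma icat: "i \<in> I \<Longrightarrow> fusion_category (G i)"
  using ifin fusion_category_finite by blast

lemma igrp: "i \<in> I \<Longrightarrow> group (Grp (G i))"
  using icat fusion_category.grp by blast

lemma ifhom: "\<lbrakk>i \<in> I; j \<in> I; r i j\<rbrakk> \<Longrightarrow> f i j \<in> hom (Grp (G j)) (Grp (G i))"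
  using fusion_morphism_withD(1)[OF imor] .

lemma ifgrp: "\<lbrakk>i \<in> I; j \<in> I; r i j\<rbrakk> \<Longrightarrow> group_hom (Grp (G j)) (Grp (G i)) (f i j)"
  using igrp ifhom by (simp add: group_hom_def group_hom_axioms_def)

lemma Grp_L: "Grp L = lim_group I r G f" and Top_L: "Top L = lim_topology I r G f"
  and Hom_L: "Hom L = lim_hom I r G f A" and HomTop_L: "HomTop L = lim_hom_topology I r G f A"
  by (simp_all add: inverse_limit_def)

lemma carrier_L: "carrier (Grp L) = lim_carrier I r G f"
  by (simp add: Grp_L lim_group_def)

lemma mult_L: "x \<otimes>\<^bsub>Grp L\<^esub> y = (\<lambda>i\<in>I. x i \<otimes>\<^bsub>Grp (G i)\<^esub> y i)"
  by (simp add: Grp_L lim_group_def product_group_def)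

lemma lim_carrierD:
  assumes "x \<in> lim_carrier I r G f"
  shows "i \<in> I \<Longrightarrow> x i \<in> carrier (Grp (G i))" "x \<in> extensional I"
    "\<lbrakk>i \<in> I; j \<in> I; r i j\<rbrakk> \<Longrightarrow> f i j (x j) = x i"
  using assms by (auto simp: lim_carrier_def PiE_iff)

lemma group_L: "group (Grp L)"
proof -
  let ?P = "product_group I (\<lambda>i. Grp (G i))"
  interpret P: group ?P using igrp by (rule product_group)
  have "subgroup (lim_carrier I r G f) ?P"
  proof (rule P.subgroupI)
    show "lim_carrier I r G f \<subseteq> carrier ?P" by (auto simp: lim_carrier_def)
    have "\<one>\<^bsub>?P\<^esub> \<in> lim_carrier I r G f"
      using group_hom.hom_one[OF ifgrp] igrp
      by (auto simp: lim_carrier_def group.is_monoid monoid.one_closed)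
    then show "lim_carrier I r G f \<noteq> {}" by blast
    show "inv\<^bsub>?P\<^esub> x \<in> lim_carrier I r G f" if x: "x \<in> lim_carrier I r G f" for x
    proof -
      have xP: "x \<in> (\<Pi>\<^sub>E i\<in>I. carrier (Grp (G i)))" using x by (simp add: lim_carrier_def)
      have "inv\<^bsub>?P\<^esub> x = (\<lambda>i\<in>I. inv\<^bsub>Grp (G i)\<^esub> x i)" by (rule inv_product_group[OF xP igrp])
      moreover have "f i j (inv\<^bsub>Grp (G j)\<^esub> x j) = inv\<^bsub>Grp (G i)\<^esub> x i" if "i \<in> I" "j \<in> I" "r i j" for i j
        using group_hom.hom_inv[OF ifgrp[OF that]] lim_carrierD[OF x] that by simp
      moreover have "inv\<^bsub>Grp (G i)\<^esub> x i \<in> carrier (Grp (G i))" if "i \<in> I" for i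
        using group.inv_closed[OF igrp[OF that]] lim_carrierD(1)[OF x that] .
      ultimately show ?thesis by (auto simp: lim_carrier_def)
    qed
    show "x \<otimes>\<^bsub>?P\<^esub> y \<in> lim_carrier I r G f"
      if x: "x \<in> lim_carrier I r G f" and y: "y \<in> lim_carrier I r G f" for x y
    proof -
      have "f i j (x j \<otimes>\<^bsub>Grp (G j)\<^esub> y j) = x i \<otimes>\<^bsub>Grp (G i)\<^esub> y i" if "i \<in> I" "j \<in> I" "r i j" for i j
        using hom_mult[OF ifhom[OF that]] lim_carrierD[OF x] lim_carrierD[OF y] that by simp
      moreover have "x i \<otimes>\<^bsub>Grp (G i)\<^esub> y i \<in> carrier (Grp (G i))" if "i \<in> I" for i
        using igrp[OF that] lim_carrierD(1)[OF x that] lim_carrierD(1)[OF y that]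
        by (simp add: group.is_monoid monoid.m_closed)
      ultimately show ?thesis by (auto simp: lim_carrier_def)
    qed
  qed
  from P.subgroup_imp_group[OF this] show ?thesis by (simp add: Grp_L lim_group_def)
qed

lemma Top_char_L: "openin (Top L) U \<longleftrightarrow> U \<subseteq> carrier (Grp L) \<and>
  (\<forall>x\<in>U. \<exists>i\<in>I. \<forall>y\<in>carrier (Grp L). y i = x i \<longrightarrow> y \<in> U)"
  unfolding Top_L lim_topology_def carrier_L
proof (rule openin_directed_limit[OF idir])
  show "lim_carrier I r G f \<subseteq> (\<Pi>\<^sub>E i\<in>I. carrier (Grp (G i)))" by (auto simp: lim_carrier_def)
  show "Top (G i) = discrete_topology (carrier (Grp (G i)))" if "i \<in> I" for i
    using ifin[OF that] by (simp add: finite_fusion_system_def)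
  show "x i = y i" if "i \<in> I" "j \<in> I" "r i j" "x \<in> lim_carrier I r G f" "y \<in> lim_carrier I r G f" "x j = y j"
    for i j x y
    using lim_carrierD(3)[OF that(4) that(1-3)] lim_carrierD(3)[OF that(5) that(1-3)] that(6) by simp
qed

lemma closed_L:
  assumes "P \<in> Obj L" "x \<in> carrier (Grp L)" "\<And>i. i \<in> I \<Longrightarrow> x i \<in> proj_image i P"
  shows "x \<in> P"
proof (rule ccontr)
  assume "x \<notin> P"
  have "openin (Top L) (topspace (Top L) - P)" using assms(1) by (simp add: Obj_def closedin_def)
  moreover have "topspace (Top L) = carrier (Grp L)"
  proof
    show "topspace (Top L) \<subseteq> carrier (Grp L)" using openin_topspace Top_char_L by metis
    have "openin (Top L) (carrier (Grp L))" using Top_char_L directed_set_nonempty[OF idir] by blast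
    then show "carrier (Grp L) \<subseteq> topspace (Top L)" by (rule openin_subset)
  qed
  ultimately have "openin (Top L) (carrier (Grp L) - P)" by simp
  then obtain i where i: "i \<in> I" "\<forall>y\<in>carrier (Grp L). y i = x i \<longrightarrow> y \<in> carrier (Grp L) - P"
    using \<open>x \<notin> P\<close> assms(2) unfolding Top_char_L by blast
  obtain y where y: "y \<in> P" "y i = x i" using assms(3)[OF i(1)] by auto
  moreover have "y \<in> carrier (Grp L)" using y(1) assms(1) by (auto simp: Obj_def dest: subgroup.subset)
  ultimately show False using i(2) by blast
qed

lemma Obj_L_subset: "P \<in> Obj L \<Longrightarrow> P \<subseteq> lim_carrier I r G f"
  using carrier_L by (auto simp: Obj_def dest: subgroup.subset)

lemma f_proj_image:
  assumes "P \<subseteq> lim_carrier I r G f" "i \<in> I" "j \<in> I" "r i j"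
  shows "f i j ` proj_image j P = proj_image i P"
proof -
  have "f i j (x j) = x i" if "x \<in> P" for x using lim_carrierD(3) assms that by blast
  then show ?thesis by (auto simp: image_image)
qed

lemma lim_families_compat:
  assumes P: "P \<in> Obj L" and \<Phi>: "\<Phi> \<in> lim_families I r G A P Q"
    and ij: "i \<in> I" "j \<in> I" "r i j" and u: "u \<in> P"
  shows "f i j (\<Phi> j (u j)) = \<Phi> i (u i)"
proof -
  have h: "\<Phi> j \<in> Hom (G j) (proj_image j P) (proj_image j Q)"
    "A i j (proj_image j P) (proj_image j Q) (\<Phi> j) = \<Phi> i"
    using \<Phi> ij by (auto simp: lim_families_def)
  note o = fusion_category.Hom_obj[OF icat[OF ij(2)] h(1)]
  have "f i j (\<Phi> j (u j)) = A i j (proj_image j P) (proj_image j Q) (\<Phi> j) (f i j (u j))"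
    by (rule fusion_morphism_withD(5)[OF imor[OF ij] conjunct1[OF o] conjunct2[OF o] h(1)]) (use u in blast)
  also have "f i j (u j) = u i" using lim_carrierD(3) Obj_L_subset[OF P] u ij by blast
  finally show ?thesis using h(2) by simp
qed

text \<open>The right-hand side does not ask that the level maps be compatible under the functors
  \<open>A i j\<close>. Each level map is determined by \<phi> on the image of \<open>P\<close>, and
  the commutation rule in the definition of \<open>fusion_functor\<close> then forces
  compatibility.\<close>

lemma Hom_char_L: "\<phi> \<in> Hom L P Q \<longleftrightarrow> P \<in> Obj L \<and> Q \<in> Obj L \<and> \<phi> \<in> extensional P \<and>
  (\<forall>u\<in>P. \<phi> u \<in> Q) \<and>
  (\<forall>i\<in>I. \<exists>\<Phi>\<in>Hom (G i) (proj_image i P) (proj_image i Q). \<forall>u\<in>P. \<phi> u i = \<Phi> (u i))"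
  (is "_ \<longleftrightarrow> ?R")
proof
  assume "\<phi> \<in> Hom L P Q"
  then obtain \<Phi> where \<Phi>: "\<Phi> \<in> lim_families I r G A P Q" "\<phi> = realize I P \<Phi>"
    and P: "P \<in> Obj L" and Q: "Q \<in> Obj L"
    by (auto simp: Hom_L lim_hom_def Obj_def Grp_L Top_L)
  have \<Phi>H: "\<Phi> i \<in> Hom (G i) (proj_image i P) (proj_image i Q)" if "i \<in> I" for i
    using \<Phi>(1) that by (auto simp: lim_families_def)
  have \<phi>i: "\<phi> u i = \<Phi> i (u i)" if "u \<in> P" "i \<in> I" for u i
    using that by (simp add: \<Phi>(2) realize_def)
  have m: "\<Phi> i (u i) \<in> proj_image i Q" if "u \<in> P" "i \<in> I" for u i
    using fusion_category.Hom_maps[OF icat[OF that(2)] \<Phi>H[OF that(2)]] that(1) by blast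
  have "\<phi> u \<in> Q" if u: "u \<in> P" for u
  proof (rule closed_L[OF Q])
    have "\<Phi> i (u i) \<in> carrier (Grp (G i))" if i: "i \<in> I" for i
      using m[OF u i] Obj_L_subset[OF Q] lim_carrierD(1)[OF _ i] by auto
    moreover have "\<phi> u = (\<lambda>i\<in>I. \<Phi> i (u i))" using u by (simp add: \<Phi>(2) realize_def)
    ultimately show "\<phi> u \<in> carrier (Grp L)"
      using lim_families_compat[OF P \<Phi>(1) _ _ _ u] by (auto simp: carrier_L lim_carrier_def)
    show "\<phi> u i \<in> proj_image i Q" if "i \<in> I" for i using \<phi>i[OF u that] m[OF u that] by simp
  qed
  moreover have "\<phi> \<in> extensional P" by (simp add: \<Phi>(2) realize_def)
  ultimately show ?R using P Q \<Phi>H \<phi>i by blast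
next
  assume R: ?R
  then have P: "P \<in> Obj L" and Q: "Q \<in> Obj L" by auto
  obtain \<Psi> where \<Psi>: "\<And>i. i \<in> I \<Longrightarrow> \<Psi> i \<in> Hom (G i) (proj_image i P) (proj_image i Q)"
    "\<And>i u. i \<in> I \<Longrightarrow> u \<in> P \<Longrightarrow> \<phi> u i = \<Psi> i (u i)"
    using R by metis
  define \<Phi> where "\<Phi> = restrict \<Psi> I"
  have "\<Phi> \<in> lim_families I r G A P Q"
    unfolding lim_families_def
  proof (intro CollectI conjI ballI impI)
    show "\<Phi> \<in> (\<Pi>\<^sub>E i\<in>I. Hom (G i) (proj_image i P) (proj_image i Q))" using \<Psi>(1) by (auto simp: \<Phi>_def)
    fix i j assume ij: "i \<in> I" "j \<in> I" "r i j"
    note h = \<Psi>(1)[OF ij(2)]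
    note o = fusion_category.Hom_obj[OF icat[OF ij(2)] h]
    let ?A = "A i j (proj_image j P) (proj_image j Q) (\<Psi> j)"
    have fP: "f i j ` proj_image j P = proj_image i P" by (rule f_proj_image[OF Obj_L_subset[OF P] ij])
    have "?A \<in> Hom (G i) (f i j ` proj_image j P) (f i j ` proj_image j Q)"
      using fusion_morphism_withD(4)[OF imor[OF ij]] o h by blast
    from fusion_category.Hom_ext[OF icat[OF ij(1)] this]
    have e1: "?A \<in> extensional (proj_image i P)" unfolding fP .
    have e2: "\<Psi> i \<in> extensional (proj_image i P)"
      using fusion_category.Hom_ext[OF icat[OF ij(1)] \<Psi>(1)[OF ij(1)]] .
    have "?A v = \<Psi> i v" if v: "v \<in> proj_image i P" for v
    proof -
      obtain u where u: "u \<in> P" "v = u i" using v by blast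
      have "f i j (u j) = u i" using lim_carrierD(3) Obj_L_subset[OF P] u ij by blast
      then have "?A v = ?A (f i j (u j))" using u by simp
      also have "\<dots> = f i j (\<Psi> j (u j))"
        using fusion_morphism_withD(5)[OF imor[OF ij] conjunct1[OF o] conjunct2[OF o] h, of "u j"] u(1) by simp
      also have "\<dots> = f i j (\<phi> u j)" using \<Psi>(2)[OF ij(2) u(1)] by simp
      also have "\<dots> = \<phi> u i" using lim_carrierD(3)[OF _ ij] R u(1) Obj_L_subset[OF Q] by blast
      also have "\<dots> = \<Psi> i v" using \<Psi>(2)[OF ij(1) u(1)] u(2) by simp
      finally show ?thesis .
    qed
    then have "?A = \<Psi> i" by (rule extensionalityI[OF e1 e2])
    then show "A i j (proj_image j P) (proj_image j Q) (\<Phi> j) = \<Phi> i" using ij by (simp add: \<Phi>_def)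
  qed
  moreover have "\<phi> = realize I P \<Phi>"
  proof (rule extensionalityI[of _ P])
    show "\<phi> \<in> extensional P" using R by blast
    show "realize I P \<Phi> \<in> extensional P" by (simp add: realize_def)
    show "\<phi> u = realize I P \<Phi> u" if u: "u \<in> P" for u
    proof (rule extensionalityI[of _ I])
      show "\<phi> u \<in> extensional I" using R u Obj_L_subset[OF Q] lim_carrierD(2) by blast
      show "realize I P \<Phi> u \<in> extensional I" using u by (simp add: realize_def)
      show "\<phi> u i = realize I P \<Phi> u i" if "i \<in> I" for i
        using \<Psi>(2)[OF that u] that u by (simp add: realize_def \<Phi>_def)
    qed
  qed
  ultimately show "\<phi> \<in> Hom L P Q" using P Q
    by (auto simp: Hom_L lim_hom_def Obj_def Grp_L Top_L)
qed

text \<open>The topology of \<open>Hom\<close> is pulled back from the compatible families along the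
  inverse of \<open>realize\<close>. Two families have the same member at \<open>i\<close> if and
  only if the maps that they realize agree at coordinate \<open>i\<close> on \<open>P\<close>, which
  translates the description of the open sets.\<close>

lemma HomTop_char_L:
  assumes P: "P \<in> Obj L" and Q: "Q \<in> Obj L"
  shows "openin (HomTop L P Q) U \<longleftrightarrow> U \<subseteq> Hom L P Q \<and>
    (\<forall>\<phi>\<in>U. \<exists>i\<in>I. \<forall>\<psi>\<in>Hom L P Q. (\<forall>u\<in>P. \<psi> u i = \<phi> u i) \<longrightarrow> \<psi> \<in> U)" (is "_ \<longleftrightarrow> ?R")
proof -
  define fam where "fam = lim_families I r G A P Q"
  define \<Theta> where "\<Theta> = subtopology (product_topology (\<lambda>i. HomTop (G i) (proj_image i P) (proj_image i Q)) I) fam"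
  have famH: "\<Phi> i \<in> Hom (G i) (proj_image i P) (proj_image i Q)" if "\<Phi> \<in> fam" "i \<in> I" for \<Phi> i
    using that by (auto simp: fam_def lim_families_def)
  have app: "realize I P \<Phi> u i = \<Phi> i (u i)" if "u \<in> P" "i \<in> I" for \<Phi> u i
    using that by (simp add: realize_def)
  have level_eq: "\<Phi> i = \<Phi>' i \<longleftrightarrow> (\<forall>u\<in>P. realize I P \<Phi> u i = realize I P \<Phi>' u i)"
    if "\<Phi> \<in> fam" "\<Phi>' \<in> fam" "i \<in> I" for \<Phi> \<Phi>' i
  proof
    assume "\<Phi> i = \<Phi>' i"
    then show "\<forall>u\<in>P. realize I P \<Phi> u i = realize I P \<Phi>' u i" using app that(3) by simp
  next
    assume *: "\<forall>u\<in>P. realize I P \<Phi> u i = realize I P \<Phi>' u i"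
    show "\<Phi> i = \<Phi>' i"
    proof (rule extensionalityI)
      show "\<Phi> i \<in> extensional (proj_image i P)" "\<Phi>' i \<in> extensional (proj_image i P)"
        using fusion_category.Hom_ext[OF icat[OF that(3)] famH[OF that(1,3)]]
          fusion_category.Hom_ext[OF icat[OF that(3)] famH[OF that(2,3)]] by auto
      show "\<Phi> i v = \<Phi>' i v" if "v \<in> proj_image i P" for v
        using * app[OF _ \<open>i \<in> I\<close>] that by auto
    qed
  qed
  have inj: "inj_on (realize I P) fam"
  proof (rule inj_onI)
    fix \<Phi> \<Phi>' assume *: "\<Phi> \<in> fam" "\<Phi>' \<in> fam" "realize I P \<Phi> = realize I P \<Phi>'"
    show "\<Phi> = \<Phi>'"
    proof (rule extensionalityI[of _ I])
      show "\<Phi> \<in> extensional I" "\<Phi>' \<in> extensional I"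
        using * by (auto simp: fam_def lim_families_def PiE_iff)
      show "\<Phi> i = \<Phi>' i" if "i \<in> I" for i using level_eq[OF *(1,2) that] *(3) by simp
    qed
  qed
  have HomL: "Hom L P Q = realize I P ` fam"
    using P Q by (auto simp: Hom_L lim_hom_def Obj_def Grp_L Top_L fam_def)
  define g where "g = the_inv_into fam (realize I P)"
  have g: "g (realize I P \<Phi>) = \<Phi>" if "\<Phi> \<in> fam" for \<Phi>
    unfolding g_def using the_inv_into_f_f[OF inj that] .
  have open_fam: "openin \<Theta> V \<longleftrightarrow> V \<subseteq> fam \<and> (\<forall>\<Phi>\<in>V. \<exists>i\<in>I. \<forall>\<Psi>\<in>fam. \<Psi> i = \<Phi> i \<longrightarrow> \<Psi> \<in> V)" for V
    unfolding \<Theta>_def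
  proof (rule openin_directed_limit[OF idir])
    show "fam \<subseteq> (\<Pi>\<^sub>E i\<in>I. Hom (G i) (proj_image i P) (proj_image i Q))"
      by (auto simp: fam_def lim_families_def)
    show "HomTop (G i) (proj_image i P) (proj_image i Q) =
      discrete_topology (Hom (G i) (proj_image i P) (proj_image i Q))" if "i \<in> I" for i
      using ifin[OF that] by (simp add: finite_fusion_system_def)
    show "\<Phi> i = \<Psi> i" if "i \<in> I" "j \<in> I" "r i j" "\<Phi> \<in> fam" "\<Psi> \<in> fam" "\<Phi> j = \<Psi> j" for i j \<Phi> \<Psi>
    proof -
      have "A i j (proj_image j P) (proj_image j Q) (\<Phi> j) = \<Phi> i"
        "A i j (proj_image j P) (proj_image j Q) (\<Psi> j) = \<Psi> i"
        using that(1-5) by (auto simp: fam_def lim_families_def)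
      then show ?thesis using that(6) by simp
    qed
  qed
  have "openin (HomTop L P Q) U \<longleftrightarrow> (\<exists>V. openin \<Theta> V \<and> U = g -` V \<inter> Hom L P Q)"
    unfolding HomTop_L lim_hom_topology_def openin_pullback_topology Hom_L \<Theta>_def g_def fam_def ..
  also have "\<dots> \<longleftrightarrow> (\<exists>V. openin \<Theta> V \<and> U = realize I P ` V)"
  proof -
    have "g -` V \<inter> Hom L P Q = realize I P ` V" if "V \<subseteq> fam" for V
      using that g unfolding HomL by auto
    then show ?thesis using open_fam by metis
  qed
  also have "\<dots> \<longleftrightarrow> ?R"
  proof
    assume "\<exists>V. openin \<Theta> V \<and> U = realize I P ` V"
    then obtain V where V: "openin \<Theta> V" "U = realize I P ` V" by blast
    show ?R
    proof (intro conjI ballI)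
      show "U \<subseteq> Hom L P Q" using V open_fam HomL by blast
      fix \<phi> assume "\<phi> \<in> U"
      then obtain \<Phi> where \<Phi>: "\<Phi> \<in> V" "\<phi> = realize I P \<Phi>" using V by blast
      then obtain i where i: "i \<in> I" "\<forall>\<Psi>\<in>fam. \<Psi> i = \<Phi> i \<longrightarrow> \<Psi> \<in> V" using V open_fam by blast
      have \<Phi>f: "\<Phi> \<in> fam" using V open_fam \<Phi> by blast
      have "\<psi> \<in> U" if \<psi>: "\<psi> \<in> Hom L P Q" "\<forall>u\<in>P. \<psi> u i = \<phi> u i" for \<psi>
      proof -
        obtain \<Psi> where \<Psi>: "\<Psi> \<in> fam" "\<psi> = realize I P \<Psi>" using \<psi>(1) HomL by blast
        have "\<Psi> i = \<Phi> i" using level_eq[OF \<Psi>(1) \<Phi>f i(1)] \<psi>(2) \<Psi>(2) \<Phi>(2) by simp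
        then show ?thesis using i(2) \<Psi> V(2) by blast
      qed
      then show "\<exists>i\<in>I. \<forall>\<psi>\<in>Hom L P Q. (\<forall>u\<in>P. \<psi> u i = \<phi> u i) \<longrightarrow> \<psi> \<in> U" using i(1) by blast
    qed
  next
    assume R: ?R
    define V where "V = {\<Phi> \<in> fam. realize I P \<Phi> \<in> U}"
    have "openin \<Theta> V"
      unfolding open_fam
    proof (intro conjI ballI)
      show "V \<subseteq> fam" by (auto simp: V_def)
      fix \<Phi> assume \<Phi>: "\<Phi> \<in> V"
      then have \<Phi>f: "\<Phi> \<in> fam" "realize I P \<Phi> \<in> U" by (auto simp: V_def)
      then obtain i where i: "i \<in> I" "\<forall>\<psi>\<in>Hom L P Q. (\<forall>u\<in>P. \<psi> u i = realize I P \<Phi> u i) \<longrightarrow> \<psi> \<in> U"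
        using R by blast
      have "\<Psi> \<in> V" if \<Psi>: "\<Psi> \<in> fam" "\<Psi> i = \<Phi> i" for \<Psi>
      proof -
        have "realize I P \<Psi> \<in> Hom L P Q" using HomL \<Psi>(1) by blast
        then show ?thesis using i(2) level_eq[OF \<Psi>(1) \<Phi>f(1) i(1)] \<Psi> by (simp add: V_def)
      qed
      then show "\<exists>i\<in>I. \<forall>\<Psi>\<in>fam. \<Psi> i = \<Phi> i \<longrightarrow> \<Psi> \<in> V" using i(1) by blast
    qed
    moreover have "U = realize I P ` V" using R HomL by (auto simp: V_def)
    ultimately show "\<exists>V. openin \<Theta> V \<and> U = realize I P ` V" by blast
  qed
  finally show ?thesis .
qed

lemma fusion_limit_L: "fusion_limit p L I r G f (\<lambda>i x. x i)"
proof (rule fusion_limit.intro)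
  show "directed_set I r" by (rule idir)
  show "group (Grp L)" by (rule group_L)
  show "\<exists>x\<in>carrier (Grp L). \<forall>j\<in>I. x j = c j"
    if "\<And>j. j \<in> I \<Longrightarrow> c j \<in> carrier (Grp (G j))" "\<And>i j. \<lbrakk>i \<in> I; j \<in> I; r i j\<rbrakk> \<Longrightarrow> f i j (c j) = c i" for c
    using that by (intro bexI[of _ "restrict c I"]) (auto simp: carrier_L lim_carrier_def)
next
  fix j assume j: "j \<in> I"
  show "finite_fusion_system p (G j)" by (rule ifin[OF j])
  show "(\<lambda>x. x j) \<in> hom (Grp L) (Grp (G j))"
    using j lim_carrierD(1) by (auto simp: hom_def carrier_L mult_L)
next
  fix i j assume ij: "i \<in> I" "j \<in> I" "r i j"
  show "f i j \<in> hom (Grp (G j)) (Grp (G i))" by (rule ifhom[OF ij])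
  show "f i j (x j) = x i" if "x \<in> carrier (Grp L)" for x
    using that lim_carrierD(3)[OF _ ij] by (simp add: carrier_L)
  show "\<exists>\<Phi>\<in>Hom (G i) (f i j ` X) (f i j ` Y). \<forall>u\<in>X. f i j (\<phi> u) = \<Phi> (f i j u)"
    if \<phi>: "\<phi> \<in> Hom (G j) X Y" for \<phi> X Y
  proof -
    note o = fusion_category.Hom_obj[OF icat[OF ij(2)] \<phi>]
    show ?thesis
      using fusion_morphism_withD(4,5)[OF imor[OF ij] conjunct1[OF o] conjunct2[OF o] \<phi>] by blast
  qed
next
  fix x y assume "x \<in> carrier (Grp L)" "y \<in> carrier (Grp L)" "\<And>j. j \<in> I \<Longrightarrow> x j = y j"
  then show "x = y" using lim_carrierD(2) by (intro extensionalityI[of _ I]) (auto simp: carrier_L)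
qed (rule icomp Top_char_L Hom_char_L HomTop_char_L; assumption)+

end

text \<open>
  Isomorphisms do not mention the topologies of the \<open>Hom\<close> sets; the presentation \<open>fusion_limit p F\<close>
  of the first fusion system is needed to identify them.
\<close>

lemma fusion_limit_isomorphic:
  assumes F: "fusion_limit q F I s H h b" and L: "fusion_limit p L J r G f c"
    and iso: "fusion_isomorphic F L"
  shows "\<exists>a. fusion_limit p F J r G f a"
proof -
  interpret F: fusion_limit q F I s H h b by (rule F)
  interpret L: fusion_limit p L J r G f c by (rule L)
  obtain \<alpha> \<beta> A B where \<alpha>: "fusion_morphism_with F L \<alpha> A" and \<beta>: "fusion_morphism_with L F \<beta> B"
    and ba: "\<And>x. x \<in> carrier (Grp F) \<Longrightarrow> \<beta> (\<alpha> x) = x" and ab: "\<And>y. y \<in> carrier (Grp L) \<Longrightarrow> \<alpha> (\<beta> y) = y"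
    using iso by (auto simp: fusion_isomorphic_def fusion_morphism_def)
  have \<alpha>c: "\<alpha> x \<in> carrier (Grp L)" if "x \<in> carrier (Grp F)" for x
    using fusion_morphism_withD(1)[OF \<alpha>] that by (auto simp: hom_def)
  have \<beta>c: "\<beta> y \<in> carrier (Grp F)" if "y \<in> carrier (Grp L)" for y
    using fusion_morphism_withD(1)[OF \<beta>] that by (auto simp: hom_def)
  define a where "a = (\<lambda>j x. c j (\<alpha> x))"
  have Ta: "openin (Top F) U \<longleftrightarrow> U \<subseteq> carrier (Grp F) \<and>
      (\<forall>x\<in>U. \<exists>j\<in>J. \<forall>y\<in>carrier (Grp F). a j y = a j x \<longrightarrow> y \<in> U)" (is "_ \<longleftrightarrow> ?R") for U
  proof
    assume U: "openin (Top F) U"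
    then have US: "U \<subseteq> carrier (Grp F)" using F.Top_char by blast
    have "openin (Top L) {y \<in> topspace (Top L). \<beta> y \<in> U}"
      using fusion_morphism_withD(2)[OF \<beta>] U by (rule openin_continuous_map_preimage)
    then have V: "openin (Top L) {y \<in> carrier (Grp L). \<beta> y \<in> U}" by (simp add: L.topspace_Top)
    show ?R
    proof (intro conjI ballI US)
      fix x assume x: "x \<in> U"
      then have "\<alpha> x \<in> {y \<in> carrier (Grp L). \<beta> y \<in> U}" using US ba \<alpha>c by auto
      then obtain j where j: "j \<in> J"
        "\<forall>y\<in>carrier (Grp L). c j y = c j (\<alpha> x) \<longrightarrow> y \<in> {y \<in> carrier (Grp L). \<beta> y \<in> U}"
        using V L.Top_char by meson
      have "x' \<in> U" if "x' \<in> carrier (Grp F)" "a j x' = a j x" for x'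
      proof -
        have "\<beta> (\<alpha> x') \<in> U" using j(2) \<alpha>c[OF that(1)] that(2) by (simp add: a_def)
        then show ?thesis using ba[OF that(1)] by simp
      qed
      then show "\<exists>j\<in>J. \<forall>y\<in>carrier (Grp F). a j y = a j x \<longrightarrow> y \<in> U" using j(1) by blast
    qed
  next
    assume R: ?R
    define V where "V = {y \<in> carrier (Grp L). \<beta> y \<in> U}"
    have "openin (Top L) V"
      unfolding L.Top_char
    proof (intro conjI ballI)
      show "V \<subseteq> carrier (Grp L)" by (auto simp: V_def)
      fix y assume y: "y \<in> V"
      then obtain j where j: "j \<in> J" "\<forall>x\<in>carrier (Grp F). a j x = a j (\<beta> y) \<longrightarrow> x \<in> U"
        using R by (auto simp: V_def)
      have "y' \<in> V" if y': "y' \<in> carrier (Grp L)" "c j y' = c j y" for y'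
      proof -
        have "a j (\<beta> y') = a j (\<beta> y)" using y y' ab by (simp add: a_def V_def)
        then show ?thesis using j(2) \<beta>c[OF y'(1)] y'(1) by (simp add: V_def)
      qed
      then show "\<exists>j\<in>J. \<forall>y'\<in>carrier (Grp L). c j y' = c j y \<longrightarrow> y' \<in> V" using j(1) by blast
    qed
    then have "openin (Top F) {x \<in> topspace (Top F). \<alpha> x \<in> V}"
      using fusion_morphism_withD(2)[OF \<alpha>] by (intro openin_continuous_map_preimage)
    moreover have "{x \<in> topspace (Top F). \<alpha> x \<in> V} = U"
      using R ba \<alpha>c by (auto simp: F.topspace_Top V_def)
    ultimately show "openin (Top F) U" by simp
  qed
  have ahom: "a j \<in> hom (Grp F) (Grp (G j))" if "j \<in> J" for j
    using hom_compose[OF fusion_morphism_withD(1)[OF \<alpha>] L.ahom[OF that]] by (simp add: a_def o_def)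
  have im: "a j ` P = c j ` \<alpha> ` P" for j P by (simp add: a_def image_image)
  have \<beta>\<alpha>: "\<beta> ` \<alpha> ` P = P" if "P \<in> Obj F" for P
    using ba F.Obj_sub[OF that] by (force simp: image_image)
  \<comment> \<open>The families \<open>a\<close> and \<open>b\<close> define the same topology on
    the group. The kernel of a member of one is open, hence contains the kernel of a member of the
    other, and agreement under the latter implies agreement under the former. So both families
    describe the same open sets of morphisms.\<close>
  have dominate: "\<exists>k\<in>K. \<forall>x\<in>carrier (Grp F). \<forall>y\<in>carrier (Grp F). d' k x = d' k y \<longrightarrow> d x = d y"
    if d: "d \<in> hom (Grp F) D" "group D"
      and op: "openin (Top F) {x \<in> carrier (Grp F). d x = \<one>\<^bsub>D\<^esub>}"
      and ch: "\<And>U. openin (Top F) U \<Longrightarrow> \<forall>x\<in>U. \<exists>k\<in>K. \<forall>y\<in>carrier (Grp F). d' k y = d' k x \<longrightarrow> y \<in> U"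
      and d': "\<And>k. k \<in> K \<Longrightarrow> d' k \<in> hom (Grp F) (D' k)" "\<And>k. k \<in> K \<Longrightarrow> group (D' k)"
    for d :: "'a \<Rightarrow> 'x" and D :: "'x monoid" and K :: "'y set" and d' :: "'y \<Rightarrow> 'a \<Rightarrow> 'z" and D' :: "'y \<Rightarrow> 'z monoid"
  proof -
    interpret d: group_hom "Grp F" D d using d F.grpF by (simp add: group_hom_def group_hom_axioms_def)
    have "\<one>\<^bsub>Grp F\<^esub> \<in> {x \<in> carrier (Grp F). d x = \<one>\<^bsub>D\<^esub>}" by simp
    then obtain k where k: "k \<in> K"
      "\<forall>y\<in>carrier (Grp F). d' k y = d' k \<one>\<^bsub>Grp F\<^esub> \<longrightarrow> y \<in> {x \<in> carrier (Grp F). d x = \<one>\<^bsub>D\<^esub>}"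
      using ch[OF op] by blast
    interpret d': group_hom "Grp F" "D' k" "d' k"
      using d'[OF k(1)] F.grpF by (simp add: group_hom_def group_hom_axioms_def)
    have "d x = d y" if xy: "x \<in> carrier (Grp F)" "y \<in> carrier (Grp F)" "d' k x = d' k y" for x y
    proof -
      have "d' k (x \<otimes>\<^bsub>Grp F\<^esub> inv\<^bsub>Grp F\<^esub> y) = d' k \<one>\<^bsub>Grp F\<^esub>" using xy by simp
      then have "d (x \<otimes>\<^bsub>Grp F\<^esub> inv\<^bsub>Grp F\<^esub> y) = \<one>\<^bsub>D\<^esub>" using k(2) xy by simp
      then have "d x \<otimes>\<^bsub>D\<^esub> inv\<^bsub>D\<^esub> d y = \<one>\<^bsub>D\<^esub>" using xy by simp
      then show ?thesis using xy d.H.inv_equality d.H.inv_inv d.hom_closed d.H.inv_closed by metis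
    qed
    then show ?thesis using k(1) by blast
  qed
  have ba_dom: "\<exists>j\<in>J. \<forall>x\<in>carrier (Grp F). \<forall>y\<in>carrier (Grp F). a j x = a j y \<longrightarrow> b i x = b i y" if i: "i \<in> I" for i
  proof (rule dominate[OF F.ahom[OF i] F.Ggrp[OF i]])
    show "openin (Top F) {x \<in> carrier (Grp F). b i x = \<one>\<^bsub>Grp (H i)\<^esub>}"
      unfolding F.Top_char
    proof (intro conjI ballI)
      show "\<exists>k\<in>I. \<forall>y\<in>carrier (Grp F). b k y = b k x \<longrightarrow> y \<in> {x \<in> carrier (Grp F). b i x = \<one>\<^bsub>Grp (H i)\<^esub>}"
        if "x \<in> {x \<in> carrier (Grp F). b i x = \<one>\<^bsub>Grp (H i)\<^esub>}" for x
        using i that by (intro bexI[of _ i]) auto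
    qed auto
    show "\<forall>x\<in>U. \<exists>k\<in>J. \<forall>y\<in>carrier (Grp F). a k y = a k x \<longrightarrow> y \<in> U" if "openin (Top F) U" for U
      using that Ta by blast
  qed (rule ahom L.Ggrp; assumption)+
  have ab_dom: "\<exists>i\<in>I. \<forall>x\<in>carrier (Grp F). \<forall>y\<in>carrier (Grp F). b i x = b i y \<longrightarrow> a j x = a j y" if j: "j \<in> J" for j
  proof (rule dominate[OF ahom[OF j] L.Ggrp[OF j]])
    show "openin (Top F) {x \<in> carrier (Grp F). a j x = \<one>\<^bsub>Grp (G j)\<^esub>}"
      unfolding Ta
    proof (intro conjI ballI)
      show "\<exists>k\<in>J. \<forall>y\<in>carrier (Grp F). a k y = a k x \<longrightarrow> y \<in> {x \<in> carrier (Grp F). a j x = \<one>\<^bsub>Grp (G j)\<^esub>}"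
        if "x \<in> {x \<in> carrier (Grp F). a j x = \<one>\<^bsub>Grp (G j)\<^esub>}" for x
        using j that by (intro bexI[of _ j]) auto
    qed auto
    show "\<forall>x\<in>U. \<exists>k\<in>I. \<forall>y\<in>carrier (Grp F). b k y = b k x \<longrightarrow> y \<in> U" if "openin (Top F) U" for U
      using that F.Top_char by blast
  qed (rule F.ahom F.Ggrp; assumption)+
  have "fusion_limit p F J r G f a"
  proof (rule fusion_limit.intro)
    show "group (Grp F)" by (rule F.grpF)
    show "f i j (a j x) = a i x" if "i \<in> J" "j \<in> J" "r i j" "x \<in> carrier (Grp F)" for i j x
      using L.acomp[OF that(1-3) \<alpha>c[OF that(4)]] by (simp add: a_def)
    show "x = y" if xy: "x \<in> carrier (Grp F)" "y \<in> carrier (Grp F)" "\<And>j. j \<in> J \<Longrightarrow> a j x = a j y" for x y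
    proof -
      have "\<alpha> x = \<alpha> y" using L.asep[OF \<alpha>c[OF xy(1)] \<alpha>c[OF xy(2)]] xy(3) by (simp add: a_def)
      then show ?thesis using ba xy(1,2) by metis
    qed
    show "\<exists>x\<in>carrier (Grp F). \<forall>j\<in>J. a j x = d j"
      if d: "\<And>j. j \<in> J \<Longrightarrow> d j \<in> carrier (Grp (G j))" "\<And>i j. \<lbrakk>i \<in> J; j \<in> J; r i j\<rbrakk> \<Longrightarrow> f i j (d j) = d i" for d
    proof -
      obtain y where y: "y \<in> carrier (Grp L)" "\<forall>j\<in>J. c j y = d j" using L.acomplete[OF d] by blast
      then show ?thesis using \<beta>c ab by (intro bexI[of _ "\<beta> y"]) (auto simp: a_def)
    qed
    show "\<phi> \<in> Hom F P Q \<longleftrightarrow> P \<in> Obj F \<and> Q \<in> Obj F \<and> \<phi> \<in> extensional P \<and> (\<forall>u\<in>P. \<phi> u \<in> Q) \<and>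
        (\<forall>j\<in>J. \<exists>\<Phi>\<in>Hom (G j) (a j ` P) (a j ` Q). \<forall>u\<in>P. a j (\<phi> u) = \<Phi> (a j u))" (is "_ \<longleftrightarrow> ?R")
      for \<phi> P Q
    proof
      assume \<phi>: "\<phi> \<in> Hom F P Q"
      note o = F.Hom_obj[OF \<phi>]
      note h = fusion_morphism_withD(4)[OF \<alpha> conjunct1[OF o] conjunct2[OF o] \<phi>]
      have "\<exists>\<Phi>\<in>Hom (G j) (a j ` P) (a j ` Q). \<forall>u\<in>P. a j (\<phi> u) = \<Phi> (a j u)" if j: "j \<in> J" for j
      proof -
        obtain \<Phi> where \<Phi>: "\<Phi> \<in> Hom (G j) (c j ` \<alpha> ` P) (c j ` \<alpha> ` Q)"
          "\<forall>v\<in>\<alpha> ` P. c j (A P Q \<phi> v) = \<Phi> (c j v)"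
          using h j unfolding L.Hom_char by blast
        have "a j (\<phi> u) = \<Phi> (a j u)" if "u \<in> P" for u
          using \<Phi>(2) fusion_morphism_withD(5)[OF \<alpha> conjunct1[OF o] conjunct2[OF o] \<phi> that] that
          by (simp add: a_def)
        then show ?thesis using \<Phi>(1) im by auto
      qed
      then show ?R using o F.Hom_ext[OF \<phi>] F.Hom_maps[OF \<phi>] by blast
    next
      assume R: ?R
      then have P: "P \<in> Obj F" and Q: "Q \<in> Obj F" by auto
      have PS: "P \<subseteq> carrier (Grp F)" and QS: "Q \<subseteq> carrier (Grp F)" using F.Obj_sub P Q by auto
      \<comment> \<open>The conjugate of \<phi> by the isomorphism is a morphism of \<open>L\<close>
        by the level condition. The functor \<open>B\<close> that belongs to \<beta> carries it back
        to \<phi>.\<close>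
      define \<psi> where "\<psi> = (\<lambda>v\<in>\<alpha> ` P. \<alpha> (\<phi> (\<beta> v)))"
      have \<psi>a: "\<psi> (\<alpha> u) = \<alpha> (\<phi> u)" if "u \<in> P" for u using that PS ba by (auto simp: \<psi>_def)
      have \<psi>: "\<psi> \<in> Hom L (\<alpha> ` P) (\<alpha> ` Q)"
        unfolding L.Hom_char
      proof (intro conjI ballI)
        show "\<alpha> ` P \<in> Obj L" "\<alpha> ` Q \<in> Obj L" using fusion_morphism_withD(3)[OF \<alpha>] P Q by auto
        show "\<psi> \<in> extensional (\<alpha> ` P)" by (simp add: \<psi>_def)
        show "\<psi> v \<in> \<alpha> ` Q" if "v \<in> \<alpha> ` P" for v using that \<psi>a R by auto
        fix j assume j: "j \<in> J"
        obtain \<Phi> where \<Phi>: "\<Phi> \<in> Hom (G j) (a j ` P) (a j ` Q)" "\<forall>u\<in>P. a j (\<phi> u) = \<Phi> (a j u)"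
          using R j by blast
        have "\<forall>v\<in>\<alpha> ` P. c j (\<psi> v) = \<Phi> (c j v)" using \<Phi>(2) \<psi>a by (auto simp: a_def)
        then show "\<exists>\<Phi>\<in>Hom (G j) (c j ` \<alpha> ` P) (c j ` \<alpha> ` Q). \<forall>v\<in>\<alpha> ` P. c j (\<psi> v) = \<Phi> (c j v)"
          using \<Phi>(1) im by metis
      qed
      note o = L.Hom_obj[OF \<psi>]
      have B: "B (\<alpha> ` P) (\<alpha> ` Q) \<psi> \<in> Hom F P Q"
        using fusion_morphism_withD(4)[OF \<beta> conjunct1[OF o] conjunct2[OF o] \<psi>] \<beta>\<alpha>[OF P] \<beta>\<alpha>[OF Q] by simp
      have "B (\<alpha> ` P) (\<alpha> ` Q) \<psi> = \<phi>"
      proof (rule extensionalityI[of _ P])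
        show "B (\<alpha> ` P) (\<alpha> ` Q) \<psi> \<in> extensional P" by (rule F.Hom_ext[OF B])
        show "\<phi> \<in> extensional P" using R by blast
        fix u assume u: "u \<in> P"
        have "B (\<alpha> ` P) (\<alpha> ` Q) \<psi> (\<beta> (\<alpha> u)) = \<beta> (\<psi> (\<alpha> u))"
          using fusion_morphism_withD(5)[OF \<beta> conjunct1[OF o] conjunct2[OF o] \<psi>, of "\<alpha> u"] u by simp
        moreover have "\<phi> u \<in> carrier (Grp F)" using R u QS by blast
        ultimately show "B (\<alpha> ` P) (\<alpha> ` Q) \<psi> u = \<phi> u" using u PS ba \<psi>a[OF u] by auto
      qed
      then show "\<phi> \<in> Hom F P Q" using B by simp
    qed
    show "openin (HomTop F P Q) U \<longleftrightarrow> U \<subseteq> Hom F P Q \<and>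
        (\<forall>\<phi>\<in>U. \<exists>j\<in>J. \<forall>\<psi>\<in>Hom F P Q. (\<forall>u\<in>P. a j (\<psi> u) = a j (\<phi> u)) \<longrightarrow> \<psi> \<in> U)"
      if P: "P \<in> Obj F" and Q: "Q \<in> Obj F" for P Q U
    proof -
      have c: "\<phi> u \<in> carrier (Grp F)" if "\<phi> \<in> Hom F P Q" "u \<in> P" for \<phi> u
        using F.Hom_maps[OF that] F.Obj_sub[OF Q] by blast
      have "(\<exists>i\<in>I. \<forall>\<psi>\<in>Hom F P Q. (\<forall>u\<in>P. b i (\<psi> u) = b i (\<phi> u)) \<longrightarrow> \<psi> \<in> U) \<longleftrightarrow>
        (\<exists>j\<in>J. \<forall>\<psi>\<in>Hom F P Q. (\<forall>u\<in>P. a j (\<psi> u) = a j (\<phi> u)) \<longrightarrow> \<psi> \<in> U)" if \<phi>: "\<phi> \<in> Hom F P Q" for \<phi>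
      proof
        assume "\<exists>i\<in>I. \<forall>\<psi>\<in>Hom F P Q. (\<forall>u\<in>P. b i (\<psi> u) = b i (\<phi> u)) \<longrightarrow> \<psi> \<in> U"
        then obtain i where i: "i \<in> I" "\<forall>\<psi>\<in>Hom F P Q. (\<forall>u\<in>P. b i (\<psi> u) = b i (\<phi> u)) \<longrightarrow> \<psi> \<in> U" by blast
        obtain j where j: "j \<in> J"
          "\<forall>x\<in>carrier (Grp F). \<forall>y\<in>carrier (Grp F). a j x = a j y \<longrightarrow> b i x = b i y"
          using ba_dom[OF i(1)] by blast
        have "\<forall>\<psi>\<in>Hom F P Q. (\<forall>u\<in>P. a j (\<psi> u) = a j (\<phi> u)) \<longrightarrow> \<psi> \<in> U" using i(2) j(2) c \<phi> by metis
        then show "\<exists>j\<in>J. \<forall>\<psi>\<in>Hom F P Q. (\<forall>u\<in>P. a j (\<psi> u) = a j (\<phi> u)) \<longrightarrow> \<psi> \<in> U" using j(1) by blast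
      next
        assume "\<exists>j\<in>J. \<forall>\<psi>\<in>Hom F P Q. (\<forall>u\<in>P. a j (\<psi> u) = a j (\<phi> u)) \<longrightarrow> \<psi> \<in> U"
        then obtain j where j: "j \<in> J" "\<forall>\<psi>\<in>Hom F P Q. (\<forall>u\<in>P. a j (\<psi> u) = a j (\<phi> u)) \<longrightarrow> \<psi> \<in> U" by blast
        obtain i where i: "i \<in> I"
          "\<forall>x\<in>carrier (Grp F). \<forall>y\<in>carrier (Grp F). b i x = b i y \<longrightarrow> a j x = a j y"
          using ab_dom[OF j(1)] by blast
        have "\<forall>\<psi>\<in>Hom F P Q. (\<forall>u\<in>P. b i (\<psi> u) = b i (\<phi> u)) \<longrightarrow> \<psi> \<in> U" using j(2) i(2) c \<phi> by metis
        then show "\<exists>i\<in>I. \<forall>\<psi>\<in>Hom F P Q. (\<forall>u\<in>P. b i (\<psi> u) = b i (\<phi> u)) \<longrightarrow> \<psi> \<in> U" using i(1) by blast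
      qed
      then show ?thesis unfolding F.HomTop_char[OF P Q] by blast
    qed
  qed (rule L.dir L.fin L.fhom L.fcomp L.fHom ahom Ta; assumption)+
  then show ?thesis by blast
qed

text \<open>In a discrete group the trivial subgroup is open and normal. Taken for \<open>N\<close>
  in both conditions of \<open>sylow_pro_p\<close>, it turns the indices into the order of
  \<open>H\<close> and the index of \<open>H\<close>.\<close>

lemma sylow_pro_p_discrete:
  assumes "group K" and fin: "finite (carrier K)" and T: "T = discrete_topology (carrier K)"
    and syl: "sylow_pro_p p K T H"
  shows "sylow_card p (card H) (card (carrier K))"
proof -
  interpret group K by fact
  have H: "subgroup H K" and pro: "pro_p_group p (K\<lparr>carrier := H\<rparr>) (subtopology T H)"
    and ix: "\<And>N. N \<lhd> K \<Longrightarrow> openin T N \<Longrightarrow> \<not> p dvd card (rcosets\<^bsub>K\<^esub> (H <#>\<^bsub>K\<^esub> N))"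
    using syl by (auto simp: sylow_pro_p_def)
  have HK: "H \<subseteq> carrier K" using H by (rule subgroup.subset)
  have "H <#>\<^bsub>K\<^esub> {\<one>\<^bsub>K\<^esub>} = H" using HK by (auto simp: set_mult_def subset_iff)
  then have nd: "\<not> p dvd card (rcosets\<^bsub>K\<^esub> H)" using ix[OF one_is_normal] T by simp
  have "card (carrier K) = card H * card (rcosets\<^bsub>K\<^esub> H)"
    using lagrange[OF H] by (simp add: Coset.order_def mult.commute)
  moreover have "\<exists>k. card H = p ^ k"
  proof -
    interpret HH: group "K\<lparr>carrier := H\<rparr>" using H by (rule subgroup_imp_group)
    have "openin (subtopology T H) {\<one>\<^bsub>K\<^esub>}"
      using T HK subgroup.one_closed[OF H] by (auto simp: subtopology_discrete_topology)
    then have "\<exists>k. card (rcosets\<^bsub>K\<lparr>carrier := H\<rparr>\<^esub> {\<one>\<^bsub>K\<^esub>}) = p ^ k"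
      using pro HH.one_is_normal by (simp add: pro_p_group_def)
    moreover have "card (rcosets\<^bsub>K\<lparr>carrier := H\<rparr>\<^esub> {\<one>\<^bsub>K\<^esub>}) = card H"
      using HH.card_rcosets_triv finite_subset[OF HK fin] by (simp add: Coset.order_def)
    ultimately show ?thesis by simp
  qed
  ultimately show ?thesis using nd unfolding sylow_card_def by metis
qed

section \<open>Finiteness, functoriality and limits of automorphism groups and normalizers\<close>

context fusion_limit
begin

lemma finite_Hom:
  assumes j: "j \<in> J" and X: "X \<in> Obj (G j)"
  shows "finite (Hom (G j) X Y)"
proof (cases "Hom (G j) X Y = {}")
  case False
  then obtain \<phi> where "\<phi> \<in> Hom (G j) X Y" by blast
  then have Y: "Y \<in> Obj (G j)" using fusion_category.Hom_obj[OF Gcat[OF j]] by blast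
  have fin: "finite X" "finite Y"
    using X Y fusion_category.Obj_subset[OF Gcat[OF j]] Gfinite[OF j] finite_subset by blast+
  have "Hom (G j) X Y \<subseteq> (\<Pi>\<^sub>E u\<in>X. Y)"
  proof
    fix \<phi> assume \<phi>: "\<phi> \<in> Hom (G j) X Y"
    show "\<phi> \<in> (\<Pi>\<^sub>E u\<in>X. Y)"
      using fusion_category.Hom_ext[OF Gcat[OF j] \<phi>] fusion_category.Hom_maps[OF Gcat[OF j] \<phi>]
      by (simp add: PiE_iff)
  qed
  then show ?thesis using fin by (meson finite_PiE finite_subset)
qed simp

lemma finite_Iso:
  assumes j: "j \<in> J" and X: "X \<in> Obj (G j)"
  shows "finite (Iso (G j) X Y)"
proof -
  have "Iso (G j) X Y \<subseteq> Hom (G j) X Y" by (auto simp: Iso_def)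
  then show ?thesis using finite_Hom[OF j X] finite_subset by blast
qed

lemma Aut_S_sylow:
  assumes j: "j \<in> J" and X: "X \<in> Obj (G j)" and fn: "fully_normalized p (G j) X"
  shows "sylow_card p (card (Aut_S (G j) X)) (card (Iso (G j) X X))"
proof -
  interpret Gj: fusion_category "G j" by (rule Gcat[OF j])
  have HT: "HomTop (G j) X X = discrete_topology (Hom (G j) X X)"
    using fin[OF j] by (simp add: finite_fusion_system_def)
  have sub: "Iso (G j) X X \<subseteq> Hom (G j) X X" by (auto simp: Iso_def)
  have "Aut_topology (G j) X = discrete_topology (carrier (Aut_group (G j) X))"
    unfolding Aut_topology_def HT Gj.carrier_Aut subtopology_discrete_topology
    using sub by (simp add: Int_absorb1)
  then show ?thesis
    using sylow_pro_p_discrete[OF Gj.group_Aut[OF X]] finite_Iso[OF j X] fn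
    by (simp add: fully_normalized_def Gj.carrier_Aut)
qed

lemma push_push:
  assumes ij: "i \<in> J" "j \<in> J" "k \<in> J" "r i j" "r j k" and \<phi>: "\<phi> \<in> Hom (G k) X Y"
  shows "push (f i j) (f j k ` X) (push (f j k) X \<phi>) = push (f i k) X \<phi>"
proof -
  have ik: "r i k" using directed_set_trans[OF dir ij] .
  interpret Gk: fusion_category "G k" by (rule Gcat[OF ij(3)])
  have X: "X \<subseteq> carrier (Grp (G k))" and Y: "Y \<subseteq> carrier (Grp (G k))"
    using Gk.Hom_obj[OF \<phi>] Gk.Obj_subset by auto
  have im: "f i j ` f j k ` X = f i k ` X"
    using fcomp[OF ij] X by (force simp: image_image subset_iff intro!: image_cong)
  show ?thesis
  proof (rule push_eqI)
    show "push (f i k) X \<phi> \<in> extensional (f i j ` f j k ` X)"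
      unfolding im using fusion_category.Hom_ext[OF Gcat[OF ij(1)] fpush(1)[OF ij(1,3) ik \<phi>]] .
    fix u assume "u \<in> f j k ` X"
    then obtain w where w: "w \<in> X" "u = f j k w" by blast
    have "push (f i k) X \<phi> (f i j u) = push (f i k) X \<phi> (f i k w)" using fcomp[OF ij] w X by auto
    also have "\<dots> = f i k (\<phi> w)" by (rule fpush(2)[OF ij(1,3) ik \<phi> w(1)])
    also have "\<dots> = f i j (f j k (\<phi> w))" using fcomp[OF ij] Gk.Hom_maps[OF \<phi> w(1)] Y by auto
    also have "f j k (\<phi> w) = push (f j k) X \<phi> u" using fpush(2)[OF ij(2,3,5) \<phi> w(1)] w by simp
    finally show "push (f i k) X \<phi> (f i j u) = f i j (push (f j k) X \<phi> u)" .
  qed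
qed

lemma push_apush:
  assumes ij: "i \<in> J" "j \<in> J" "r i j" and \<phi>: "\<phi> \<in> Hom F P Q"
  shows "push (f i j) (a j ` P) (push (a j) P \<phi>) = push (a i) P \<phi>"
proof -
  have P: "P \<subseteq> carrier (Grp F)" and Q: "Q \<subseteq> carrier (Grp F)" using Hom_objs[OF \<phi>] Obj_sub by auto
  show ?thesis
  proof (rule push_eqI)
    show "push (a i) P \<phi> \<in> extensional (f i j ` a j ` P)"
      unfolding f_image_a[OF ij P] using fusion_category.Hom_ext[OF Gcat[OF ij(1)] apush(1)[OF ij(1) \<phi>]] .
    fix u assume "u \<in> a j ` P"
    then obtain w where w: "w \<in> P" "u = a j w" by blast
    have "push (a i) P \<phi> (f i j u) = push (a i) P \<phi> (a i w)" using acomp[OF ij] w P by auto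
    also have "\<dots> = a i (\<phi> w)" by (rule apush(2)[OF ij(1) \<phi> w(1)])
    also have "\<dots> = f i j (a j (\<phi> w))" using acomp[OF ij] Hom_in[OF \<phi> w(1)] Q by auto
    also have "a j (\<phi> w) = push (a j) P \<phi> u" using apush(2)[OF ij(2) \<phi> w(1)] w by simp
    finally show "push (a i) P \<phi> (f i j u) = f i j (push (a j) P \<phi> u)" .
  qed
qed

lemma fpush_Iso:
  assumes ij: "i \<in> J" "j \<in> J" "r i j" and \<phi>: "\<phi> \<in> Iso (G j) X Y"
  shows "push (f i j) X \<phi> \<in> Iso (G i) (f i j ` X) (f i j ` Y)"
proof -
  interpret Gi: fusion_category "G i" by (rule Gcat[OF ij(1)])
  interpret Gj: fusion_category "G j" by (rule Gcat[OF ij(2)])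
  have h: "\<phi> \<in> Hom (G j) X Y" "\<phi> ` X = Y" using \<phi> by (auto simp: Gj.Iso_iff)
  have "push (f i j) X \<phi> ` f i j ` X = f i j ` \<phi> ` X"
    using fpush(2)[OF ij h(1)] by (simp add: image_image)
  then show ?thesis using fpush(1)[OF ij h(1)] h(2) by (simp add: Gi.Iso_iff)
qed

lemma apush_Iso:
  assumes j: "j \<in> J" and \<phi>: "\<phi> \<in> Iso F P Q"
  shows "push (a j) P \<phi> \<in> Iso (G j) (a j ` P) (a j ` Q)"
proof -
  interpret Gj: fusion_category "G j" by (rule Gcat[OF j])
  have h: "\<phi> \<in> Hom F P Q" "\<phi> ` P = Q" using \<phi> by (auto simp: Iso_iff)
  show ?thesis using apush(1)[OF j h(1)] Hom_mapsto_Obj(2)[OF h(1) j] h(2) by (simp add: Gj.Iso_iff)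
qed

lemma apush_eq_iff:
  assumes j: "j \<in> J" and \<phi>: "\<phi> \<in> Hom F P Q" and \<psi>: "\<psi> \<in> Hom F P Q'"
  shows "push (a j) P \<phi> = push (a j) P \<psi> \<longleftrightarrow> (\<forall>u\<in>P. a j (\<phi> u) = a j (\<psi> u))"
proof
  assume "push (a j) P \<phi> = push (a j) P \<psi>"
  then show "\<forall>u\<in>P. a j (\<phi> u) = a j (\<psi> u)" using apush(2)[OF j \<phi>] apush(2)[OF j \<psi>] by metis
next
  assume *: "\<forall>u\<in>P. a j (\<phi> u) = a j (\<psi> u)"
  show "push (a j) P \<phi> = push (a j) P \<psi>"
    using fusion_category.Hom_ext[OF Gcat[OF j] apush(1)[OF j \<psi>]] apush(2)[OF j \<psi>] *
    by (intro push_eqI) auto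
qed

lemma Hom_eqI:
  assumes \<phi>: "\<phi> \<in> Hom F P Q" and \<psi>: "\<psi> \<in> Hom F P Q'"
    and eq: "\<And>j u. j \<in> J \<Longrightarrow> u \<in> P \<Longrightarrow> a j (\<phi> u) = a j (\<psi> u)"
  shows "\<phi> = \<psi>"
proof (rule extensionalityI)
  show "\<phi> \<in> extensional P" "\<psi> \<in> extensional P" using Hom_ext \<phi> \<psi> by auto
  fix u assume u: "u \<in> P"
  have "\<phi> u \<in> carrier (Grp F)" "\<psi> u \<in> carrier (Grp F)"
    using Hom_in[OF \<phi> u] Hom_in[OF \<psi> u] Hom_objs[OF \<phi>] Hom_objs[OF \<psi>] Obj_sub by auto
  then show "\<phi> u = \<psi> u" using asep eq[OF _ u] by blast
qed

text \<open>Surjectivity passes from the levels to the limit because the image of \<phi> is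
  closed.\<close>

lemma Iso_complete:
  assumes P: "P \<in> Obj F" and Q: "Q \<in> Obj F"
    and \<Phi>: "\<And>j. j \<in> J \<Longrightarrow> \<Phi> j \<in> Iso (G j) (a j ` P) (a j ` Q)"
    and compat: "\<And>i j u. \<lbrakk>i \<in> J; j \<in> J; r i j; u \<in> P\<rbrakk> \<Longrightarrow> f i j (\<Phi> j (a j u)) = \<Phi> i (a i u)"
  shows "\<exists>\<phi>\<in>Iso F P Q. \<forall>j\<in>J. push (a j) P \<phi> = \<Phi> j"
proof -
  have \<Phi>H: "\<Phi> j \<in> Hom (G j) (a j ` P) (a j ` Q)" "\<Phi> j ` a j ` P = a j ` Q" if "j \<in> J" for j
    using \<Phi>[OF that] fusion_category.Iso_iff[OF Gcat[OF that]] by auto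
  obtain \<phi> where \<phi>: "\<phi> \<in> Hom F P Q" "\<forall>j\<in>J. \<forall>u\<in>P. a j (\<phi> u) = \<Phi> j (a j u)"
    using Hom_complete[of P Q \<Phi>, OF P Q \<Phi>H(1) compat] by blast
  have eq: "push (a j) P \<phi> = \<Phi> j" if j: "j \<in> J" for j
    using fusion_category.Hom_ext[OF Gcat[OF j] \<Phi>H(1)[OF j]] \<phi>(2) j by (intro push_eqI) auto
  have "Q \<subseteq> \<phi> ` P"
  proof
    fix y assume y: "y \<in> Q"
    show "y \<in> \<phi> ` P"
    proof (rule Obj_limit)
      show "\<phi> ` P \<in> Obj F" by (rule Hom_mapsto_Obj(1)[OF \<phi>(1)])
      show "y \<in> carrier (Grp F)" using y Obj_sub[OF Q] by blast
      show "a j y \<in> a j ` \<phi> ` P" if j: "j \<in> J" for j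
        using Hom_mapsto_Obj(2)[OF \<phi>(1) j] eq[OF j] \<Phi>H(2)[OF j] y by auto
    qed
  qed
  then have "\<phi> ` P = Q" using Hom_in[OF \<phi>(1)] by blast
  then have "\<phi> \<in> Iso F P Q" using \<phi>(1) by (simp add: Iso_iff)
  then show ?thesis using eq by blast
qed

lemma a_conj:
  "\<lbrakk>j \<in> J; x \<in> carrier (Grp F); u \<in> carrier (Grp F)\<rbrakk> \<Longrightarrow> a j (conj_by F x u) = conj_by (G j) (a j x) (a j u)"
  using conj_by_hom[OF grpF Ggrp ahom] by blast

lemma f_conj:
  "\<lbrakk>i \<in> J; j \<in> J; r i j; x \<in> carrier (Grp (G j)); u \<in> carrier (Grp (G j))\<rbrakk>
    \<Longrightarrow> f i j (conj_by (G j) x u) = conj_by (G i) (f i j x) (f i j u)"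
  using conj_by_hom[OF Ggrp Ggrp fhom] by blast

lemma a_normalizer:
  assumes j: "j \<in> J" and Q: "Q \<subseteq> carrier (Grp F)" and x: "x \<in> normalizer (Grp F) Q"
  shows "a j x \<in> normalizer (Grp (G j)) (a j ` Q)"
proof -
  interpret Gj: fusion_category "G j" by (rule Gcat[OF j])
  have x': "x \<in> carrier (Grp F)" "conj_by F x ` Q = Q" using x normalizer_iff[OF Q] by auto
  have "conj_by (G j) (a j x) ` a j ` Q = a j ` conj_by F x ` Q"
    using a_conj[OF j x'(1)] Q by (force simp: image_image subset_iff intro!: image_cong)
  moreover have "a j ` Q \<subseteq> carrier (Grp (G j))" using a_closed[OF j] Q by auto
  ultimately show ?thesis using Gj.normalizer_iff a_closed[OF j x'(1)] x'(2) by simp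
qed

lemma f_normalizer:
  assumes ij: "i \<in> J" "j \<in> J" "r i j" and Q: "Q \<subseteq> carrier (Grp (G j))" and x: "x \<in> normalizer (Grp (G j)) Q"
  shows "f i j x \<in> normalizer (Grp (G i)) (f i j ` Q)"
proof -
  interpret Gi: fusion_category "G i" by (rule Gcat[OF ij(1)])
  interpret Gj: fusion_category "G j" by (rule Gcat[OF ij(2)])
  have x': "x \<in> carrier (Grp (G j))" "conj_by (G j) x ` Q = Q" using x Gj.normalizer_iff[OF Q] by auto
  have "conj_by (G i) (f i j x) ` f i j ` Q = f i j ` conj_by (G j) x ` Q"
    using f_conj[OF ij x'(1)] Q by (force simp: image_image subset_iff intro!: image_cong)
  moreover have "f i j ` Q \<subseteq> carrier (Grp (G i))" using f_closed[OF ij] Q by auto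
  ultimately show ?thesis using Gi.normalizer_iff f_closed[OF ij x'(1)] x'(2) by simp
qed

text \<open>Since \<open>Q\<close> is closed, conjugation by \<open>x\<close> maps \<open>Q\<close>
  into itself if it does so at each level. The same holds for the inverse of \<open>x\<close>, whose
  images also lie in the level normalizers, and the two inclusions give equality.\<close>

lemma normalizer_limit:
  assumes Q: "Q \<in> Obj F" and x: "x \<in> carrier (Grp F)"
    and n: "\<And>j. j \<in> J \<Longrightarrow> a j x \<in> normalizer (Grp (G j)) (a j ` Q)"
  shows "x \<in> normalizer (Grp F) Q"
proof -
  have QS: "Q \<subseteq> carrier (Grp F)" using Q by (rule Obj_sub)
  have key: "conj_by F y ` Q \<subseteq> Q"
    if y: "y \<in> carrier (Grp F)" "\<And>j. j \<in> J \<Longrightarrow> a j y \<in> normalizer (Grp (G j)) (a j ` Q)" for y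
  proof (intro subsetI, elim imageE)
    fix v u assume u: "v = conj_by F y u" "u \<in> Q"
    have uc: "u \<in> carrier (Grp F)" using u QS by blast
    show "v \<in> Q"
    proof (rule Obj_limit[OF Q])
      show "v \<in> carrier (Grp F)" using conj_by_closed[OF y(1) uc] u by simp
      fix j assume j: "j \<in> J"
      interpret Gj: fusion_category "G j" by (rule Gcat[OF j])
      have "a j ` Q \<subseteq> carrier (Grp (G j))" using a_closed[OF j] QS by auto
      then have "conj_by (G j) (a j y) ` a j ` Q = a j ` Q" using y(2)[OF j] Gj.normalizer_iff by blast
      then show "a j v \<in> a j ` Q" using a_conj[OF j y(1) uc] u by auto
    qed
  qed
  have "a j (inv\<^bsub>Grp F\<^esub> x) \<in> normalizer (Grp (G j)) (a j ` Q)" if j: "j \<in> J" for j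
  proof -
    interpret h: group_hom "Grp F" "Grp (G j)" "a j" by (rule agrp[OF j])
    have "a j ` Q \<subseteq> carrier (Grp (G j))" using a_closed[OF j] QS by auto
    then have "subgroup (normalizer (Grp (G j)) (a j ` Q)) (Grp (G j))"
      by (rule h.H.normalizer_imp_subgroup)
    then show ?thesis using n[OF j] x subgroup.m_inv_closed by (metis h.hom_inv)
  qed
  then have "conj_by F (inv\<^bsub>Grp F\<^esub> x) ` Q \<subseteq> Q" using key[of "inv\<^bsub>Grp F\<^esub> x"] x by simp
  moreover have "conj_by F x ` Q \<subseteq> Q" by (rule key[OF x n])
  ultimately show ?thesis using normalizer_iff_inclusions[OF QS x] by blast
qed

lemma normalizer_Obj:
  assumes Q: "Q \<in> Obj F"
  shows "normalizer (Grp F) Q \<in> Obj F"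
  unfolding Obj_char
proof (intro conjI ballI impI)
  show "subgroup (normalizer (Grp F) Q) (Grp F)" by (rule normalizer_subgroup[OF Obj_sub[OF Q]])
  fix x assume x: "x \<in> carrier (Grp F)" "\<forall>j\<in>J. a j x \<in> a j ` normalizer (Grp F) Q"
  show "x \<in> normalizer (Grp F) Q"
    by (rule normalizer_limit[OF Q x(1)]) (use x(2) a_normalizer[OF _ Obj_sub[OF Q]] in fastforce)
qed

lemma apush_group_hom:
  assumes j: "j \<in> J" and Q: "Q \<in> Obj F"
  shows "group_hom (Aut_group F Q) (Aut_group (G j) (a j ` Q)) (push (a j) Q)"
proof -
  interpret Gj: fusion_category "G j" by (rule Gcat[OF j])
  have "push (a j) Q \<in> hom (Aut_group F Q) (Aut_group (G j) (a j ` Q))"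
  proof (rule homI)
    show "push (a j) Q \<phi> \<in> carrier (Aut_group (G j) (a j ` Q))" if "\<phi> \<in> carrier (Aut_group F Q)" for \<phi>
      using apush_Iso[OF j] that by (simp add: carrier_Aut Gj.carrier_Aut)
    fix \<phi> \<psi> assume "\<phi> \<in> carrier (Aut_group F Q)" "\<psi> \<in> carrier (Aut_group F Q)"
    then have h: "\<phi> \<in> Hom F Q Q" "\<psi> \<in> Hom F Q Q" by (auto simp: carrier_Aut Iso_iff)
    show "push (a j) Q (\<phi> \<otimes>\<^bsub>Aut_group F Q\<^esub> \<psi>) =
      push (a j) Q \<phi> \<otimes>\<^bsub>Aut_group (G j) (a j ` Q)\<^esub> push (a j) Q \<psi>"
      unfolding mult_Aut Gj.mult_Aut
      using apush(2)[OF j h(1)] apush(2)[OF j h(2)] Hom_in[OF h(2)]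
      by (intro push_eqI) (simp_all add: compose_def)
  qed
  then show ?thesis using group_Aut[OF Q] Gj.group_Aut[OF image_Obj[OF j Q]]
    by (simp add: group_hom_def group_hom_axioms_def)
qed

lemma fpush_group_hom:
  assumes ij: "i \<in> J" "j \<in> J" "r i j" and X: "X \<in> Obj (G j)"
  shows "group_hom (Aut_group (G j) X) (Aut_group (G i) (f i j ` X)) (push (f i j) X)"
proof -
  interpret Gi: fusion_category "G i" by (rule Gcat[OF ij(1)])
  interpret Gj: fusion_category "G j" by (rule Gcat[OF ij(2)])
  have "push (f i j) X \<in> hom (Aut_group (G j) X) (Aut_group (G i) (f i j ` X))"
  proof (rule homI)
    show "push (f i j) X \<phi> \<in> carrier (Aut_group (G i) (f i j ` X))" if "\<phi> \<in> carrier (Aut_group (G j) X)" for \<phi>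
      using fpush_Iso[OF ij] that by (simp add: Gi.carrier_Aut Gj.carrier_Aut)
    fix \<phi> \<psi> assume "\<phi> \<in> carrier (Aut_group (G j) X)" "\<psi> \<in> carrier (Aut_group (G j) X)"
    then have h: "\<phi> \<in> Hom (G j) X X" "\<psi> \<in> Hom (G j) X X" by (auto simp: Gj.carrier_Aut Gj.Iso_iff)
    show "push (f i j) X (\<phi> \<otimes>\<^bsub>Aut_group (G j) X\<^esub> \<psi>) =
      push (f i j) X \<phi> \<otimes>\<^bsub>Aut_group (G i) (f i j ` X)\<^esub> push (f i j) X \<psi>"
      unfolding Gi.mult_Aut Gj.mult_Aut
      using fpush(2)[OF ij h(1)] fpush(2)[OF ij h(2)] Gj.Hom_maps[OF h(2)]
      by (intro push_eqI) (simp_all add: compose_def)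
  qed
  then show ?thesis using Gj.group_Aut[OF X] Gi.group_Aut[OF f_image_Obj[OF ij X]]
    by (simp add: group_hom_def group_hom_axioms_def)
qed

lemma apush_conj:
  assumes j: "j \<in> J" and Q: "Q \<subseteq> carrier (Grp F)" and x: "x \<in> carrier (Grp F)"
  shows "push (a j) Q (\<lambda>u\<in>Q. conj_by F x u) = (\<lambda>v\<in>a j ` Q. conj_by (G j) (a j x) v)"
  using a_conj[OF j x] Q by (intro push_eqI) auto

lemma fpush_conj:
  assumes ij: "i \<in> J" "j \<in> J" "r i j" and X: "X \<subseteq> carrier (Grp (G j))" and x: "x \<in> carrier (Grp (G j))"
  shows "push (f i j) X (\<lambda>u\<in>X. conj_by (G j) x u) = (\<lambda>v\<in>f i j ` X. conj_by (G i) (f i j x) v)"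
  using f_conj[OF ij x] X by (intro push_eqI) auto

text \<open>Makes the levelwise Sylow criterion available for the automorphism group of
  \<open>Q\<close>. Completeness rests on \<open>Iso_complete\<close>; the open sets come from those
  of \<open>Hom F Q Q\<close> by restriction.\<close>

lemma Aut_profinite_levels:
  assumes Q: "Q \<in> Obj F"
  shows "profinite_levels (Aut_group F Q) (Aut_topology F Q) J r
    (\<lambda>j. Aut_group (G j) (a j ` Q)) (\<lambda>j. push (a j) Q)"
proof (intro profinite_levels.intro profinite_levels_axioms.intro)
  show "group (Aut_group F Q)" by (rule group_Aut[OF Q])
  show "directed_set J r" by (rule dir)
next
  fix j assume j: "j \<in> J"
  show "group (Aut_group (G j) (a j ` Q))" "push (a j) Q \<in> hom (Aut_group F Q) (Aut_group (G j) (a j ` Q))"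
    using apush_group_hom[OF j Q] by (auto simp: group_hom_def group_hom_axioms_def)
  have "push (a j) Q ` Iso F Q Q \<subseteq> Iso (G j) (a j ` Q) (a j ` Q)" using apush_Iso[OF j] by blast
  then show "finite (push (a j) Q ` carrier (Aut_group F Q))"
    using finite_Iso[OF j image_Obj[OF j Q]] by (simp add: carrier_Aut finite_subset)
next
  fix g h assume "g \<in> carrier (Aut_group F Q)" "h \<in> carrier (Aut_group F Q)"
    and eq: "\<And>j. j \<in> J \<Longrightarrow> push (a j) Q g = push (a j) Q h"
  then have gh: "g \<in> Hom F Q Q" "h \<in> Hom F Q Q" by (auto simp: carrier_Aut Iso_iff)
  show "g = h" by (rule Hom_eqI[OF gh]) (use apush_eq_iff[OF _ gh] eq in blast)
next
  fix i j g h assume ij: "i \<in> J" "j \<in> J" "r i j"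
    and "g \<in> carrier (Aut_group F Q)" "h \<in> carrier (Aut_group F Q)" and eq: "push (a j) Q g = push (a j) Q h"
  then have gh: "g \<in> Hom F Q Q" "h \<in> Hom F Q Q" by (auto simp: carrier_Aut Iso_iff)
  show "push (a i) Q g = push (a i) Q h"
    using push_apush[OF ij gh(1)] push_apush[OF ij gh(2)] eq by simp
next
  fix c assume "\<And>j. j \<in> J \<Longrightarrow> c j \<in> carrier (Aut_group F Q)"
    and eq: "\<And>i j. i \<in> J \<Longrightarrow> j \<in> J \<Longrightarrow> r i j \<Longrightarrow> push (a i) Q (c j) = push (a i) Q (c i)"
  then have c: "c j \<in> Iso F Q Q" "c j \<in> Hom F Q Q" if "j \<in> J" for j
    using that by (auto simp: carrier_Aut Iso_iff)
  have "f i j (push (a j) Q (c j) (a j u)) = push (a i) Q (c i) (a i u)"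
    if ij: "i \<in> J" "j \<in> J" "r i j" and u: "u \<in> Q" for i j u
  proof -
    have "c j u \<in> carrier (Grp F)" using Hom_in[OF c(2)[OF ij(2)] u] Obj_sub[OF Q] by blast
    then have "f i j (push (a j) Q (c j) (a j u)) = a i (c j u)"
      using apush(2)[OF ij(2) c(2)[OF ij(2)] u] acomp[OF ij] by simp
    also have "\<dots> = push (a i) Q (c j) (a i u)" using apush(2)[OF ij(1) c(2)[OF ij(2)] u] by simp
    finally show ?thesis using eq[OF ij] by simp
  qed
  from Iso_complete[of Q Q "\<lambda>j. push (a j) Q (c j)", OF Q Q apush_Iso[OF _ c(1)] this]
  show "\<exists>g\<in>carrier (Aut_group F Q). \<forall>j\<in>J. push (a j) Q g = push (a j) Q (c j)"
    by (auto simp: carrier_Aut)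
next
  fix U
  show "openin (Aut_topology F Q) U \<longleftrightarrow> U \<subseteq> carrier (Aut_group F Q) \<and>
    (\<forall>g\<in>U. \<exists>j\<in>J. \<forall>h\<in>carrier (Aut_group F Q). push (a j) Q h = push (a j) Q g \<longrightarrow> h \<in> U)" (is "_ \<longleftrightarrow> ?R")
  proof
    assume "openin (Aut_topology F Q) U"
    then obtain V where V: "openin (HomTop F Q Q) V" "U = V \<inter> Iso F Q Q"
      by (auto simp: Aut_topology_def openin_subtopology)
    have "\<exists>j\<in>J. \<forall>h\<in>Iso F Q Q. push (a j) Q h = push (a j) Q g \<longrightarrow> h \<in> U" if g: "g \<in> U" for g
    proof -
      have gV: "g \<in> V" "g \<in> Hom F Q Q" using g V(2) Iso_Hom by auto
      obtain j where j: "j \<in> J" "\<forall>\<psi>\<in>Hom F Q Q. (\<forall>u\<in>Q. a j (\<psi> u) = a j (g u)) \<longrightarrow> \<psi> \<in> V"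
        using V(1) gV(1) unfolding HomTop_char[OF Q Q] by blast
      have "h \<in> U" if h: "h \<in> Iso F Q Q" "push (a j) Q h = push (a j) Q g" for h
        using j(2) apush_eq_iff[OF j(1) Iso_Hom[OF h(1)] gV(2)] h Iso_Hom[OF h(1)] V(2) by blast
      then show ?thesis using j(1) by blast
    qed
    then show ?R using V(2) by (auto simp: carrier_Aut)
  next
    assume R: ?R
    then have UI: "U \<subseteq> Iso F Q Q" by (simp add: carrier_Aut)
    \<comment> \<open>An open set of endomorphisms whose automorphisms are exactly \<open>U\<close>:
      those that agree with some \<open>g\<close> in \<open>U\<close> at a level where agreement
      with \<open>g\<close> guarantees membership in \<open>U\<close>.\<close>
    define V where "V = {\<psi> \<in> Hom F Q Q. \<exists>g\<in>U. \<exists>j\<in>J. push (a j) Q \<psi> = push (a j) Q g \<and>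
      (\<forall>h\<in>Iso F Q Q. push (a j) Q h = push (a j) Q g \<longrightarrow> h \<in> U)}"
    have "openin (HomTop F Q Q) V"
      unfolding HomTop_char[OF Q Q]
    proof (intro conjI ballI)
      show "V \<subseteq> Hom F Q Q" by (auto simp: V_def)
      fix \<psi> assume \<psi>: "\<psi> \<in> V"
      then obtain g j where gj: "\<psi> \<in> Hom F Q Q" "g \<in> U" "j \<in> J" "push (a j) Q \<psi> = push (a j) Q g"
        "\<forall>h\<in>Iso F Q Q. push (a j) Q h = push (a j) Q g \<longrightarrow> h \<in> U" by (auto simp: V_def)
      have "\<psi>' \<in> V" if "\<psi>' \<in> Hom F Q Q" "\<forall>u\<in>Q. a j (\<psi>' u) = a j (\<psi> u)" for \<psi>'
      proof -
        have "push (a j) Q \<psi>' = push (a j) Q g" using apush_eq_iff[OF gj(3) that(1) gj(1)] that(2) gj(4) by simp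
        then show ?thesis using that(1) gj unfolding V_def by blast
      qed
      then show "\<exists>j\<in>J. \<forall>\<psi>'\<in>Hom F Q Q. (\<forall>u\<in>Q. a j (\<psi>' u) = a j (\<psi> u)) \<longrightarrow> \<psi>' \<in> V" using gj(3) by blast
    qed
    moreover have "U = V \<inter> Iso F Q Q"
    proof
      show "V \<inter> Iso F Q Q \<subseteq> U" by (auto simp: V_def)
      show "U \<subseteq> V \<inter> Iso F Q Q"
      proof
        fix g assume g: "g \<in> U"
        then have gI: "g \<in> Iso F Q Q" using UI by blast
        obtain j where "j \<in> J" "\<forall>h\<in>Iso F Q Q. push (a j) Q h = push (a j) Q g \<longrightarrow> h \<in> U"
          using R g by (auto simp: carrier_Aut)
        then have "g \<in> V" unfolding V_def using g Iso_Hom[OF gI] by blast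
        then show "g \<in> V \<inter> Iso F Q Q" using gI by blast
      qed
    qed
    ultimately show "openin (Aut_topology F Q) U" by (auto simp: Aut_topology_def openin_subtopology)
  qed
qed

text \<open>The elements that induce the given conjugation at the various levels form an inverse
  system of finite sets.\<close>

lemma Aut_S_limit:
  assumes Q: "Q \<in> Obj F" and g: "g \<in> Iso F Q Q"
    and lev: "\<And>j. j \<in> J \<Longrightarrow> push (a j) Q g \<in> push (a j) Q ` Aut_S F Q"
  shows "g \<in> Aut_S F Q"
proof -
  let ?N = "normalizer (Grp F) Q"
  have QS: "Q \<subseteq> carrier (Grp F)" using Q by (rule Obj_sub)
  have N: "?N \<in> Obj F" "?N \<subseteq> carrier (Grp F)" using normalizer_Obj[OF Q] Obj_sub by auto
  have gH: "g \<in> Hom F Q Q" using g by (rule Iso_Hom)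
  \<comment> \<open>The elements are taken from the image of the normalizer of \<open>Q\<close>, not
    from the normalizer of the image, so that the limit \<open>x\<close> lies in the closed subgroup
    \<open>?N\<close>.\<close>
  define X where "X = (\<lambda>j. {y \<in> a j ` ?N. \<forall>u\<in>Q. conj_by (G j) y (a j u) = a j (g u)})"
  have "\<exists>x. (\<forall>j\<in>J. x j \<in> X j) \<and> (\<forall>i\<in>J. \<forall>j\<in>J. r i j \<longrightarrow> f i j (x j) = x i)"
  proof (rule finite_inverse_limit_nonempty[OF dir, of X f])
    fix j assume j: "j \<in> J"
    have "a j ` ?N \<subseteq> carrier (Grp (G j))" using a_closed[OF j] N by auto
    then show "finite (X j)" unfolding X_def using Gfinite[OF j] by (simp add: finite_subset)
    obtain x where x: "x \<in> ?N" "push (a j) Q g = push (a j) Q (\<lambda>u\<in>Q. conj_by F x u)"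
      using lev[OF j] by (auto simp: Aut_S_def)
    have xc: "x \<in> carrier (Grp F)" using x N by blast
    have "conj_by (G j) (a j x) (a j u) = a j (g u)" if u: "u \<in> Q" for u
      using apush(2)[OF j gH u] x(2) apush_conj[OF j QS xc] u by simp
    then have "a j x \<in> X j" using x(1) by (simp add: X_def)
    then show "X j \<noteq> {}" by blast
  next
    fix i j y assume ij: "i \<in> J" "j \<in> J" "r i j" and y: "y \<in> X j"
    obtain x where x: "x \<in> ?N" "y = a j x" using y by (auto simp: X_def)
    have xc: "x \<in> carrier (Grp F)" using x N by blast
    have "conj_by (G i) (a i x) (a i u) = a i (g u)" if u: "u \<in> Q" for u
    proof -
      have c: "u \<in> carrier (Grp F)" "g u \<in> carrier (Grp F)" using u QS Hom_in[OF gH u] by auto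
      have "conj_by (G i) (a i x) (a i u) = f i j (conj_by (G j) (a j x) (a j u))"
        using f_conj[OF ij a_closed[OF ij(2) xc] a_closed[OF ij(2) c(1)]] acomp[OF ij] xc c by simp
      also have "conj_by (G j) (a j x) (a j u) = a j (g u)" using y x(2) u by (simp add: X_def)
      finally show ?thesis using acomp[OF ij c(2)] by simp
    qed
    then show "f i j y \<in> X i" using x acomp[OF ij xc] by (simp add: X_def)
  next
    fix i j k y assume ij: "i \<in> J" "j \<in> J" "k \<in> J" "r i j" "r j k" and y: "y \<in> X k"
    have "y \<in> carrier (Grp (G k))" using y N a_closed[OF ij(3)] by (auto simp: X_def)
    then show "f i j (f j k y) = f i k y" by (rule fcomp[OF ij])
  qed
  then obtain y where y: "\<And>j. j \<in> J \<Longrightarrow> y j \<in> X j" "\<And>i j. \<lbrakk>i \<in> J; j \<in> J; r i j\<rbrakk> \<Longrightarrow> f i j (y j) = y i"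
    by blast
  have yc: "y j \<in> carrier (Grp (G j))" if "j \<in> J" for j
    using y(1)[OF that] N a_closed[OF that] by (auto simp: X_def)
  obtain x where x: "x \<in> carrier (Grp F)" "\<forall>j\<in>J. a j x = y j" using acomplete[of y, OF yc y(2)] by blast
  have xN: "x \<in> ?N"
    by (rule Obj_limit[OF N(1) x(1)]) (use x(2) y(1) in \<open>auto simp: X_def\<close>)
  have "(\<lambda>u\<in>Q. conj_by F x u) = g"
  proof (rule Hom_eqI[OF Iso_Hom[OF conj_Iso[OF Q xN]] gH])
    fix j u assume j: "j \<in> J" and u: "u \<in> Q"
    have "a j (conj_by F x u) = conj_by (G j) (a j x) (a j u)" using a_conj[OF j x(1)] u QS by blast
    then show "a j ((\<lambda>u\<in>Q. conj_by F x u) u) = a j (g u)" using y(1)[OF j] x(2) j u by (simp add: X_def)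
  qed
  then show ?thesis using xN by (auto simp: Aut_S_def)
qed

end

section \<open>Cofinally stable choices of fully normalized subgroups\<close>

locale saturated_limit = fusion_limit p F J r G f a
  for p :: nat and F :: "'s fusion" and J :: "'j set" and r and G :: "'j \<Rightarrow> 'b fusion" and f a +
  assumes p: "prime p" and sat: "\<And>j. j \<in> J \<Longrightarrow> saturated p (G j)"

text \<open>
  Level by level, \<open>P\<close> is isomorphic to a fully normalized subgroup \<open>X m\<close> through \<open>\<theta> m\<close>. The
  images of \<open>\<theta> m\<close> and of the normalizer of \<open>X m\<close> at level \<open>j\<close> depend on \<open>m\<close>; \<open>\<Theta> j\<close> and
  \<open>M j\<close> are compatible values that occur for cofinally many \<open>m\<close>.
\<close>

locale stable_choice = saturated_limit p F J r G f a
  for p :: nat and F :: "'s fusion" and J :: "'j set" and r and G :: "'j \<Rightarrow> 'b fusion" and f a +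
  fixes P :: "'s set" and X :: "'j \<Rightarrow> 'b set" and \<theta> \<Theta> :: "'j \<Rightarrow> 'b \<Rightarrow> 'b" and M :: "'j \<Rightarrow> 'b set"
  assumes P: "P \<in> Obj F"
    and X: "\<And>m. m \<in> J \<Longrightarrow> X m \<in> Obj (G m)"
    and \<theta>: "\<And>m. m \<in> J \<Longrightarrow> \<theta> m \<in> Iso (G m) (a m ` P) (X m)"
    and full: "\<And>m. m \<in> J \<Longrightarrow> fully_normalized p (G m) (X m)"
    and cofinal: "\<And>j k. \<lbrakk>j \<in> J; k \<in> J\<rbrakk> \<Longrightarrow> \<exists>m\<in>J. r j m \<and> r k m \<and>
      push (f j m) (a m ` P) (\<theta> m) = \<Theta> j \<and> f j m ` normalizer (Grp (G m)) (X m) = M j"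
    and \<Theta>_compat: "\<And>i j. \<lbrakk>i \<in> J; j \<in> J; r i j\<rbrakk> \<Longrightarrow> push (f i j) (a j ` P) (\<Theta> j) = \<Theta> i"
    and M_compat: "\<And>i j. \<lbrakk>i \<in> J; j \<in> J; r i j\<rbrakk> \<Longrightarrow> f i j ` M j = M i"

text \<open>The map and the normalizer are recorded as one pair \<open>d j m\<close>, so that in
  \<open>cofinal\<close> one index \<open>m\<close> realizes both stable values.\<close>

lemma (in saturated_limit) stable_choice_exists:
  assumes P: "P \<in> Obj F"
  shows "\<exists>X \<theta> \<Theta> M. stable_choice p F J r G f a P X \<theta> \<Theta> M"
proof -
  have "\<exists>Q t. Q \<in> Obj (G m) \<and> t \<in> Iso (G m) (a m ` P) Q \<and> fully_normalized p (G m) Q" if m: "m \<in> J" for m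
    using sat[OF m] image_Obj[OF m P] by (fastforce simp: saturated_def)
  then obtain X \<theta> where X: "\<And>m. m \<in> J \<Longrightarrow> X m \<in> Obj (G m)"
    and \<theta>: "\<And>m. m \<in> J \<Longrightarrow> \<theta> m \<in> Iso (G m) (a m ` P) (X m)"
    and full: "\<And>m. m \<in> J \<Longrightarrow> fully_normalized p (G m) (X m)" by metis
  define d where "d = (\<lambda>j m. (push (f j m) (a m ` P) (\<theta> m), f j m ` normalizer (Grp (G m)) (X m)))"
  \<comment> \<open>The values that occur at level \<open>j\<close> beyond every index. The maps
    \<open>g i j\<close> send the value of \<open>m\<close> at level \<open>j\<close> to its value
    at level \<open>i\<close>, so they preserve this property.\<close>
  define Y where "Y = (\<lambda>j. {e. \<forall>k\<in>J. \<exists>m\<in>J. r j m \<and> r k m \<and> d j m = e})"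
  define D where "D = (\<lambda>j. (\<Pi>\<^sub>E v\<in>a j ` P. carrier (Grp (G j))) \<times> Pow (carrier (Grp (G j))))"
  define g where "g = (\<lambda>i j (t, N). (push (f i j) (a j ` P) t, f i j ` N))"
  have PS: "P \<subseteq> carrier (Grp F)" using P by (rule Obj_sub)
  have \<theta>H: "\<theta> m \<in> Hom (G m) (a m ` P) (X m)" if "m \<in> J" for m
    using fusion_category.Iso_Hom[OF Gcat[OF that] \<theta>[OF that]] .
  have NS: "normalizer (Grp (G m)) (X m) \<subseteq> carrier (Grp (G m))" if "m \<in> J" for m
    using fusion_category.normalizer_iff[OF Gcat[OF that] fusion_category.Obj_subset[OF Gcat[OF that] X[OF that]]]
    by blast
  have dD: "d j m \<in> D j" if jm: "j \<in> J" "m \<in> J" "r j m" for j m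
  proof -
    interpret Gj: fusion_category "G j" by (rule Gcat[OF jm(1)])
    have h: "push (f j m) (a m ` P) (\<theta> m) \<in> Hom (G j) (a j ` P) (f j m ` X m)"
      using fpush(1)[OF jm \<theta>H[OF jm(2)]] f_image_a[OF jm PS] by simp
    have "f j m ` X m \<subseteq> carrier (Grp (G j))" using Gj.Obj_subset Gj.Hom_obj[OF h] by blast
    then have "push (f j m) (a m ` P) (\<theta> m) \<in> (\<Pi>\<^sub>E v\<in>a j ` P. carrier (Grp (G j)))"
      using Gj.Hom_ext[OF h] Gj.Hom_maps[OF h] by (auto simp: PiE_iff)
    moreover have "f j m ` normalizer (Grp (G m)) (X m) \<subseteq> carrier (Grp (G j))"
      using NS[OF jm(2)] f_closed[OF jm] by auto
    ultimately show ?thesis by (simp add: d_def D_def)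
  qed
  have finD: "finite (D j)" if j: "j \<in> J" for j
  proof -
    have "finite (a j ` P)" using a_closed[OF j] PS Gfinite[OF j] by (meson finite_subset image_subset_iff subsetD)
    then show ?thesis unfolding D_def using Gfinite[OF j] by (simp add: finite_PiE)
  qed
  have gd: "g i j (d j m) = d i m" if ij: "i \<in> J" "j \<in> J" "m \<in> J" "r i j" "r j m" for i j m
  proof -
    have "f i j ` f j m ` normalizer (Grp (G m)) (X m) = f i m ` normalizer (Grp (G m)) (X m)"
      using fcomp[OF ij] NS[OF ij(3)] by (force simp: image_image subset_iff intro!: image_cong)
    then show ?thesis
      using push_push[OF ij \<theta>H[OF ij(3)]] f_image_a[OF ij(2,3,5) PS] by (simp add: g_def d_def)
  qed
  have YD: "Y j \<subseteq> D j" if j: "j \<in> J" for j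
  proof
    fix e assume "e \<in> Y j"
    then obtain m where "m \<in> J" "r j m" "d j m = e" using j unfolding Y_def by blast
    then show "e \<in> D j" using dD[OF j] by blast
  qed
  have "\<exists>x. (\<forall>j\<in>J. x j \<in> Y j) \<and> (\<forall>i\<in>J. \<forall>j\<in>J. r i j \<longrightarrow> g i j (x j) = x i)"
  proof (rule finite_inverse_limit_nonempty[OF dir, of Y g])
    fix j assume j: "j \<in> J"
    show "finite (Y j)" using YD[OF j] finD[OF j] by (rule finite_subset)
    show "Y j \<noteq> {}"
    proof
      \<comment> \<open>Then each value \<open>e\<close> is avoided by all \<open>m\<close> beyond
        some \<open>k e\<close>. For an \<open>m\<close> above \<open>j\<close> and above the
        finitely many \<open>k e\<close> with \<open>e\<close> in \<open>D j\<close>, no value in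
        \<open>D j\<close> would be left.\<close>
      assume "Y j = {}"
      have "\<exists>k. k \<in> J \<and> (\<forall>m\<in>J. r j m \<longrightarrow> r k m \<longrightarrow> d j m \<noteq> e)" for e
      proof -
        have "e \<notin> Y j" using \<open>Y j = {}\<close> by simp
        then show ?thesis by (simp add: Y_def) blast
      qed
      from choice[OF allI[OF this]]
      obtain k where k: "\<forall>e. k e \<in> J \<and> (\<forall>m\<in>J. r j m \<longrightarrow> r (k e) m \<longrightarrow> d j m \<noteq> e)" ..
      have "finite (insert j (k ` D j))" "insert j (k ` D j) \<subseteq> J" using finD[OF j] k j by auto
      from directed_set_finite_ub[OF dir this]
      obtain m where m: "m \<in> J" "\<forall>i\<in>insert j (k ` D j). r i m" by blast
      have "d j m \<in> D j" using dD[OF j m(1)] m(2) by simp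
      then show False using k m by blast
    qed
  next
    fix i j e assume ij: "i \<in> J" "j \<in> J" "r i j" and e: "e \<in> Y j"
    have "\<exists>m\<in>J. r i m \<and> r k m \<and> d i m = g i j e" if k: "k \<in> J" for k
    proof -
      obtain m where m: "m \<in> J" "r j m" "r k m" "d j m = e" using e k by (auto simp: Y_def)
      then show ?thesis using gd[OF ij(1,2) m(1) ij(3) m(2)] directed_set_trans[OF dir ij(1,2) m(1) ij(3) m(2)]
        by (intro bexI[of _ m]) auto
    qed
    then show "g i j e \<in> Y i" by (auto simp: Y_def)
  next
    fix i j k e assume ij: "i \<in> J" "j \<in> J" "k \<in> J" "r i j" "r j k" and e: "e \<in> Y k"
    obtain m where m: "m \<in> J" "r k m" "d k m = e" using e ij(3) by (auto simp: Y_def)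
    have rm: "r j m" "r i k" using directed_set_trans[OF dir] ij m by blast+
    \<comment> \<open>Functoriality is needed on attained values only: \<open>e\<close> is
      \<open>d k m\<close> for some \<open>m\<close>, and both sides equal
      \<open>d i m\<close>.\<close>
    show "g i j (g j k e) = g i k e"
      using gd[OF ij(2,3) m(1) ij(5) m(2)] gd[OF ij(1,2) m(1) ij(4) rm(1)] gd[OF ij(1,3) m(1) rm(2) m(2)] m(3)
      by simp
  qed
  then obtain x where x: "\<And>j. j \<in> J \<Longrightarrow> x j \<in> Y j" "\<And>i j. \<lbrakk>i \<in> J; j \<in> J; r i j\<rbrakk> \<Longrightarrow> g i j (x j) = x i"
    by blast
  have "stable_choice p F J r G f a P X \<theta> (\<lambda>j. fst (x j)) (\<lambda>j. snd (x j))"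
  proof (intro stable_choice.intro stable_choice_axioms.intro P X \<theta> full)
    show "saturated_limit p F J r G f a" by (rule saturated_limit_axioms)
    show "\<exists>m\<in>J. r j m \<and> r k m \<and> push (f j m) (a m ` P) (\<theta> m) = fst (x j) \<and>
        f j m ` normalizer (Grp (G m)) (X m) = snd (x j)" if jk: "j \<in> J" "k \<in> J" for j k
    proof -
      obtain m where "m \<in> J" "r j m" "r k m" "d j m = x j" using x(1)[OF jk(1)] jk(2) by (auto simp: Y_def)
      then show ?thesis by (intro bexI[of _ m]) (auto simp: d_def prod_eq_iff)
    qed
    fix i j assume ij: "i \<in> J" "j \<in> J" "r i j"
    have "g i j (fst (x j), snd (x j)) = x i" using x(2)[OF ij] by simp
    then have "x i = (push (f i j) (a j ` P) (fst (x j)), f i j ` snd (x j))" unfolding g_def prod.case by (rule sym)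
    then show "push (f i j) (a j ` P) (fst (x j)) = fst (x i)" "f i j ` snd (x j) = snd (x i)"
      by simp_all
  qed
  then show ?thesis by blast
qed

section \<open>The limit subgroup \<open>Q\<close> and the Sylow property of
  \<open>Aut_S F Q\<close>\<close>

context stable_choice
begin

abbreviation N where "N m \<equiv> normalizer (Grp (G m)) (X m)"

definition good :: "'j \<Rightarrow> 'j \<Rightarrow> bool" where
  "good j m \<longleftrightarrow> m \<in> J \<and> r j m \<and> push (f j m) (a m ` P) (\<theta> m) = \<Theta> j \<and> f j m ` N m = M j"

lemma good_cofinal: "\<lbrakk>j \<in> J; k \<in> J\<rbrakk> \<Longrightarrow> \<exists>m. good j m \<and> r k m"
  using cofinal unfolding good_def by blast

lemma goodD:
  assumes "good j m"
  shows "m \<in> J" "r j m" "push (f j m) (a m ` P) (\<theta> m) = \<Theta> j" "f j m ` N m = M j"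
  using assms by (auto simp: good_def)

lemma P_sub: "P \<subseteq> carrier (Grp F)"
  using P by (rule Obj_sub)

lemma X_sub: "m \<in> J \<Longrightarrow> X m \<subseteq> carrier (Grp (G m))"
  using fusion_category.Obj_subset[OF Gcat X] .

lemma N_sub: "m \<in> J \<Longrightarrow> N m \<subseteq> carrier (Grp (G m))"
  using fusion_category.normalizer_iff[OF Gcat X_sub] by blast

lemma M_sub:
  assumes "j \<in> J"
  shows "M j \<subseteq> carrier (Grp (G j))"
proof -
  obtain m where m: "good j m" using good_cofinal[OF assms assms] by blast
  note g = goodD[OF m]
  show ?thesis unfolding g(4)[symmetric] using N_sub[OF g(1)] f_closed[OF assms g(1,2)] by auto
qed

lemma \<theta>_Hom: "m \<in> J \<Longrightarrow> \<theta> m \<in> Hom (G m) (a m ` P) (X m)"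
  using fusion_category.Iso_Hom[OF Gcat \<theta>] .

lemma \<Theta>_good:
  assumes j: "j \<in> J" and m: "good j m"
  shows "\<Theta> j \<in> Iso (G j) (a j ` P) (f j m ` X m)"
    and "w \<in> a m ` P \<Longrightarrow> \<Theta> j (f j m w) = f j m (\<theta> m w)"
proof -
  note g = goodD[OF m]
  show "\<Theta> j \<in> Iso (G j) (a j ` P) (f j m ` X m)"
    using fpush_Iso[OF j g(1,2) \<theta>[OF g(1)]] f_image_a[OF j g(1,2) P_sub] g(3) by simp
  show "w \<in> a m ` P \<Longrightarrow> \<Theta> j (f j m w) = f j m (\<theta> m w)"
    using fpush(2)[OF j g(1,2) \<theta>_Hom[OF g(1)]] g(3) by simp
qed

lemma \<Theta>_Hom:
  assumes j: "j \<in> J"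
  shows "\<exists>Y. \<Theta> j \<in> Hom (G j) (a j ` P) Y"
proof -
  obtain m where "good j m" using good_cofinal[OF j j] by blast
  from \<Theta>_good(1)[OF j this] show ?thesis using fusion_category.Iso_Hom[OF Gcat[OF j]] by blast
qed

lemma \<Theta>_f:
  assumes ij: "i \<in> J" "j \<in> J" "r i j" and u: "u \<in> P"
  shows "f i j (\<Theta> j (a j u)) = \<Theta> i (a i u)"
proof -
  obtain Y where Y: "\<Theta> j \<in> Hom (G j) (a j ` P) Y" using \<Theta>_Hom[OF ij(2)] by blast
  have "f i j (\<Theta> j (a j u)) = push (f i j) (a j ` P) (\<Theta> j) (f i j (a j u))"
    using fpush(2)[OF ij Y, of "a j u"] u by simp
  then show ?thesis using \<Theta>_compat[OF ij] acomp[OF ij] u P_sub by auto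
qed

lemma limit_map_exists: "\<exists>t\<in>Hom F P (carrier (Grp F)). \<forall>j\<in>J. \<forall>u\<in>P. a j (t u) = \<Theta> j (a j u)"
proof (rule Hom_complete[OF P carrier_Obj])
  fix j assume j: "j \<in> J"
  interpret Gj: fusion_category "G j" by (rule Gcat[OF j])
  obtain Y where Y: "\<Theta> j \<in> Hom (G j) (a j ` P) Y" using \<Theta>_Hom[OF j] by blast
  \<comment> \<open>As \<open>a j\<close> need not be surjective, it has to be shown that the values
    of \<open>\<Theta> j\<close> come from the limit; together the values at all levels form a
    compatible family.\<close>
  have "\<Theta> j (a j u) \<in> a j ` carrier (Grp F)" if u: "u \<in> P" for u
  proof -
    have "\<exists>x\<in>carrier (Grp F). \<forall>i\<in>J. a i x = \<Theta> i (a i u)"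
    proof (rule acomplete)
      fix i assume i: "i \<in> J"
      obtain Y where Y: "\<Theta> i \<in> Hom (G i) (a i ` P) Y" using \<Theta>_Hom[OF i] by blast
      then show "\<Theta> i (a i u) \<in> carrier (Grp (G i))"
        using fusion_category.Hom_maps[OF Gcat[OF i] Y] fusion_category.Obj_subset[OF Gcat[OF i]]
          fusion_category.Hom_obj[OF Gcat[OF i] Y] u by blast
    qed (rule \<Theta>_f[OF _ _ _ u])
    then show ?thesis using j by (metis imageI)
  qed
  then show "\<Theta> j \<in> Hom (G j) (a j ` P) (a j ` carrier (Grp F))"
    using Gj.Hom_change[OF Y image_Obj[OF j carrier_Obj]] by blast
qed (rule \<Theta>_f)

definition limit_map :: "'s \<Rightarrow> 's" where
  "limit_map = (SOME t. t \<in> Hom F P (carrier (Grp F)) \<and> (\<forall>j\<in>J. \<forall>u\<in>P. a j (t u) = \<Theta> j (a j u)))"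

definition Q :: "'s set" where "Q = limit_map ` P"

lemma limit_map: "limit_map \<in> Hom F P (carrier (Grp F))" "\<lbrakk>j \<in> J; u \<in> P\<rbrakk> \<Longrightarrow> a j (limit_map u) = \<Theta> j (a j u)"
proof -
  have "\<exists>t. t \<in> Hom F P (carrier (Grp F)) \<and> (\<forall>j\<in>J. \<forall>u\<in>P. a j (t u) = \<Theta> j (a j u))"
    using limit_map_exists by blast
  from someI_ex[OF this, folded limit_map_def]
  show "limit_map \<in> Hom F P (carrier (Grp F))" "\<lbrakk>j \<in> J; u \<in> P\<rbrakk> \<Longrightarrow> a j (limit_map u) = \<Theta> j (a j u)" by auto
qed

lemma Q: "Q \<in> Obj F"
  unfolding Q_def by (rule Hom_image_obj[OF limit_map(1)])

lemma Q_sub: "Q \<subseteq> carrier (Grp F)"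
  using Q by (rule Obj_sub)

lemma limit_map_Iso: "limit_map \<in> Iso F P Q"
  unfolding Iso_iff using Hom_onto_image[OF limit_map(1)] by (simp add: Q_def)

lemma image_Q: "j \<in> J \<Longrightarrow> a j ` Q = \<Theta> j ` a j ` P"
  using limit_map(2) by (simp add: Q_def image_image)

lemma good_image_X:
  assumes j: "j \<in> J" and m: "good j m"
  shows "f j m ` X m = a j ` Q"
  using fusion_category.Iso_image[OF Gcat[OF j] \<Theta>_good(1)[OF j m]] image_Q[OF j] by simp

lemma \<Theta>_Iso: "j \<in> J \<Longrightarrow> \<Theta> j \<in> Iso (G j) (a j ` P) (a j ` Q)"
  using \<Theta>_good(1) good_image_X good_cofinal by metis

text \<open>Compares the image of \<open>Q\<close> at level \<open>m\<close>, reached from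
  \<open>P\<close> through the stable map, with the chosen subgroup \<open>X m\<close>. If
  \<open>m\<close> is good for \<open>j\<close>, then \<open>\<theta> m\<close> and
  \<open>\<Theta> m\<close> agree after projection to level \<open>j\<close>, so
  \<open>\<eta> m\<close> becomes the identity there; this is \<open>f_\<eta>\<close>.\<close>

definition \<eta> :: "'j \<Rightarrow> 'b \<Rightarrow> 'b" where
  "\<eta> m = compose (a m ` Q) (\<theta> m) (\<lambda>v\<in>a m ` Q. inv_into (a m ` P) (\<Theta> m) v)"

lemma \<eta>_Iso: "m \<in> J \<Longrightarrow> \<eta> m \<in> Iso (G m) (a m ` Q) (X m)"
  unfolding \<eta>_def
  using fusion_category.Iso_comp[OF Gcat fusion_category.Iso_inv[OF Gcat \<Theta>_Iso] \<theta>] by blast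

lemma f_\<eta>:
  assumes j: "j \<in> J" and m: "good j m" and v: "v \<in> a m ` Q"
  shows "f j m (\<eta> m v) = f j m v"
proof -
  note g = goodD[OF m]
  obtain u where u: "u \<in> P" "v = \<Theta> m (a m u)" using v image_Q[OF g(1)] by auto
  have "\<eta> m v = \<theta> m (a m u)"
    using fusion_category.Iso_inv_apply(1)[OF Gcat[OF g(1)] \<Theta>_Iso[OF g(1)], of "a m u"] u v
    by (simp add: \<eta>_def compose_def)
  moreover have "f j m (\<theta> m (a m u)) = \<Theta> j (a j u)"
    using \<Theta>_good(2)[OF j m, of "a m u"] u(1) acomp[OF j g(1,2)] P_sub by auto
  ultimately show ?thesis using \<Theta>_f[OF j g(1,2) u(1)] u(2) by simp
qed

text \<open>The maps between the sets \<open>M k\<close> are surjective by \<open>M_compat\<close>,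
  so \<open>y\<close> extends to a compatible family and comes from some \<open>z\<close>. Each
  \<open>M k\<close> is the image of the normalizer of some \<open>X m\<close> whose image is that
  of \<open>Q\<close>, so \<open>z\<close> normalizes \<open>Q\<close> at every level.\<close>

lemma M_lift:
  assumes j: "j \<in> J" and y: "y \<in> M j"
  shows "\<exists>x\<in>normalizer (Grp F) Q. a j x = y"
proof -
  have "\<exists>x. (\<forall>k\<in>J. x k \<in> M k) \<and> (\<forall>i\<in>J. \<forall>k\<in>J. r i k \<longrightarrow> f i k (x k) = x i) \<and> x j = y"
  proof (rule finite_inverse_limit_lift[OF dir _ _ _ j])
    show "finite (M k)" if "k \<in> J" for k using M_sub[OF that] Gfinite[OF that] by (rule finite_subset)
    show "f i k x \<in> M i" if "i \<in> J" "k \<in> J" "r i k" "x \<in> M k" for i k x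
      using M_compat[OF that(1-3)] that(4) by blast
    show "f i k (f k l x) = f i l x" if "i \<in> J" "k \<in> J" "l \<in> J" "r i k" "r k l" "x \<in> M l" for i k l x
      using fcomp[OF that(1-5)] M_sub[OF that(3)] that(6) by blast
    show "y \<in> f j k ` M k" if "k \<in> J" "r j k" for k using M_compat[OF j that] y by simp
  qed
  then obtain x where x: "\<And>k. k \<in> J \<Longrightarrow> x k \<in> M k" "\<And>i k. \<lbrakk>i \<in> J; k \<in> J; r i k\<rbrakk> \<Longrightarrow> f i k (x k) = x i" "x j = y"
    by blast
  obtain z where z: "z \<in> carrier (Grp F)" "\<forall>k\<in>J. a k z = x k"
    using acomplete[of x] x(1,2) M_sub by blast
  have "z \<in> normalizer (Grp F) Q"
  proof (rule normalizer_limit[OF Q z(1)])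
    fix k assume k: "k \<in> J"
    obtain m where m: "good k m" using good_cofinal[OF k k] by blast
    note g = goodD[OF m]
    obtain w where w: "w \<in> N m" "a k z = f k m w" using g(4) x(1)[OF k] z(2) k by auto
    show "a k z \<in> normalizer (Grp (G k)) (a k ` Q)"
      using f_normalizer[OF k g(1,2) X_sub[OF g(1)] w(1)] good_image_X[OF k m] w(2) by simp
  qed
  then show ?thesis using z(2) x(3) j by auto
qed

definition conj_level :: "'j \<Rightarrow> 'b \<Rightarrow> 'b \<Rightarrow> 'b" where
  "conj_level j y = (\<lambda>v\<in>a j ` Q. conj_by (G j) y v)"

lemma push_Aut_S: "j \<in> J \<Longrightarrow> push (a j) Q ` Aut_S F Q = conj_level j ` a j ` normalizer (Grp F) Q"
proof -
  assume j: "j \<in> J"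
  have "push (a j) Q (\<lambda>u\<in>Q. conj_by F x u) = conj_level j (a j x)" if "x \<in> normalizer (Grp F) Q" for x
    using apush_conj[OF j Q_sub] that normalizer_iff[OF Q_sub] by (simp add: conj_level_def)
  then show ?thesis by (simp add: Aut_S_def image_image)
qed

lemma push_Aut_S_X:
  assumes j: "j \<in> J" and m: "good j m"
  shows "push (f j m) (X m) ` Aut_S (G m) (X m) = conj_level j ` M j"
proof -
  note g = goodD[OF m]
  have "push (f j m) (X m) (\<lambda>u\<in>X m. conj_by (G m) z u) = conj_level j (f j m z)" if "z \<in> N m" for z
    using fpush_conj[OF j g(1,2) X_sub[OF g(1)]] that N_sub[OF g(1)] good_image_X[OF j m]
    by (auto simp: conj_level_def)
  then show ?thesis by (simp add: Aut_S_def image_image g(4)[symmetric])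
qed

text \<open>By compactness, an automorphism at level \<open>j\<close> that lifts to each later level
  lifts to an automorphism of \<open>Q\<close>. Each of the finitely many others fails to lift from
  some level on, and beyond a common bound only the liftable ones remain.\<close>

lemma Aut_image_stable:
  assumes j: "j \<in> J"
  shows "\<exists>k\<in>J. \<forall>m\<in>J. r j m \<longrightarrow> r k m \<longrightarrow>
    push (f j m) (a m ` Q) ` Iso (G m) (a m ` Q) (a m ` Q) = push (a j) Q ` Iso F Q Q"
proof -
  define E where "E = (\<lambda>m. push (f j m) (a m ` Q) ` Iso (G m) (a m ` Q) (a m ` Q))"
  have EI: "E m \<subseteq> Iso (G j) (a j ` Q) (a j ` Q)" if m: "m \<in> J" "r j m" for m
    using fpush_Iso[OF j m, of _ "a m ` Q" "a m ` Q"] f_image_a[OF j m Q_sub] by (auto simp: E_def)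
  have im: "push (f i m) (a m ` Q) \<beta> \<in> Iso (G i) (a i ` Q) (a i ` Q)"
    if "i \<in> J" "m \<in> J" "r i m" "\<beta> \<in> Iso (G m) (a m ` Q) (a m ` Q)" for i m \<beta>
    using fpush_Iso[OF that] f_image_a[OF that(1-3) Q_sub] by simp
  have pp: "push (f i k) (a k ` Q) (push (f k m) (a m ` Q) \<beta>) = push (f i m) (a m ` Q) \<beta>"
    if "i \<in> J" "k \<in> J" "m \<in> J" "r i k" "r k m" "\<beta> \<in> Iso (G m) (a m ` Q) (a m ` Q)" for i k m \<beta>
    using push_push[OF that(1-5) fusion_category.Iso_Hom[OF Gcat[OF that(3)] that(6)]]
      f_image_a[OF that(2,3,5) Q_sub] by simp
  have lift: "\<beta> \<in> push (a j) Q ` Iso F Q Q" if \<beta>: "\<And>k. \<lbrakk>k \<in> J; r j k\<rbrakk> \<Longrightarrow> \<beta> \<in> E k" for \<beta>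
  proof -
    have "\<exists>x. (\<forall>k\<in>J. x k \<in> Iso (G k) (a k ` Q) (a k ` Q)) \<and>
      (\<forall>i\<in>J. \<forall>k\<in>J. r i k \<longrightarrow> push (f i k) (a k ` Q) (x k) = x i) \<and> x j = \<beta>"
    proof (rule finite_inverse_limit_lift[OF dir _ _ _ j, of _ "\<lambda>i k. push (f i k) (a k ` Q)"])
      show "finite (Iso (G k) (a k ` Q) (a k ` Q))" if "k \<in> J" for k
        by (rule finite_Iso[OF that image_Obj[OF that Q]])
      show "\<beta> \<in> push (f j k) (a k ` Q) ` Iso (G k) (a k ` Q) (a k ` Q)" if "k \<in> J" "r j k" for k
        using \<beta>[OF that] by (simp add: E_def)
    qed (rule im pp; assumption)+
    then obtain x where x: "\<And>k. k \<in> J \<Longrightarrow> x k \<in> Iso (G k) (a k ` Q) (a k ` Q)"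
      "\<And>i k. \<lbrakk>i \<in> J; k \<in> J; r i k\<rbrakk> \<Longrightarrow> push (f i k) (a k ` Q) (x k) = x i" "x j = \<beta>" by blast
    have "f i k (x k (a k u)) = x i (a i u)" if ik: "i \<in> J" "k \<in> J" "r i k" and u: "u \<in> Q" for i k u
    proof -
      have "f i k (x k (a k u)) = push (f i k) (a k ` Q) (x k) (f i k (a k u))"
        using fpush(2)[OF ik fusion_category.Iso_Hom[OF Gcat[OF ik(2)] x(1)[OF ik(2)]], of "a k u"] u by simp
      then show ?thesis using x(2)[OF ik] acomp[OF ik] u Q_sub by auto
    qed
    from Iso_complete[of Q Q x, OF Q Q x(1) this] obtain \<phi> where
      "\<phi> \<in> Iso F Q Q" "\<forall>k\<in>J. push (a k) Q \<phi> = x k" by blast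
    then show ?thesis using x(3) j by (intro image_eqI[of _ _ \<phi>]) auto
  qed
  define B where "B = Iso (G j) (a j ` Q) (a j ` Q) - push (a j) Q ` Iso F Q Q"
  have "\<forall>\<beta>\<in>B. \<exists>k\<in>J. r j k \<and> \<beta> \<notin> E k" using lift by (auto simp: B_def)
  then obtain k where k: "\<And>\<beta>. \<beta> \<in> B \<Longrightarrow> k \<beta> \<in> J \<and> r j (k \<beta>) \<and> \<beta> \<notin> E (k \<beta>)" by metis
  have finB: "finite B" unfolding B_def by (rule finite_Diff[OF finite_Iso[OF j image_Obj[OF j Q]]])
  have "finite (insert j (k ` B))" "insert j (k ` B) \<subseteq> J" using finB k j by auto
  from directed_set_finite_ub[OF dir this]
  obtain l where l: "l \<in> J" "\<forall>i\<in>insert j (k ` B). r i l" by blast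
  have "E m = push (a j) Q ` Iso F Q Q" if m: "m \<in> J" "r j m" "r l m" for m
  proof
    show "E m \<subseteq> push (a j) Q ` Iso F Q Q"
    proof
      fix \<beta> assume \<beta>: "\<beta> \<in> E m"
      show "\<beta> \<in> push (a j) Q ` Iso F Q Q"
      proof (rule ccontr)
        assume "\<beta> \<notin> push (a j) Q ` Iso F Q Q"
        then have B: "\<beta> \<in> B" using \<beta> EI[OF m(1,2)] by (auto simp: B_def)
        note k = k[OF B]
        have km: "r (k \<beta>) m" using directed_set_trans[OF dir _ l(1) m(1) _ m(3)] k l(2) B by blast
        obtain \<gamma> where \<gamma>: "\<gamma> \<in> Iso (G m) (a m ` Q) (a m ` Q)" "\<beta> = push (f j m) (a m ` Q) \<gamma>"
          using \<beta> by (auto simp: E_def)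
        have "\<beta> = push (f j (k \<beta>)) (a (k \<beta>) ` Q) (push (f (k \<beta>) m) (a m ` Q) \<gamma>)"
          using pp[OF j _ m(1) _ km \<gamma>(1)] k \<gamma>(2) by simp
        then have "\<beta> \<in> E (k \<beta>)" using im[OF _ m(1) km \<gamma>(1)] k unfolding E_def by blast
        then show False using k by simp
      qed
    qed
    show "push (a j) Q ` Iso F Q Q \<subseteq> E m"
    proof
      fix \<beta> assume "\<beta> \<in> push (a j) Q ` Iso F Q Q"
      then obtain \<phi> where \<phi>: "\<phi> \<in> Iso F Q Q" "\<beta> = push (a j) Q \<phi>" by blast
      then have "\<beta> = push (f j m) (a m ` Q) (push (a m) Q \<phi>)"
        using push_apush[OF j m(1,2) Iso_Hom[OF \<phi>(1)]] by simp
      then show "\<beta> \<in> E m" using apush_Iso[OF m(1) \<phi>(1)] unfolding E_def by blast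
    qed
  qed
  then show ?thesis using l(1) unfolding E_def by blast
qed

text \<open>Conjugation by \<open>h\<close> maps the automorphisms of \<open>Y\<close> to those of
  \<open>Z\<close> and is invisible at level \<open>j\<close>, because \<open>h\<close> is trivial
  there. Applied to an \<open>\<eta> m\<close> and to its inverse, the inclusion becomes an
  equality.\<close>

lemma push_conjugate_Iso:
  assumes j: "j \<in> J" and m: "m \<in> J" "r j m" and h: "h \<in> Iso (G m) Y Z"
    and fh: "\<And>w. w \<in> Y \<Longrightarrow> f j m (h w) = f j m w"
  shows "push (f j m) Y ` Iso (G m) Y Y \<subseteq> push (f j m) Z ` Iso (G m) Z Z"
proof
  interpret Gm: fusion_category "G m" by (rule Gcat[OF m(1)])
  interpret Gj: fusion_category "G j" by (rule Gcat[OF j])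
  fix \<beta> assume "\<beta> \<in> push (f j m) Y ` Iso (G m) Y Y"
  then obtain \<phi> where \<phi>: "\<phi> \<in> Iso (G m) Y Y" "\<beta> = push (f j m) Y \<phi>" by blast
  let ?i = "\<lambda>v\<in>Z. inv_into Y h v"
  define \<psi> where "\<psi> = compose Z h (compose Z \<phi> ?i)"
  have \<psi>: "\<psi> \<in> Iso (G m) Z Z"
    unfolding \<psi>_def by (rule Gm.Iso_comp[OF Gm.Iso_comp[OF Gm.Iso_inv[OF h] \<phi>(1)] h])
  note h' = Gm.Iso_Hom[OF h] and \<phi>' = Gm.Iso_Hom[OF \<phi>(1)]
  have YZ: "f j m ` Z = f j m ` Y" using fh Gm.Iso_image[OF h] by (auto simp: image_image)
  have "push (f j m) Z \<psi> = push (f j m) Y \<phi>"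
  proof (rule push_eqI)
    show "push (f j m) Y \<phi> \<in> extensional (f j m ` Z)"
      unfolding YZ using Gj.Hom_ext[OF fpush(1)[OF j m \<phi>']] .
    fix v assume "v \<in> Z"
    then obtain w where w: "w \<in> Y" "v = h w" using Gm.Iso_image[OF h] by blast
    have "\<psi> v = h (\<phi> w)"
      using w Gm.Iso_inv_apply(1)[OF h w(1)] Gm.Hom_maps[OF h' w(1)] by (simp add: \<psi>_def compose_def)
    then show "push (f j m) Y \<phi> (f j m v) = f j m (\<psi> v)"
      using fh[OF w(1)] fh[OF Gm.Hom_maps[OF \<phi>' w(1)]] fpush(2)[OF j m \<phi>' w(1)] w(2) by simp
  qed
  then show "\<beta> \<in> push (f j m) Z ` Iso (G m) Z Z" using \<psi> \<phi>(2) by (metis imageI)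
qed

text \<open>For \<open>m\<close> beyond the bound of \<open>Aut_image_stable\<close> and good for
  \<open>j\<close>, the automorphisms of \<open>X m\<close> and of \<open>Q\<close> have the same
  image at level \<open>j\<close>. The conjugations by \<open>M j\<close> are the image of the Sylow
  subgroup \<open>Aut_S (G m) (X m)\<close>.\<close>

lemma sylow_M:
  assumes j: "j \<in> J"
  shows "sylow_card p (card (conj_level j ` M j)) (card (push (a j) Q ` Iso F Q Q))"
proof -
  obtain k where k: "k \<in> J" "\<forall>m\<in>J. r j m \<longrightarrow> r k m \<longrightarrow>
    push (f j m) (a m ` Q) ` Iso (G m) (a m ` Q) (a m ` Q) = push (a j) Q ` Iso F Q Q"
    using Aut_image_stable[OF j] by blast
  obtain m where m: "good j m" "r k m" using good_cofinal[OF j k(1)] by blast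
  note g = goodD[OF m(1)]
  interpret Gm: fusion_category "G m" by (rule Gcat[OF g(1)])
  interpret h: group_hom "Aut_group (G m) (X m)" "Aut_group (G j) (f j m ` X m)" "push (f j m) (X m)"
    by (rule fpush_group_hom[OF j g(1,2) X[OF g(1)]])
  let ?i = "\<lambda>v\<in>X m. inv_into (a m ` Q) (\<eta> m) v"
  have "f j m (?i v) = f j m v" if v: "v \<in> X m" for v
    using f_\<eta>[OF j m(1), of "?i v"] Gm.Iso_inv_apply(2,3)[OF \<eta>_Iso[OF g(1)] v] v by simp
  then have "push (f j m) (X m) ` Iso (G m) (X m) (X m) = push (f j m) (a m ` Q) ` Iso (G m) (a m ` Q) (a m ` Q)"
    using push_conjugate_Iso[OF j g(1,2) \<eta>_Iso[OF g(1)] f_\<eta>[OF j m(1)]]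
      push_conjugate_Iso[OF j g(1,2) Gm.Iso_inv[OF \<eta>_Iso[OF g(1)]]] by blast
  then have "push (f j m) (X m) ` Iso (G m) (X m) (X m) = push (a j) Q ` Iso F Q Q" using k(2) g(1,2) m(2) by simp
  moreover have "sylow_card p (card (push (f j m) (X m) ` Aut_S (G m) (X m)))
      (card (push (f j m) (X m) ` carrier (Aut_group (G m) (X m))))"
    using h.sylow_card_image[OF p _ Gm.Aut_S_subgroup[OF X[OF g(1)]]]
      finite_Iso[OF g(1) X[OF g(1)]] Aut_S_sylow[OF g(1) X[OF g(1)] full[OF g(1)]]
    by (simp add: Gm.carrier_Aut)
  ultimately show ?thesis using push_Aut_S_X[OF j m(1)] by (simp add: Gm.carrier_Aut)
qed

lemma card_p_subgroup:
  assumes j: "j \<in> J" and H: "subgroup H (Grp (G j))"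
  shows "\<exists>l. card H = p ^ l"
proof -
  interpret Gj: fusion_category "G j" by (rule Gcat[OF j])
  obtain n where "Coset.order (Grp (G j)) = p ^ n" using fin[OF j] by (auto simp: finite_fusion_system_def)
  then have "card H dvd p ^ n"
    using Gj.S.card_subgroup_dvd[OF H Gj.S.subgroup_self subgroup.subset[OF H]] by (simp add: Coset.order_def)
  then show ?thesis using divides_primepow_nat[OF p] by blast
qed

text \<open>One inclusion is the lifting property of \<open>M j\<close>. Conversely, the image of
  \<open>Aut_S F Q\<close> is a \<open>p\<close>-group inside the image of the automorphism group,
  where the conjugations by \<open>M j\<close> already form a Sylow subgroup, so it cannot be
  larger.\<close>

lemma push_Aut_S_eq:
  assumes j: "j \<in> J"
  shows "push (a j) Q ` Aut_S F Q = conj_level j ` M j"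
proof -
  interpret Gj: fusion_category "G j" by (rule Gcat[OF j])
  interpret h: group_hom "Aut_group F Q" "Aut_group (G j) (a j ` Q)" "push (a j) Q"
    by (rule apush_group_hom[OF j Q])
  interpret c: group_hom "(Grp F)\<lparr>carrier := normalizer (Grp F) Q\<rparr>" "Aut_group F Q"
    "\<lambda>x. \<lambda>u\<in>Q. conj_by F x u" by (rule conj_group_hom[OF Q])
  interpret aj: group_hom "Grp F" "Grp (G j)" "a j" by (rule agrp[OF j])
  let ?N = "normalizer (Grp F) Q"
  have N: "subgroup ?N (Grp F)" by (rule normalizer_subgroup[OF Q_sub])
  have sub: "conj_level j ` M j \<subseteq> push (a j) Q ` Aut_S F Q"
    unfolding push_Aut_S[OF j] using M_lift[OF j] by blast
  have A: "subgroup (Aut_S F Q) (Aut_group F Q)" by (rule Aut_S_subgroup[OF Q])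
  have fin: "finite (push (a j) Q ` Aut_S F Q)"
  proof (rule finite_subset)
    show "push (a j) Q ` Aut_S F Q \<subseteq> Iso (G j) (a j ` Q) (a j ` Q)"
      using subgroup.subset[OF A] apush_Iso[OF j] by (auto simp: carrier_Aut)
    show "finite (Iso (G j) (a j ` Q) (a j ` Q))" by (rule finite_Iso[OF j image_Obj[OF j Q]])
  qed
  obtain k m where km: "card (conj_level j ` M j) = p ^ k" "card (push (a j) Q ` Iso F Q Q) = p ^ k * m" "\<not> p dvd m"
    using sylow_M[OF j] by (auto simp: sylow_card_def)
  have aQ: "a j ` Q \<subseteq> carrier (Grp (G j))" using Gj.Obj_subset[OF image_Obj[OF j Q]] .
  \<comment> \<open>These maps are conjugations by the image of the normalizer of \<open>Q\<close>,
    which is a subgroup of the finite \<open>p\<close>-group at level \<open>j\<close>.\<close>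
  have "\<exists>l. card (push (a j) Q ` Aut_S F Q) = p ^ l"
  proof -
    interpret cc: group_hom "(Grp (G j))\<lparr>carrier := normalizer (Grp (G j)) (a j ` Q)\<rparr>"
      "Aut_group (G j) (a j ` Q)" "\<lambda>x. \<lambda>v\<in>a j ` Q. conj_by (G j) x v"
      by (rule Gj.conj_group_hom[OF image_Obj[OF j Q]])
    have aN: "subgroup (a j ` ?N) (Grp (G j))" by (rule aj.subgroup_img_is_subgroup[OF N])
    have "subgroup (a j ` ?N) ((Grp (G j))\<lparr>carrier := normalizer (Grp (G j)) (a j ` Q)\<rparr>)"
      by (rule Gj.S.subgroup_incl[OF aN Gj.normalizer_subgroup[OF aQ]])
        (use a_normalizer[OF j Q_sub] in blast)
    moreover have "finite (a j ` ?N)"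
      using subgroup.subset[OF aN] Gfinite[OF j] by (rule finite_subset)
    ultimately have "card ((\<lambda>x. \<lambda>v\<in>a j ` Q. conj_by (G j) x v) ` a j ` ?N) dvd card (a j ` ?N)"
      by (rule dvdI[OF cc.card_hom_image[symmetric]])
    moreover have "(\<lambda>x. \<lambda>v\<in>a j ` Q. conj_by (G j) x v) ` a j ` ?N = push (a j) Q ` Aut_S F Q"
      unfolding push_Aut_S[OF j] by (simp add: conj_level_def)
    moreover obtain l where "card (a j ` ?N) = p ^ l" using card_p_subgroup[OF j aN] by blast
    ultimately show ?thesis using divides_primepow_nat[OF p] by auto
  qed
  then obtain l where l: "card (push (a j) Q ` Aut_S F Q) = p ^ l" by blast
  have "card (push (a j) Q ` Aut_S F Q) dvd card (push (a j) Q ` Iso F Q Q)"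
    using h.H.card_subgroup_dvd[OF h.subgroup_img_is_subgroup[OF A] h.subgroup_img_is_subgroup[OF h.G.subgroup_self]]
      subgroup.subset[OF A] by (simp add: carrier_Aut image_mono)
  then have "p ^ l dvd p ^ k * m" using l km(2) by simp
  \<comment> \<open>The cofactor contributes no factor \<open>p\<close>, so \<open>p ^ l\<close> is
    bounded by the Sylow order \<open>p ^ k\<close>.\<close>
  moreover have "coprime (p ^ l) m"
    using prime_imp_coprime[OF p km(3)] by (rule coprime_power_left_iff[THEN iffD2, OF disjI1])
  ultimately have "p ^ l dvd p ^ k" using coprime_dvd_mult_left_iff by blast
  moreover have "0 < p ^ k" using prime_gt_0_nat[OF p] by simp
  ultimately have "p ^ l \<le> p ^ k" by (rule dvd_imp_le)
  then show ?thesis using card_seteq[OF fin sub] l km(1) by simp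
qed

lemma Aut_S_sylow_pro_p: "sylow_pro_p p (Aut_group F Q) (Aut_topology F Q) (Aut_S F Q)"
proof -
  interpret A: profinite_levels "Aut_group F Q" "Aut_topology F Q" J r
    "\<lambda>j. Aut_group (G j) (a j ` Q)" "\<lambda>j. push (a j) Q" by (rule Aut_profinite_levels[OF Q])
  show ?thesis
  proof (rule A.sylow_pro_p_levels[OF p Aut_S_subgroup[OF Q]])
    show "g \<in> Aut_S F Q" if "g \<in> carrier (Aut_group F Q)"
      "\<And>j. j \<in> J \<Longrightarrow> push (a j) Q g \<in> push (a j) Q ` Aut_S F Q" for g
      using Aut_S_limit[OF Q, of g] that by (simp add: carrier_Aut)
    show "sylow_card p (card (push (a j) Q ` Aut_S F Q)) (card (push (a j) Q ` carrier (Aut_group F Q)))"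
      if "j \<in> J" for j
      using sylow_M[OF that] push_Aut_S_eq[OF that] by (simp add: carrier_Aut)
  qed
qed

end

section \<open>Receptivity\<close>

context fusion_category
begin

text \<open>The automorphism of \<open>Q\<close> that corresponds under \<phi> to conjugation by
  \<open>x\<close> on \<open>R\<close>. As a function of \<open>x\<close> it is a homomorphism on
  the normalizer of \<open>R\<close>, and \<open>N_phi\<close> is the preimage of
  \<open>Aut_S F Q\<close> under it, hence a subgroup.\<close>

definition transport :: "'a set \<Rightarrow> 'a set \<Rightarrow> ('a \<Rightarrow> 'a) \<Rightarrow> 'a \<Rightarrow> 'a \<Rightarrow> 'a" where
  "transport R Q \<phi> x = compose Q \<phi> (compose Q (\<lambda>u\<in>R. conj_by F x u) (\<lambda>v\<in>Q. inv_into R \<phi> v))"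

lemma transport_apply:
  assumes "\<phi> \<in> Iso F R Q" "u \<in> R"
  shows "transport R Q \<phi> x (\<phi> u) = \<phi> (conj_by F x u)"
  using assms Iso_inv_apply(1)[OF assms] Hom_maps[OF Iso_Hom[OF assms(1)] assms(2)]
  by (simp add: transport_def compose_def)

lemma Iso_obj: "\<phi> \<in> Iso F R Q \<Longrightarrow> R \<in> Obj F \<and> Q \<in> Obj F"
  using Hom_obj Iso_Hom by blast

lemma transport_Iso:
  assumes \<phi>: "\<phi> \<in> Iso F R Q" and x: "x \<in> normalizer (Grp F) R"
  shows "transport R Q \<phi> x \<in> Iso F Q Q"
  unfolding transport_def
  using Iso_comp[OF Iso_comp[OF Iso_inv[OF \<phi>] conj_Iso[OF _ x]] \<phi>] Iso_obj[OF \<phi>] by blast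

lemma eq_on_Iso_image:
  assumes \<phi>: "\<phi> \<in> Iso F R Q" and "\<alpha> \<in> extensional Q" "\<beta> \<in> extensional Q"
    and "\<And>u. u \<in> R \<Longrightarrow> \<alpha> (\<phi> u) = \<beta> (\<phi> u)"
  shows "\<alpha> = \<beta>"
  using assms(2,3) by (rule extensionalityI) (use assms(4) Iso_image[OF \<phi>] in blast)

lemma transport_group_hom:
  assumes \<phi>: "\<phi> \<in> Iso F R Q"
  shows "group_hom ((Grp F)\<lparr>carrier := normalizer (Grp F) R\<rparr>) (Aut_group F Q) (transport R Q \<phi>)"
proof -
  have R: "R \<in> Obj F" and Q: "Q \<in> Obj F" using Iso_obj[OF \<phi>] by auto
  have RS: "R \<subseteq> carrier (Grp F)" using R by (rule Obj_subset)
  have N: "subgroup (normalizer (Grp F) R) (Grp F)" by (rule normalizer_subgroup[OF RS])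
  have "transport R Q \<phi> \<in> hom ((Grp F)\<lparr>carrier := normalizer (Grp F) R\<rparr>) (Aut_group F Q)"
  proof (rule homI)
    show "transport R Q \<phi> x \<in> carrier (Aut_group F Q)"
      if "x \<in> carrier ((Grp F)\<lparr>carrier := normalizer (Grp F) R\<rparr>)" for x
      using transport_Iso[OF \<phi>] that by (simp add: carrier_Aut)
    fix x y assume "x \<in> carrier ((Grp F)\<lparr>carrier := normalizer (Grp F) R\<rparr>)"
      "y \<in> carrier ((Grp F)\<lparr>carrier := normalizer (Grp F) R\<rparr>)"
    then have xy: "x \<in> normalizer (Grp F) R" "y \<in> normalizer (Grp F) R" by auto
    have c: "x \<in> carrier (Grp F)" "y \<in> carrier (Grp F)" "conj_by F y ` R = R"
      using xy normalizer_iff[OF RS] by auto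
    have "transport R Q \<phi> (x \<otimes>\<^bsub>Grp F\<^esub> y) = compose Q (transport R Q \<phi> x) (transport R Q \<phi> y)"
    proof (rule eq_on_Iso_image[OF \<phi>])
      show "transport R Q \<phi> (x \<otimes>\<^bsub>Grp F\<^esub> y) \<in> extensional Q" by (simp add: transport_def)
      show "compose Q (transport R Q \<phi> x) (transport R Q \<phi> y) \<in> extensional Q" by simp
      fix u assume u: "u \<in> R"
      have yu: "conj_by F y u \<in> R" using c(3) u by blast
      have "transport R Q \<phi> (x \<otimes>\<^bsub>Grp F\<^esub> y) (\<phi> u) = \<phi> (conj_by F x (conj_by F y u))"
        using transport_apply[OF \<phi> u] conj_by_mult[OF c(1,2)] u RS by auto
      then show "transport R Q \<phi> (x \<otimes>\<^bsub>Grp F\<^esub> y) (\<phi> u) =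
        compose Q (transport R Q \<phi> x) (transport R Q \<phi> y) (\<phi> u)"
        using transport_apply[OF \<phi> u, of y] transport_apply[OF \<phi> yu, of x] Hom_maps[OF Iso_Hom[OF \<phi>] u]
        by (simp add: compose_def)
    qed
    then show "transport R Q \<phi> (x \<otimes>\<^bsub>(Grp F)\<lparr>carrier := normalizer (Grp F) R\<rparr>\<^esub> y) =
      transport R Q \<phi> x \<otimes>\<^bsub>Aut_group F Q\<^esub> transport R Q \<phi> y" by (simp add: mult_Aut)
  qed
  then show ?thesis using S.subgroup_imp_group[OF N] group_Aut[OF Q]
    by (simp add: group_hom_def group_hom_axioms_def)
qed

lemma N_phi_iff:
  assumes \<phi>: "\<phi> \<in> Iso F R Q"
  shows "x \<in> N_phi F R Q \<phi> \<longleftrightarrow> x \<in> normalizer (Grp F) R \<and> transport R Q \<phi> x \<in> Aut_S F Q"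
proof -
  have "(\<forall>u\<in>R. \<phi> (conj_by F x u) = conj_by F y (\<phi> u)) \<longleftrightarrow> transport R Q \<phi> x = (\<lambda>v\<in>Q. conj_by F y v)" for y
  proof
    assume *: "\<forall>u\<in>R. \<phi> (conj_by F x u) = conj_by F y (\<phi> u)"
    show "transport R Q \<phi> x = (\<lambda>v\<in>Q. conj_by F y v)"
    proof (rule eq_on_Iso_image[OF \<phi>])
      show "transport R Q \<phi> x \<in> extensional Q" by (simp add: transport_def)
      show "transport R Q \<phi> x (\<phi> u) = (\<lambda>v\<in>Q. conj_by F y v) (\<phi> u)" if "u \<in> R" for u
        using * that transport_apply[OF \<phi> that] Hom_maps[OF Iso_Hom[OF \<phi>] that] by simp
    qed simp
  next
    assume *: "transport R Q \<phi> x = (\<lambda>v\<in>Q. conj_by F y v)"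
    show "\<forall>u\<in>R. \<phi> (conj_by F x u) = conj_by F y (\<phi> u)"
      using * transport_apply[OF \<phi>, of _ x] Hom_maps[OF Iso_Hom[OF \<phi>]] by simp
  qed
  then show ?thesis by (auto simp: N_phi_def Aut_S_def)
qed

lemma N_phi_subgroup:
  assumes \<phi>: "\<phi> \<in> Iso F R Q"
  shows "subgroup (N_phi F R Q \<phi>) (Grp F)"
proof -
  have R: "R \<in> Obj F" and Q: "Q \<in> Obj F" using Iso_obj[OF \<phi>] by auto
  have N: "subgroup (normalizer (Grp F) R) (Grp F)" by (rule normalizer_subgroup[OF Obj_subset[OF R]])
  interpret t: group_hom "(Grp F)\<lparr>carrier := normalizer (Grp F) R\<rparr>" "Aut_group F Q" "transport R Q \<phi>"
    by (rule transport_group_hom[OF \<phi>])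
  have A: "subgroup (Aut_S F Q) (Aut_group F Q)" by (rule Aut_S_subgroup[OF Q])
  note iff = N_phi_iff[OF \<phi>]
  show ?thesis
  proof (rule S.subgroupI)
    show "N_phi F R Q \<phi> \<subseteq> carrier (Grp F)" using subgroup.subset[OF N] iff by blast
    have "\<one>\<^bsub>Grp F\<^esub> \<in> N_phi F R Q \<phi>"
      using iff subgroup.one_closed[OF N] t.hom_one subgroup.one_closed[OF A] by simp
    then show "N_phi F R Q \<phi> \<noteq> {}" by blast
    show "inv\<^bsub>Grp F\<^esub> x \<in> N_phi F R Q \<phi>" if x: "x \<in> N_phi F R Q \<phi>" for x
    proof -
      have x': "x \<in> normalizer (Grp F) R" "transport R Q \<phi> x \<in> Aut_S F Q" using x iff by auto
      have "transport R Q \<phi> (inv\<^bsub>Grp F\<^esub> x) = inv\<^bsub>Aut_group F Q\<^esub> transport R Q \<phi> x"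
        using t.hom_inv[of x] S.m_inv_consistent[OF N x'(1)] x'(1) by simp
      then show ?thesis
        using iff subgroup.m_inv_closed[OF N x'(1)] subgroup.m_inv_closed[OF A x'(2)] by simp
    qed
    show "x \<otimes>\<^bsub>Grp F\<^esub> y \<in> N_phi F R Q \<phi>" if x: "x \<in> N_phi F R Q \<phi>" and y: "y \<in> N_phi F R Q \<phi>" for x y
    proof -
      have xy: "x \<in> normalizer (Grp F) R" "transport R Q \<phi> x \<in> Aut_S F Q"
        "y \<in> normalizer (Grp F) R" "transport R Q \<phi> y \<in> Aut_S F Q" using x y iff by auto
      have "transport R Q \<phi> (x \<otimes>\<^bsub>Grp F\<^esub> y) = transport R Q \<phi> x \<otimes>\<^bsub>Aut_group F Q\<^esub> transport R Q \<phi> y"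
        using t.hom_mult[of x y] xy by simp
      then show ?thesis using iff subgroup.m_closed[OF N xy(1,3)] subgroup.m_closed[OF A xy(2,4)] by simp
    qed
  qed
qed

lemma subset_N_phi:
  assumes \<phi>: "\<phi> \<in> Iso F R Q"
  shows "R \<subseteq> N_phi F R Q \<phi>"
proof
  fix x assume x: "x \<in> R"
  have R: "R \<in> Obj F" and Q: "Q \<in> Obj F" using Iso_obj[OF \<phi>] by auto
  \<comment> \<open>For \<open>x\<close> in \<open>R\<close> the element \<open>y\<close> required
    by \<open>N_phi\<close> is \<open>\<phi> x\<close>.\<close>
  have "x \<in> normalizer (Grp F) R" "\<phi> x \<in> normalizer (Grp F) Q"
    using subgroup_normalizes Obj_subgroup R Q x Hom_maps[OF Iso_Hom[OF \<phi>] x] by blast+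
  then show "x \<in> N_phi F R Q \<phi>"
    using Hom_conj_by[OF Iso_Hom[OF \<phi>] x] by (auto simp: N_phi_def)
qed

end

section \<open>Extending isomorphisms onto \<open>Q\<close>\<close>

context stable_choice
begin

context
  fixes R \<phi>
  assumes \<phi>: "\<phi> \<in> Iso F R Q"
begin

lemma R_Obj: "R \<in> Obj F"
  using Iso_obj[OF \<phi>] by blast

lemma R_sub: "R \<subseteq> carrier (Grp F)"
  using R_Obj by (rule Obj_sub)

lemma N_phi_normalizer: "N_phi F R Q \<phi> \<subseteq> normalizer (Grp F) R"
  using N_phi_iff[OF \<phi>] by blast

lemma N_phi_sub: "N_phi F R Q \<phi> \<subseteq> carrier (Grp F)"
  using N_phi_subgroup[OF \<phi>] by (rule subgroup.subset)

text \<open>\<open>N_phi\<close> has to be closed to be the domain of a morphism. The effect of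
  \<open>transport R Q \<phi> x\<close> at level \<open>j\<close> depends only on
  \<open>a j x\<close>, so the levelwise characterization of \<open>Aut_S F Q\<close> in
  \<open>Aut_S_limit\<close> applies.\<close>

lemma N_phi_Obj: "N_phi F R Q \<phi> \<in> Obj F"
  unfolding Obj_char
proof (intro conjI ballI impI)
  show "subgroup (N_phi F R Q \<phi>) (Grp F)" by (rule N_phi_subgroup[OF \<phi>])
  fix x assume x: "x \<in> carrier (Grp F)" "\<forall>j\<in>J. a j x \<in> a j ` N_phi F R Q \<phi>"
  have xN: "x \<in> normalizer (Grp F) R"
    by (rule Obj_limit[OF normalizer_Obj[OF R_Obj] x(1)]) (use x(2) N_phi_normalizer in blast)
  have "transport R Q \<phi> x \<in> Aut_S F Q"
  proof (rule Aut_S_limit[OF Q transport_Iso[OF \<phi> xN]])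
    fix j assume j: "j \<in> J"
    obtain x' where x': "x' \<in> N_phi F R Q \<phi>" "a j x = a j x'" using x(2) j by blast
    have x'N: "x' \<in> normalizer (Grp F) R" "transport R Q \<phi> x' \<in> Aut_S F Q" using x'(1) N_phi_iff[OF \<phi>] by auto
    have x'c: "x' \<in> carrier (Grp F)" using x'(1) N_phi_sub by blast
    have "push (a j) Q (transport R Q \<phi> x) = push (a j) Q (transport R Q \<phi> x')"
      unfolding apush_eq_iff[OF j Iso_Hom[OF transport_Iso[OF \<phi> xN]] Iso_Hom[OF transport_Iso[OF \<phi> x'N(1)]]]
    proof
      fix v assume "v \<in> Q"
      then obtain u where u: "u \<in> R" "v = \<phi> u" using Iso_image[OF \<phi>] by blast
      have uc: "u \<in> carrier (Grp F)" using u R_sub by blast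
      have cu: "conj_by F x u \<in> R" "conj_by F x' u \<in> R"
        using xN x'N(1) normalizer_iff[OF R_sub] u(1) by blast+
      have "a j (conj_by F x u) = a j (conj_by F x' u)"
        using a_conj[OF j x(1) uc] a_conj[OF j x'c uc] x'(2) by simp
      then have "a j (\<phi> (conj_by F x u)) = a j (\<phi> (conj_by F x' u))"
        using apush(2)[OF j Iso_Hom[OF \<phi>] cu(1)] apush(2)[OF j Iso_Hom[OF \<phi>] cu(2)] by simp
      then show "a j (transport R Q \<phi> x v) = a j (transport R Q \<phi> x' v)"
        using transport_apply[OF \<phi> u(1)] u(2) by simp
    qed
    then show "push (a j) Q (transport R Q \<phi> x) \<in> push (a j) Q ` Aut_S F Q" using x'N(2) by blast
  qed
  then show "x \<in> N_phi F R Q \<phi>" using N_phi_iff[OF \<phi>] xN by blast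
qed

text \<open>
  The extension to \<open>N_phi\<close> is found at a good level \<open>m\<close>, where \<open>X m\<close> is receptive. The
  isomorphism \<open>\<zeta>\<close> onto \<open>X m\<close> need not carry the conjugations by \<open>N_phi\<close> into \<open>Aut_S\<close>, but it
  does so up to automorphisms that are trivial at level \<open>j\<close>, and Sylow's theorem corrects it by
  such an automorphism \<open>\<xi>\<close>.
\<close>

lemma level_extension:
  assumes j: "j \<in> J"
  shows "\<exists>\<psi>\<in>Hom (G j) (a j ` N_phi F R Q \<phi>) (a j ` normalizer (Grp F) Q). \<forall>u\<in>R. \<psi> (a j u) = a j (\<phi> u)"
proof -
  let ?N = "N_phi F R Q \<phi>"
  obtain m where m: "good j m" using good_cofinal[OF j j] by blast
  note g = goodD[OF m]
  interpret Gm: fusion_category "G m" by (rule Gcat[OF g(1)])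
  interpret Gj: fusion_category "G j" by (rule Gcat[OF j])
  have aR: "a m ` R \<subseteq> carrier (Grp (G m))" using Gm.Obj_subset[OF image_Obj[OF g(1) R_Obj]] .
  \<comment> \<open>The given isomorphism at level \<open>m\<close>, continued by
    \<open>\<eta> m\<close> to the subgroup \<open>X m\<close>, where receptivity is available. At
    level \<open>j\<close> it still induces \<phi>.\<close>
  define \<zeta> where "\<zeta> = compose (a m ` R) (\<eta> m) (push (a m) R \<phi>)"
  have \<zeta>: "\<zeta> \<in> Iso (G m) (a m ` R) (X m)"
    unfolding \<zeta>_def by (rule Gm.Iso_comp[OF apush_Iso[OF g(1) \<phi>] \<eta>_Iso[OF g(1)]])
  have f\<zeta>: "f j m (\<zeta> (a m u)) = a j (\<phi> u)" if u: "u \<in> R" for u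
  proof -
    have q: "\<phi> u \<in> Q" using Hom_in[OF Iso_Hom[OF \<phi>] u] .
    have "\<zeta> (a m u) = \<eta> m (a m (\<phi> u))"
      using apush(2)[OF g(1) Iso_Hom[OF \<phi>] u] u by (simp add: \<zeta>_def compose_def)
    then show ?thesis using f_\<eta>[OF j m, of "a m (\<phi> u)"] acomp[OF j g(1,2)] q Q_sub by auto
  qed
  define \<tau> where "\<tau> = Gm.transport (a m ` R) (X m) \<zeta>"
  let ?B = "Aut_group (G m) (X m)"
  interpret t: group_hom "(Grp (G m))\<lparr>carrier := normalizer (Grp (G m)) (a m ` R)\<rparr>" ?B \<tau>
    unfolding \<tau>_def by (rule Gm.transport_group_hom[OF \<zeta>])
  interpret h: group_hom ?B "Aut_group (G j) (f j m ` X m)" "push (f j m) (X m)"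
    by (rule fpush_group_hom[OF j g(1,2) X[OF g(1)]])
  have aN: "a m ` ?N \<in> Obj (G m)" by (rule image_Obj[OF g(1) N_phi_Obj])
  have aNn: "a m ` ?N \<subseteq> normalizer (Grp (G m)) (a m ` R)"
    using N_phi_normalizer a_normalizer[OF g(1) R_sub] by blast
  have aNs: "subgroup (a m ` ?N) ((Grp (G m))\<lparr>carrier := normalizer (Grp (G m)) (a m ` R)\<rparr>)"
    by (rule Gm.S.subgroup_incl[OF Gm.Obj_subgroup[OF aN] Gm.normalizer_subgroup[OF aR] aNn])
  define K where "K = \<tau> ` a m ` ?N"
  have K: "subgroup K ?B" unfolding K_def by (rule t.subgroup_img_is_subgroup[OF aNs])
  obtain l where l: "card K = p ^ l"
  proof -
    have "finite (a m ` ?N)" using Gm.Obj_subset[OF aN] Gfinite[OF g(1)] by (rule finite_subset)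
    from dvdI[OF t.card_hom_image[OF aNs this, symmetric]] have "card K dvd card (a m ` ?N)" by (simp only: K_def)
    moreover obtain n where "card (a m ` ?N) = p ^ n"
      using card_p_subgroup[OF g(1) Gm.Obj_subgroup[OF aN]] by blast
    ultimately show thesis using that divides_primepow_nat[OF p] by auto
  qed
  define U where "U = kernel ?B (Aut_group (G j) (f j m ` X m)) (push (f j m) (X m))"
  have U: "U \<lhd> ?B" unfolding U_def by (rule h.normal_kernel)
  have A: "subgroup (Aut_S (G m) (X m)) ?B" by (rule Gm.Aut_S_subgroup[OF X[OF g(1)]])
  \<comment> \<open>At level \<open>j\<close> the element \<open>k\<close> coincides with the
    transport of \<open>x\<close> along \<phi>, which belongs to \<open>Aut_S F Q\<close> as
    \<open>x\<close> is in \<open>N_phi\<close>. By \<open>push_Aut_S_eq\<close> it is also induced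
    by some \<alpha> in \<open>Aut_S (G m) (X m)\<close>, so \<open>k\<close> and \<alpha> differ by
    an element of \<open>U\<close>.\<close>
  have KAU: "\<exists>\<alpha>\<in>Aut_S (G m) (X m). k \<otimes>\<^bsub>?B\<^esub> inv\<^bsub>?B\<^esub> \<alpha> \<in> U" if k: "k \<in> K" for k
  proof -
    obtain x where x: "x \<in> ?N" "k = \<tau> (a m x)" using k by (auto simp: K_def)
    have xn: "x \<in> normalizer (Grp F) R" "transport R Q \<phi> x \<in> Aut_S F Q" using x(1) N_phi_iff[OF \<phi>] by auto
    have xc: "x \<in> carrier (Grp F)" using x(1) N_phi_sub by blast
    have kB: "k \<in> carrier ?B" using k subgroup.subset[OF K] by blast
    note tH = Iso_Hom[OF transport_Iso[OF \<phi> xn(1)]]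
    have eq: "push (f j m) (X m) k = push (a j) Q (transport R Q \<phi> x)"
    proof (rule push_eqI)
      show "push (a j) Q (transport R Q \<phi> x) \<in> extensional (f j m ` X m)"
        unfolding good_image_X[OF j m] using Gj.Hom_ext[OF apush(1)[OF j tH]] .
      fix v assume "v \<in> X m"
      then obtain u where u: "u \<in> R" "v = \<zeta> (a m u)" using Gm.Iso_image[OF \<zeta>] by blast
      have uc: "u \<in> carrier (Grp F)" using u R_sub by blast
      have cu: "conj_by F x u \<in> R" using xn(1) normalizer_iff[OF R_sub] u(1) by blast
      have "k v = \<zeta> (conj_by (G m) (a m x) (a m u))"
        using Gm.transport_apply[OF \<zeta>, of "a m u" "a m x"] u x(2) by (simp add: \<tau>_def)
      also have "\<dots> = \<zeta> (a m (conj_by F x u))" using a_conj[OF g(1) xc uc] by simp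
      finally have "f j m (k v) = a j (\<phi> (conj_by F x u))" using f\<zeta>[OF cu] by simp
      moreover have "push (a j) Q (transport R Q \<phi> x) (f j m v) = a j (\<phi> (conj_by F x u))"
        using f\<zeta>[OF u(1)] u(2) apush(2)[OF j tH Hom_in[OF Iso_Hom[OF \<phi>] u(1)]] transport_apply[OF \<phi> u(1)]
        by simp
      ultimately show "push (a j) Q (transport R Q \<phi> x) (f j m v) = f j m (k v)" by simp
    qed
    have "push (a j) Q (transport R Q \<phi> x) \<in> push (f j m) (X m) ` Aut_S (G m) (X m)"
      unfolding push_Aut_S_X[OF j m] push_Aut_S_eq[OF j, symmetric] using xn(2) by blast
    then obtain \<alpha> where \<alpha>: "\<alpha> \<in> Aut_S (G m) (X m)" "push (f j m) (X m) k = push (f j m) (X m) \<alpha>"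
      using eq by auto
    have \<alpha>B: "\<alpha> \<in> carrier ?B" using \<alpha>(1) subgroup.subset[OF A] by blast
    have "k \<otimes>\<^bsub>?B\<^esub> inv\<^bsub>?B\<^esub> \<alpha> \<in> U" using \<alpha>(2) kB \<alpha>B by (simp add: U_def kernel_def)
    then show ?thesis using \<alpha>(1) by blast
  qed
  have finB: "finite (carrier ?B)" unfolding Gm.carrier_Aut by (rule finite_Iso[OF g(1) X[OF g(1)]])
  have syl: "sylow_card p (card (Aut_S (G m) (X m))) (card (carrier ?B))"
    unfolding Gm.carrier_Aut by (rule Aut_S_sylow[OF g(1) X[OF g(1)] full[OF g(1)]])
  obtain \<xi> where \<xi>: "\<xi> \<in> U" "\<And>k. k \<in> K \<Longrightarrow> inv\<^bsub>?B\<^esub> \<xi> \<otimes>\<^bsub>?B\<^esub> k \<otimes>\<^bsub>?B\<^esub> \<xi> \<in> Aut_S (G m) (X m)"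
    using t.H.sylow_conjugate_in_normal[OF p finB A syl K l U KAU] by blast
  have \<xi>B: "\<xi> \<in> carrier ?B" using \<xi>(1) by (simp add: U_def kernel_def)
  \<comment> \<open>The correction is applied after \<zeta>, so the conjugating element enters
    through its inverse. This replaces \<open>K\<close> by its conjugate inside
    \<open>Aut_S (G m) (X m)\<close>.\<close>
  define \<kappa> where "\<kappa> = inv\<^bsub>?B\<^esub> \<xi>"
  have \<kappa>: "\<kappa> \<in> Iso (G m) (X m) (X m)" and \<xi>I: "\<xi> \<in> Iso (G m) (X m) (X m)"
    using \<xi>B t.H.inv_closed[OF \<xi>B] by (auto simp: \<kappa>_def Gm.carrier_Aut)
  have \<xi>\<kappa>: "\<xi> (\<kappa> v) = v" if "v \<in> X m" for v
    using Gm.inv_Aut_apply(2)[OF X[OF g(1)] \<xi>I that] by (simp add: \<kappa>_def)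
  have f\<kappa>: "f j m (\<kappa> v) = f j m v" if v: "v \<in> X m" for v
  proof -
    have kv: "\<kappa> v \<in> X m" using Gm.Hom_maps[OF Gm.Iso_Hom[OF \<kappa>] v] .
    have "push (f j m) (X m) \<xi> = (\<lambda>w\<in>f j m ` X m. w)"
      using \<xi>(1) Gj.one_Aut by (simp add: U_def kernel_def)
    then have "f j m (\<xi> (\<kappa> v)) = f j m (\<kappa> v)"
      using fpush(2)[OF j g(1,2) Gm.Iso_Hom[OF \<xi>I] kv] kv by simp
    then show ?thesis using \<xi>\<kappa>[OF v] by simp
  qed
  define \<zeta>' where "\<zeta>' = compose (a m ` R) \<kappa> \<zeta>"
  have \<zeta>': "\<zeta>' \<in> Iso (G m) (a m ` R) (X m)" unfolding \<zeta>'_def by (rule Gm.Iso_comp[OF \<zeta> \<kappa>])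
  have sub: "a m ` ?N \<subseteq> N_phi (G m) (a m ` R) (X m) \<zeta>'"
  proof
    fix y assume y: "y \<in> a m ` ?N"
    have yn: "y \<in> normalizer (Grp (G m)) (a m ` R)" using y aNn by blast
    have "Gm.transport (a m ` R) (X m) \<zeta>' y = compose (X m) (compose (X m) \<kappa> (\<tau> y)) \<xi>"
    proof (rule Gm.eq_on_Iso_image[OF \<zeta>'])
      show "Gm.transport (a m ` R) (X m) \<zeta>' y \<in> extensional (X m)" by (simp add: Gm.transport_def)
      show "compose (X m) (compose (X m) \<kappa> (\<tau> y)) \<xi> \<in> extensional (X m)" by simp
      fix w assume w: "w \<in> a m ` R"
      have \<zeta>w: "\<zeta> w \<in> X m" "\<zeta>' w \<in> X m" using Gm.Hom_maps[OF Gm.Iso_Hom] \<zeta> \<zeta>' w by blast+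
      have cw: "conj_by (G m) y w \<in> a m ` R" using yn Gm.normalizer_iff[OF aR] w by blast
      have "\<xi> (\<zeta>' w) = \<zeta> w" using \<xi>\<kappa>[OF \<zeta>w(1)] w by (simp add: \<zeta>'_def compose_def)
      moreover have "\<tau> y (\<zeta> w) = \<zeta> (conj_by (G m) y w)" unfolding \<tau>_def by (rule Gm.transport_apply[OF \<zeta> w])
      moreover have "\<zeta>' (conj_by (G m) y w) = \<kappa> (\<zeta> (conj_by (G m) y w))" using cw by (simp add: \<zeta>'_def compose_def)
      ultimately show "Gm.transport (a m ` R) (X m) \<zeta>' y (\<zeta>' w) = compose (X m) (compose (X m) \<kappa> (\<tau> y)) \<xi> (\<zeta>' w)"
        using Gm.transport_apply[OF \<zeta>' w, of y] \<zeta>w by (simp add: compose_def)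
    qed
    moreover have "\<tau> y \<in> K" using y by (auto simp: K_def)
    ultimately have "Gm.transport (a m ` R) (X m) \<zeta>' y \<in> Aut_S (G m) (X m)"
      using \<xi>(2)[of "\<tau> y"] by (simp add: \<kappa>_def Gm.mult_Aut)
    then show "y \<in> N_phi (G m) (a m ` R) (X m) \<zeta>'" using Gm.N_phi_iff[OF \<zeta>'] yn by blast
  qed
  have "receptive (G m) (X m)" using full[OF g(1)] by (simp add: fully_normalized_def)
  then obtain \<psi> where \<psi>: "\<psi> \<in> Hom (G m) (N_phi (G m) (a m ` R) (X m) \<zeta>') (N m)" "\<forall>w\<in>a m ` R. \<psi> w = \<zeta>' w"
    using \<zeta>' image_Obj[OF g(1) R_Obj] unfolding receptive_def by blast
  define \<psi>' where "\<psi>' = restrict \<psi> (a m ` ?N)"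
  have \<psi>': "\<psi>' \<in> Hom (G m) (a m ` ?N) (N m)" unfolding \<psi>'_def by (rule Gm.Hom_restrict[OF \<psi>(1) aN sub])
  have h1: "push (f j m) (a m ` ?N) \<psi>' \<in> Hom (G j) (a j ` ?N) (M j)"
    using fpush(1)[OF j g(1,2) \<psi>'] f_image_a[OF j g(1,2) N_phi_sub] g(4) by simp
  \<comment> \<open>The extension takes values in \<open>M j\<close>, the image of the normalizer of
    \<open>X m\<close>. The lifting property of \<open>M j\<close> places these values in the image
    of the normalizer of \<open>Q\<close>.\<close>
  have "M j \<subseteq> a j ` normalizer (Grp F) Q" using M_lift[OF j] by blast
  then have "push (f j m) (a m ` ?N) \<psi>' \<in> Hom (G j) (a j ` ?N) (a j ` normalizer (Grp F) Q)"
    using Gj.Hom_maps[OF h1] by (intro Gj.Hom_change[OF h1 image_Obj[OF j normalizer_Obj[OF Q]]]) blast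
  moreover have "push (f j m) (a m ` ?N) \<psi>' (a j u) = a j (\<phi> u)" if u: "u \<in> R" for u
  proof -
    have uN: "u \<in> ?N" using subset_N_phi[OF \<phi>] u by blast
    have "push (f j m) (a m ` ?N) \<psi>' (f j m (a m u)) = f j m (\<psi>' (a m u))"
      using fpush(2)[OF j g(1,2) \<psi>', of "a m u"] uN by simp
    moreover have "f j m (a m u) = a j u" using acomp[OF j g(1,2)] u R_sub by blast
    moreover have "\<psi>' (a m u) = \<kappa> (\<zeta> (a m u))" using \<psi>(2) u uN by (simp add: \<psi>'_def \<zeta>'_def compose_def)
    moreover have "f j m (\<kappa> (\<zeta> (a m u))) = a j (\<phi> u)"
      using f\<kappa>[OF Gm.Hom_maps[OF Gm.Iso_Hom[OF \<zeta>], of "a m u"]] f\<zeta>[OF u] u by simp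
    ultimately show ?thesis by simp
  qed
  ultimately show ?thesis by blast
qed

lemma extension:
  "\<exists>\<psi>\<in>Hom F (N_phi F R Q \<phi>) (normalizer (Grp F) Q). \<forall>u\<in>R. \<psi> u = \<phi> u"
proof -
  let ?N = "N_phi F R Q \<phi>" and ?M = "normalizer (Grp F) Q"
  \<comment> \<open>The restriction to \<open>R\<close> is prescribed at every level, so that the
    limit of a compatible choice restricts to \<phi>.\<close>
  define E where "E = (\<lambda>j. {\<psi> \<in> Hom (G j) (a j ` ?N) (a j ` ?M). \<forall>u\<in>R. \<psi> (a j u) = a j (\<phi> u)})"
  have RN: "R \<subseteq> ?N" by (rule subset_N_phi[OF \<phi>])
  have MO: "?M \<in> Obj F" by (rule normalizer_Obj[OF Q])
  have "\<exists>x. (\<forall>j\<in>J. x j \<in> E j) \<and> (\<forall>i\<in>J. \<forall>j\<in>J. r i j \<longrightarrow> push (f i j) (a j ` ?N) (x j) = x i)"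
  proof (rule finite_inverse_limit_nonempty[OF dir, of E "\<lambda>i j. push (f i j) (a j ` ?N)"])
    fix j assume j: "j \<in> J"
    show "finite (E j)" using finite_Hom[OF j image_Obj[OF j N_phi_Obj]] by (simp add: E_def)
    show "E j \<noteq> {}" using level_extension[OF j] by (auto simp: E_def)
  next
    fix i j \<psi> assume ij: "i \<in> J" "j \<in> J" "r i j" and "\<psi> \<in> E j"
    then have \<psi>: "\<psi> \<in> Hom (G j) (a j ` ?N) (a j ` ?M)" "\<And>u. u \<in> R \<Longrightarrow> \<psi> (a j u) = a j (\<phi> u)"
      by (auto simp: E_def)
    have "push (f i j) (a j ` ?N) \<psi> (a i u) = a i (\<phi> u)" if u: "u \<in> R" for u
    proof -
      have "\<phi> u \<in> carrier (Grp F)" using Hom_in[OF Iso_Hom[OF \<phi>] u] Q_sub by blast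
      moreover have "f i j (a j u) = a i u" using acomp[OF ij] u R_sub by blast
      moreover have "push (f i j) (a j ` ?N) \<psi> (f i j (a j u)) = f i j (\<psi> (a j u))"
        using fpush(2)[OF ij \<psi>(1)] u RN by blast
      ultimately show ?thesis using \<psi>(2)[OF u] acomp[OF ij] by simp
    qed
    then show "push (f i j) (a j ` ?N) \<psi> \<in> E i"
      using fpush(1)[OF ij \<psi>(1)] f_image_a[OF ij N_phi_sub] f_image_a[OF ij Obj_sub[OF MO]] by (simp add: E_def)
  next
    fix i j k \<psi> assume ij: "i \<in> J" "j \<in> J" "k \<in> J" "r i j" "r j k" and "\<psi> \<in> E k"
    then have \<psi>: "\<psi> \<in> Hom (G k) (a k ` ?N) (a k ` ?M)" by (simp add: E_def)
    show "push (f i j) (a j ` ?N) (push (f j k) (a k ` ?N) \<psi>) = push (f i k) (a k ` ?N) \<psi>"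
      using push_push[OF ij \<psi>] f_image_a[OF ij(2,3,5) N_phi_sub] by simp
  qed
  then obtain x where x: "\<And>j. j \<in> J \<Longrightarrow> x j \<in> E j"
    "\<And>i j. \<lbrakk>i \<in> J; j \<in> J; r i j\<rbrakk> \<Longrightarrow> push (f i j) (a j ` ?N) (x j) = x i" by blast
  have xH: "x j \<in> Hom (G j) (a j ` ?N) (a j ` ?M)" if "j \<in> J" for j using x(1)[OF that] by (simp add: E_def)
  have "f i j (x j (a j u)) = x i (a i u)" if ij: "i \<in> J" "j \<in> J" "r i j" and u: "u \<in> ?N" for i j u
  proof -
    have "push (f i j) (a j ` ?N) (x j) (f i j (a j u)) = f i j (x j (a j u))"
      using fpush(2)[OF ij xH[OF ij(2)]] u by blast
    moreover have "f i j (a j u) = a i u" using acomp[OF ij] u N_phi_sub by blast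
    ultimately show ?thesis using x(2)[OF ij] by simp
  qed
  from Hom_complete[of ?N ?M x, OF N_phi_Obj MO xH this]
  obtain \<psi> where \<psi>: "\<psi> \<in> Hom F ?N ?M" "\<forall>j\<in>J. \<forall>u\<in>?N. a j (\<psi> u) = x j (a j u)" by blast
  have "\<psi> u = \<phi> u" if u: "u \<in> R" for u
  proof (rule asep)
    have uN: "u \<in> ?N" using u RN by blast
    show "\<psi> u \<in> carrier (Grp F)" using Hom_in[OF \<psi>(1) uN] Obj_sub[OF MO] by blast
    show "\<phi> u \<in> carrier (Grp F)" using Hom_in[OF Iso_Hom[OF \<phi>] u] Q_sub by blast
    show "a j (\<psi> u) = a j (\<phi> u)" if j: "j \<in> J" for j using \<psi>(2) j uN x(1)[OF j] u by (simp add: E_def)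
  qed
  then show ?thesis using \<psi>(1) by blast
qed

end

lemma fully_normalized_Q: "fully_normalized p F Q"
  unfolding fully_normalized_def receptive_def using extension Aut_S_sylow_pro_p by blast

end

theorem (in saturated_limit) saturated: "saturated p F"
  unfolding saturated_def
proof
  fix P assume "P \<in> Obj F"
  from stable_choice_exists[OF this] obtain X \<theta> \<Theta> M
    where "stable_choice p F J r G f a P X \<theta> \<Theta> M" by blast
  then interpret stable_choice p F J r G f a P X \<theta> \<Theta> M .
  show "\<exists>Q\<in>Obj F. Iso F P Q \<noteq> {} \<and> fully_normalized p F Q"
    using Q limit_map_Iso fully_normalized_Q by blast
qed

theorem theorem5p2:
  fixes p :: nat and \<F> :: "('i \<Rightarrow> 'a) fusion"
  assumes "prime p"
    and "pro_fusion_system p \<F>"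
    and "pro_saturated TYPE('j) TYPE('b) p \<F>"
    and "countably_based TYPE('c) p \<F>"
  shows "saturated p \<F>"
proof -
  obtain I s H h B where H: "inverse_system p I s H h B" "\<F> = inverse_limit I s H h B"
    using assms(2) by (auto simp: pro_fusion_system_def)
  obtain J :: "'j set" and r and G :: "'j \<Rightarrow> 'b fusion" and f A where G: "inverse_system p J r G f A"
    "\<And>j. j \<in> J \<Longrightarrow> saturated p (G j)" "fusion_isomorphic \<F> (inverse_limit J r G f A)"
    using assms(3) by (auto simp: pro_saturated_def)
  \<comment> \<open>The system \<open>H\<close> defines the topologies of \<open>\<F>\<close>, and
    the system \<open>G\<close> brings saturation. The isomorphism makes \<open>G\<close> a
    presentation of \<open>\<F>\<close> itself.\<close>
  have 1: "fusion_limit p \<F> I s H h (\<lambda>i x. x i)"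
    unfolding H(2) by (rule fusion_inverse_system.fusion_limit_L) (rule fusion_inverse_system.intro[OF H(1)])
  have 2: "fusion_limit p (inverse_limit J r G f A) J r G f (\<lambda>j x. x j)"
    by (rule fusion_inverse_system.fusion_limit_L) (rule fusion_inverse_system.intro[OF G(1)])
  obtain a where "fusion_limit p \<F> J r G f a" using fusion_limit_isomorphic[OF 1 2 G(3)] by blast
  then interpret saturated_limit p \<F> J r G f a
    using assms(1) G(2) by (simp add: saturated_limit_def saturated_limit_axioms_def)
  show ?thesis by (rule saturated)
qed

end
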